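(* There exists a universal constant $c > 0$ such that for every $n \geq 1$ and every probability measure $\mu$ on $\mathbb{R}^n$ with isotropic log-concave density, $$D_{Che}(\mu) \geq c\, n^{-\frac{5}{12}} .$$
   Context: A function $g:\mathbb{R}^n \to [0,\infty)$ is log-concave if $-\log g : \mathbb{R}^n \to \mathbb{R} \cup \{+\infty\}$ is convex. A density is isotropic if a random vector $X$ with this density satisfies $\mathbb{E} X = 0$ and $\mathbb{E}\, X \otimes X = \mathrm{Id}$. The Cheeger (isoperimetric) constant $D_{Che}(\mu)$ of a probability measure $\mu$ on Euclidean space $\mathbb{R}^n$ is the largest $D \geq 0$ such that $\mu^+(S) \geq D \min(\mu(S), 1-\mu(S))$ for every Borel set $S \subset \mathbb{R}^n$, where $\mu^+(S) := \liminf_{\varepsilon \to 0^+} \frac{\mu(S_\varepsilon) - \mu(S)}{\varepsilon}$ is the outer Minkowski boundary measure and $S_\varepsilon := \{x : \exists y \in S,\ |x-y| < \varepsilon\}$. "Universal constant" means a numeric constant independent of all other parameters. *)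

theory Defs
  imports "HOL-Probability.Probability"
begin

text \<open>
  The dimension is quantified inside the statement (the constant must not depend on it), so
  \<open>\<real>\<^sup>n\<close> is the product of \<open>n\<close> copies of \<open>lborel\<close>: its points are the functions on
  \<open>{..<n}\<close> (extensional, that is, \<open>undefined\<close> elsewhere) and its measurable sets are the
  Borel sets of \<open>\<real>\<^sup>n\<close>.
\<close>

abbreviation lborel_pow :: "nat \<Rightarrow> (nat \<Rightarrow> real) measure" where
  "lborel_pow n \<equiv> Pi\<^sub>M {..<n} (\<lambda>_. lborel)"

definition eucl_dist :: "nat \<Rightarrow> (nat \<Rightarrow> real) \<Rightarrow> (nat \<Rightarrow> real) \<Rightarrow> real" where
  "eucl_dist n x y = L2_set (\<lambda>i. x i - y i) {..<n}"

definition neg_log :: "real \<Rightarrow> ereal" where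
  "neg_log r = (if r = 0 then \<infinity> else ereal (- ln r))"

text \<open>
  The value \<open>-\<infinity>\<close> does not occur below, and \<open>0 * \<infinity> = 0\<close> in \<^typ>\<open>ereal\<close>, so the end points
  \<open>t = 0\<close> and \<open>t = 1\<close> impose no condition.
\<close>

definition convex_ereal :: "nat \<Rightarrow> ((nat \<Rightarrow> real) \<Rightarrow> ereal) \<Rightarrow> bool" where
  "convex_ereal n f \<longleftrightarrow>
    (\<forall>x\<in>space (lborel_pow n). \<forall>y\<in>space (lborel_pow n). \<forall>t\<in>{0..1::real}.
      f (\<lambda>i\<in>{..<n}. (1 - t) * x i + t * y i) \<le> ereal (1 - t) * f x + ereal t * f y)"

definition log_concave_fun :: "nat \<Rightarrow> ((nat \<Rightarrow> real) \<Rightarrow> real) \<Rightarrow> bool" where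
  "log_concave_fun n g \<longleftrightarrow>
    (\<forall>x\<in>space (lborel_pow n). 0 \<le> g x) \<and> convex_ereal n (\<lambda>x. neg_log (g x))"

text \<open>
  Asking for a Borel density excludes no measure: a log-concave density, which is a priori only
  Lebesgue measurable, agrees almost everywhere with its upper semicontinuous regularisation,
  which is Borel and again log-concave.
\<close>

definition has_density :: "nat \<Rightarrow> (nat \<Rightarrow> real) measure \<Rightarrow> ((nat \<Rightarrow> real) \<Rightarrow> real) \<Rightarrow> bool" where
  "has_density n M g \<longleftrightarrow>
    g \<in> borel_measurable (lborel_pow n) \<and> M = density (lborel_pow n) (\<lambda>x. ennreal (g x))"

definition isotropic :: "nat \<Rightarrow> (nat \<Rightarrow> real) measure \<Rightarrow> bool" where
  "isotropic n M \<longleftrightarrow>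
    (\<forall>i<n. has_bochner_integral M (\<lambda>x. x i) 0) \<and>
    (\<forall>i<n. \<forall>j<n. has_bochner_integral M (\<lambda>x. x i * x j) (if i = j then 1 else 0))"

definition open_nbhd :: "nat \<Rightarrow> real \<Rightarrow> (nat \<Rightarrow> real) set \<Rightarrow> (nat \<Rightarrow> real) set" where
  "open_nbhd n \<epsilon> S = {x \<in> space (lborel_pow n). \<exists>y\<in>S. eucl_dist n x y < \<epsilon>}"

definition boundary_measure :: "nat \<Rightarrow> (nat \<Rightarrow> real) measure \<Rightarrow> (nat \<Rightarrow> real) set \<Rightarrow> ereal" where
  "boundary_measure n M S =
    Liminf (at_right 0) (\<lambda>\<epsilon>. ereal ((measure M (open_nbhd n \<epsilon> S) - measure M S) / \<epsilon>))"

definition isoperimetric_bound :: "nat \<Rightarrow> (nat \<Rightarrow> real) measure \<Rightarrow> ereal \<Rightarrow> bool" where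
  "isoperimetric_bound n M D \<longleftrightarrow>
    0 \<le> D \<and> (\<forall>S\<in>sets (lborel_pow n).
      D * ereal (min (measure M S) (1 - measure M S)) \<le> boundary_measure n M S)"

text \<open>
  The supremum is taken in \<^typ>\<open>ereal\<close>, where it is a maximum for every probability measure
  (\<open>cheeger_const_greatest\<close>); it is \<open>\<infinity>\<close> for a Dirac measure, for instance.
\<close>

definition cheeger_const :: "nat \<Rightarrow> (nat \<Rightarrow> real) measure \<Rightarrow> ereal" where
  "cheeger_const n M = Sup {D. isoperimetric_bound n M D}"

lemma eucl_dist_triangle: "eucl_dist n x z \<le> eucl_dist n x y + eucl_dist n y z"
  using L2_set_triangle_ineq[of "\<lambda>i. x i - y i" "\<lambda>i. y i - z i" "{..<n}"]
  by (simp add: eucl_dist_def)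

lemma eucl_dist_commute: "eucl_dist n x y = eucl_dist n y x"
  by (simp add: eucl_dist_def L2_set_def power2_commute)

lemma eucl_dist_rational_approx:
  assumes "0 < \<delta>"
  obtains q where "q \<in> PiE {..<n} (\<lambda>_. \<rat>)" "eucl_dist n x q < \<delta>"
proof -
  have pos: "0 < \<delta> / (real n + 1)"
    using assms by simp
  have "\<exists>r\<in>\<rat>. x i < r \<and> r < x i + \<delta> / (real n + 1)" for i
    using Rats_dense_in_real[of "x i" "x i + \<delta> / (real n + 1)"] pos by auto
  then obtain f where f: "\<And>i. f i \<in> \<rat>" "\<And>i. x i < f i" "\<And>i. f i < x i + \<delta> / (real n + 1)"
    by metis
  define q where "q = restrict f {..<n}"
  have "eucl_dist n x q \<le> (\<Sum>i<n. \<bar>x i - q i\<bar>)"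
    unfolding eucl_dist_def by (rule L2_set_le_sum_abs)
  also have "\<dots> \<le> (\<Sum>i<n. \<delta> / (real n + 1))"
  proof (rule sum_mono)
    fix i assume "i \<in> {..<n}"
    then show "\<bar>x i - q i\<bar> \<le> \<delta> / (real n + 1)"
      using f(2)[of i] f(3)[of i] by (simp add: q_def)
  qed
  also have "\<dots> < \<delta>"
    using assms by (simp add: field_simps)
  finally have "eucl_dist n x q < \<delta>" .
  moreover have "q \<in> PiE {..<n} (\<lambda>_. \<rat>)"
    using f(1) by (auto simp: q_def)
  ultimately show thesis
    using that by blast
qed

lemma open_nbhd_measurable:
  assumes "S \<subseteq> space (lborel_pow n)"
  shows "open_nbhd n \<epsilon> S \<in> sets (lborel_pow n)"
proof -
  let ?Q = "PiE {..<n} (\<lambda>_. \<rat> :: real set)"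
  let ?R = "\<lambda>q. {r \<in> \<rat>. \<exists>y\<in>S. eucl_dist n q y < \<epsilon> - r}"
  let ?B = "\<lambda>q r. {x \<in> space (lborel_pow n). eucl_dist n x q < r}"
  have eq: "open_nbhd n \<epsilon> S = (\<Union>q\<in>?Q. \<Union>r\<in>?R q. ?B q r)"
  proof (intro set_eqI iffI)
    fix x assume "x \<in> open_nbhd n \<epsilon> S"
    then obtain y where x: "x \<in> space (lborel_pow n)" and y: "y \<in> S" "eucl_dist n x y < \<epsilon>"
      by (auto simp: open_nbhd_def)
    define \<delta> where "\<delta> = (\<epsilon> - eucl_dist n x y) / 2"
    have "0 < \<delta>"
      using y by (simp add: \<delta>_def)
    obtain r where r: "r \<in> \<rat>" "0 < r" "r < \<delta>"
      using Rats_dense_in_real[OF \<open>0 < \<delta>\<close>] by auto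
    obtain q where q: "q \<in> ?Q" "eucl_dist n x q < r"
      using eucl_dist_rational_approx[OF r(2)] by blast
    have "eucl_dist n q y \<le> eucl_dist n x q + eucl_dist n x y"
      using eucl_dist_triangle[of n q y x] by (simp add: eucl_dist_commute)
    also have "\<dots> < r + (\<epsilon> - 2 * \<delta>)"
      using q by (simp add: \<delta>_def field_simps)
    also have "\<dots> < \<epsilon> - r"
      using r by simp
    finally have "r \<in> ?R q"
      using r(1) y(1) by blast
    then show "x \<in> (\<Union>q\<in>?Q. \<Union>r\<in>?R q. ?B q r)"
      using q x by blast
  next
    fix x assume "x \<in> (\<Union>q\<in>?Q. \<Union>r\<in>?R q. ?B q r)"
    then obtain q r y where x: "x \<in> space (lborel_pow n)" "eucl_dist n x q < r"
      and y: "y \<in> S" "eucl_dist n q y < \<epsilon> - r"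
      by blast
    have "eucl_dist n x y < \<epsilon>"
      using eucl_dist_triangle[of n x y q] x y by linarith
    then show "x \<in> open_nbhd n \<epsilon> S"
      using x y by (auto simp: open_nbhd_def)
  qed
  have "countable ?Q"
    by (intro countable_PiE) (auto simp: countable_rat)
  moreover have "countable (?R q)" for q
    by (rule countable_subset[OF _ countable_rat]) auto
  moreover have "?B q r \<in> sets (lborel_pow n)" for q r
    unfolding eucl_dist_def L2_set_def by measurable
  ultimately show ?thesis
    unfolding eq by (intro sets.countable_UN' ) auto
qed

lemma boundary_measure_nonneg:
  assumes "prob_space M" "sets M = sets (lborel_pow n)" "S \<in> sets (lborel_pow n)"
  shows "0 \<le> boundary_measure n M S"
proof -
  interpret prob_space M by fact
  have S: "S \<subseteq> space (lborel_pow n)"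
    using assms(3) by (rule sets.sets_into_space)
  have "0 \<le> (measure M (open_nbhd n \<epsilon> S) - measure M S) / \<epsilon>" if "0 < \<epsilon>" for \<epsilon>
  proof -
    have "S \<subseteq> open_nbhd n \<epsilon> S"
      using S that by (auto simp: open_nbhd_def eucl_dist_def L2_set_def intro!: bexI)
    then have "measure M S \<le> measure M (open_nbhd n \<epsilon> S)"
      using open_nbhd_measurable[OF S] assms(2) by (intro finite_measure_mono) auto
    with that show ?thesis by simp
  qed
  then show ?thesis
    unfolding boundary_measure_def
    by (intro Liminf_bounded) (auto simp: eventually_at_right_less intro: eventually_at_rightI[of 0 1])
qed

lemma cheeger_const_greatest:
  assumes "prob_space M" "sets M = sets (lborel_pow n)"
  shows "isoperimetric_bound n M (cheeger_const n M)"
    and "\<And>D. isoperimetric_bound n M D \<Longrightarrow> D \<le> cheeger_const n M"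
proof -
  interpret prob_space M by fact
  let ?A = "{D. isoperimetric_bound n M D}"
  have zero: "0 \<in> ?A"
    using boundary_measure_nonneg[OF assms] by (simp add: isoperimetric_bound_def)
  then have nonneg: "0 \<le> Sup ?A"
    by (rule Sup_upper)
  have "Sup ?A * ereal (min (measure M S) (1 - measure M S)) \<le> boundary_measure n M S"
    if S: "S \<in> sets (lborel_pow n)" for S
  proof -
    have m: "0 \<le> min (measure M S) (1 - measure M S)"
      by simp
    have "Sup ?A * ereal (min (measure M S) (1 - measure M S)) =
        (SUP D\<in>?A. D * ereal (min (measure M S) (1 - measure M S)))"
      using Sup_ereal_mult_right'[of ?A _ "\<lambda>D. D", OF _ m] zero by (auto simp: image_def)
    also have "\<dots> \<le> boundary_measure n M S"
      using S by (intro SUP_least) (auto simp: isoperimetric_bound_def)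
    finally show ?thesis .
  qed
  with nonneg show "isoperimetric_bound n M (cheeger_const n M)"
    by (simp add: isoperimetric_bound_def cheeger_const_def)
  show "D \<le> cheeger_const n M" if "isoperimetric_bound n M D" for D
    using that by (auto simp: cheeger_const_def intro: Sup_upper)
qed

end

theory Submission
  imports Defs
begin

text \<open>
  A weight is a log-concave probability density on a cube. If \<open>l\<close> is small, affine and of mean zero, the
  tilts of a weight by the factors \<open>1 + l\<close> and \<open>1 - l\<close> are weights again, and their average is the
  original one. Such pairs of tilts play the role of the bisections in needle localisation and of the
  Brownian increments in stochastic localisation.

  Tilting only along affine functions uncorrelated with a given \<open>f\<close> keeps the mean of \<open>f\<close> and drives the
  covariance towards rank one, so an inequality between expectations has to be checked on nearly
  one-dimensional weights only. On such a needle of standard deviation \<open>\<sigma>\<close>, isoperimetry holds at scale \<open>\<sigma>\<close>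
  and the variance of \<open>norm x ^ 2\<close> is at least a multiple of \<open>\<sigma> ^ 4\<close>; this gives Bobkov's bound of the
  Cheeger constant from below by a multiple of \<open>V powr (-1/4)\<close>, where \<open>V\<close> is the variance of \<open>norm x ^ 2\<close>.

  Tilting along the coordinates up to time \<open>t\<close> makes the weight \<open>t\<close>-strongly log-concave; then the variance of
  \<open>norm x ^ 2\<close> is at most a multiple of \<open>n / t\<close>, again by needles. Meanwhile this variance decreases at a
  relative rate of at most the Hilbert-Schmidt norm of the covariance, which starts near \<open>n powr (1/2)\<close> and
  exceeds \<open>n powr (2/3)\<close> before time \<open>n powr (-2/3)\<close> with small probability only. Hence \<open>V\<close> is at most a
  multiple of \<open>n powr (5/3)\<close>.
\<close>

text \<open>The exponent comes from a balance in the level \<open>lam\<close> allowed for the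
  Hilbert-Schmidt norm of the covariance. While the norm stays below \<open>lam\<close>, tilting may
  go on for a time of order \<open>1 / lam\<close> before half of the variance is lost, and strong
  log-concavity then leaves a variance of order \<open>n * lam\<close>. The fourth power of the norm
  starts at order \<open>n ^ 2\<close> and grows by a constant factor only, so the level is passed
  with probability of order \<open>n ^ 2 / lam ^ 4\<close>; Cauchy-Schwarz with the fourth moment
  \<open>n ^ 4\<close> of \<open>norm x ^ 2\<close> charges this event
  \<open>n ^ 3 / lam ^ 2\<close>. Both orders agree for \<open>lam = n powr (2/3)\<close>, and the
  power \<open>-1/4\<close> of \<open>n powr (5/3)\<close> is the claimed rate.

  Neither a stochastic process nor a decomposition into needles is constructed. A supremum over
  weights replaces the decomposition, a path of children no worse than average replaces the process,
  and both rest on identities for one symmetric pair of tilts. The cube keeps \<open>1 + l\<close>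
  positive. The error terms that depend on it carry the defect or the step size as a factor and
  vanish in the end.\<close>

section \<open>The Prekopa-Leindler inequality for midpoints\<close>

text \<open>Supplies the exhaustion for Brunn-Minkowski on the line: cutting a set at its own points
  replaces approximation by compact sets. If there is no maximum, \<open>c\<close> picks for the
  \<open>k\<close>-th rational a point of \<open>A\<close> above it where possible, and running
  maxima make the choice increasing.\<close>

lemma cofinal_seq:
  fixes A :: "real set"
  assumes "A \<noteq> {}"
  obtains f :: "nat \<Rightarrow> real" where "incseq f" "range f \<subseteq> A" "\<And>a. a \<in> A \<Longrightarrow> \<exists>k. a \<le> f k"
proof (cases "\<exists>m\<in>A. \<forall>a\<in>A. a \<le> m")
  case True
  then obtain m where "m \<in> A" "\<forall>a\<in>A. a \<le> m" by blast
  then show thesis using that[of "\<lambda>_. m"] by (auto simp: incseq_def)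
next
  case False
  obtain a0 where a0: "a0 \<in> A" using assms by blast
  define c where "c = (\<lambda>k. let q = real_of_rat (from_nat k) in if \<exists>a\<in>A. q \<le> a then (SOME a. a \<in> A \<and> q \<le> a) else a0)"
  have cA: "c k \<in> A" for k
    unfolding c_def Let_def using a0 someI_ex[of "\<lambda>a. a \<in> A \<and> real_of_rat (from_nat k) \<le> a"] by auto
  define f where "f k = Max (c ` {..k})" for k
  have "f k \<in> A" for k
  proof -
    have "f k \<in> c ` {..k}" unfolding f_def by (intro Max_in) auto
    then show ?thesis using cA by auto
  qed
  moreover have "incseq f"
    unfolding f_def by (intro incseq_SucI Max_mono) auto
  moreover have "\<exists>k. a \<le> f k" if "a \<in> A" for a
  proof -
    obtain b where b: "b \<in> A" "a < b" using False \<open>a \<in> A\<close> by (meson not_le)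
    obtain q where q: "a < real_of_rat q" "real_of_rat q < b" using of_rat_dense[OF b(2)] by blast
    define k where "k = to_nat q"
    have qk: "real_of_rat (from_nat k) = real_of_rat q" by (simp add: k_def)
    have "\<exists>a\<in>A. real_of_rat q \<le> a" using b(1) q(2) less_imp_le by blast
    then have "real_of_rat q \<le> c k"
      unfolding c_def Let_def qk using someI_ex[of "\<lambda>a. a \<in> A \<and> real_of_rat q \<le> a"] by auto
    also have "c k \<le> f k" unfolding f_def by (intro Max_ge) auto
    finally show ?thesis using q by (intro exI[of _ k]) linarith
  qed
  ultimately show thesis using that[of f] by blast
qed

lemma emeasure_half_affine:
  assumes [measurable]: "C \<in> sets borel"
  shows "emeasure lborel {x::real. (x + b) / 2 \<in> C} = 2 * emeasure lborel C"
proof -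
  have m: "{x::real. (x + b) / 2 \<in> C} \<in> sets lborel"
    by measurable
  have "emeasure lborel C = (\<integral>\<^sup>+x. indicator C x \<partial>lborel)" by simp
  also have "\<dots> = ennreal (1/2) * (\<integral>\<^sup>+x. indicator C (b/2 + (1/2) * x) \<partial>lborel)"
    by (subst nn_integral_real_affine[where c="1/2" and t="b/2"]) auto
  also have "(\<integral>\<^sup>+x. indicator C (b/2 + (1/2) * x) \<partial>lborel) = (\<integral>\<^sup>+x. indicator {x::real. (x + b) / 2 \<in> C} x \<partial>lborel)"
    by (intro nn_integral_cong) (auto simp: indicator_def add_divide_distrib add.commute)
  also have "\<dots> = emeasure lborel {x::real. (x + b) / 2 \<in> C}" using m by simp
  finally have e: "emeasure lborel C = ennreal (1/2) * emeasure lborel {x::real. (x + b) / 2 \<in> C}" .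
  have "2 * emeasure lborel C = (2 * ennreal (1/2)) * emeasure lborel {x::real. (x + b) / 2 \<in> C}"
    unfolding e by (simp add: mult.assoc)
  also have "2 * ennreal (1/2) = 1"
    by (metis (no_types, opaque_lifting) ennreal_1 ennreal_mult ennreal_numeral half_gt_zero_iff less_eq_real_def mult.commute nonzero_eq_divide_eq order.order_iff_strict zero_less_numeral zero_less_one zero_neq_numeral divide_nonneg_nonneg zero_le_one)
  finally show ?thesis by simp
qed

text \<open>Translating the part of \<open>A\<close> below \<open>a\<close> by some \<open>b \<in> B\<close>, and the part of \<open>B\<close> above \<open>b\<close> by \<open>a\<close>,
  gives two subsets of \<open>A + B\<close> that share only the point \<open>a + b\<close>.\<close>

lemma brunn_minkowski_real_half:
  fixes A B C :: "real set"
  assumes [measurable]: "A \<in> sets borel" "B \<in> sets borel" "C \<in> sets borel"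
    and ne: "A \<noteq> {}" "B \<noteq> {}"
    and AB: "\<And>a b. a \<in> A \<Longrightarrow> b \<in> B \<Longrightarrow> (a + b) / 2 \<in> C"
  shows "emeasure lborel A + emeasure lborel B \<le> 2 * emeasure lborel C"
proof -
  have step: "emeasure lborel (A \<inter> {..a}) + emeasure lborel (B \<inter> {b..}) \<le> 2 * emeasure lborel C"
    if ab: "a \<in> A" "b \<in> B" for a b
  proof -
    let ?c = "(a + b) / 2"
    have "emeasure lborel (A \<inter> {..a}) \<le> emeasure lborel {x. (x + b) / 2 \<in> C \<inter> {..?c}}"
      using ab AB by (intro emeasure_mono) auto
    also have "\<dots> = 2 * emeasure lborel (C \<inter> {..?c})"
      by (rule emeasure_half_affine) simp
    finally have 1: "emeasure lborel (A \<inter> {..a}) \<le> 2 * emeasure lborel (C \<inter> {..?c})" .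
    have "emeasure lborel (B \<inter> {b..}) \<le> emeasure lborel {x. (x + a) / 2 \<in> C \<inter> {?c..}}"
      using ab AB[OF ab(1)] by (intro emeasure_mono) (auto simp: add.commute[of _ a])
    also have "\<dots> = 2 * emeasure lborel (C \<inter> {?c..})"
      by (rule emeasure_half_affine) simp
    finally have 2: "emeasure lborel (B \<inter> {b..}) \<le> 2 * emeasure lborel (C \<inter> {?c..})" .
    have "emeasure lborel (C \<inter> {?c..}) \<le> emeasure lborel ((C \<inter> {?c<..}) \<union> {?c})"
      by (intro emeasure_mono) auto
    also have "\<dots> \<le> emeasure lborel (C \<inter> {?c<..}) + emeasure lborel {?c}"
      by (intro emeasure_subadditive) auto
    finally have 3: "emeasure lborel (C \<inter> {?c..}) \<le> emeasure lborel (C \<inter> {?c<..})" by simp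
    have "emeasure lborel (C \<inter> {..?c}) + emeasure lborel (C \<inter> {?c<..}) = emeasure lborel ((C \<inter> {..?c}) \<union> (C \<inter> {?c<..}))"
      by (intro plus_emeasure) auto
    also have "(C \<inter> {..?c}) \<union> (C \<inter> {?c<..}) = C" by auto
    finally have 4: "emeasure lborel (C \<inter> {..?c}) + emeasure lborel (C \<inter> {?c<..}) = emeasure lborel C" .
    have "emeasure lborel (A \<inter> {..a}) + emeasure lborel (B \<inter> {b..})
        \<le> 2 * emeasure lborel (C \<inter> {..?c}) + 2 * emeasure lborel (C \<inter> {?c<..})"
      by (rule add_mono[OF 1 order_trans[OF 2 mult_left_mono[OF 3]]]) simp
    also have "\<dots> = 2 * emeasure lborel C" by (simp only: 4 flip: distrib_left)
    finally show ?thesis .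
  qed
  obtain f where f: "incseq f" "range f \<subseteq> A" "\<And>a. a \<in> A \<Longrightarrow> \<exists>k. a \<le> f k"
    using cofinal_seq[OF ne(1)] by blast
  have "uminus ` B \<noteq> {}" using ne by simp
  from cofinal_seq[OF this] obtain g where g: "incseq g" "range g \<subseteq> uminus ` B" "\<And>a. a \<in> uminus ` B \<Longrightarrow> \<exists>k. a \<le> g k"
    by blast
  have A: "(\<lambda>k. emeasure lborel (A \<inter> {..f k})) \<longlonglongrightarrow> emeasure lborel (\<Union>k. A \<inter> {..f k})"
    using f(1) by (intro Lim_emeasure_incseq) (auto simp: incseq_def intro: order_trans)
  have A': "(\<Union>k. A \<inter> {..f k}) = A" using f(3) by auto
  have B: "(\<lambda>k. emeasure lborel (B \<inter> {- g k..})) \<longlonglongrightarrow> emeasure lborel (\<Union>k. B \<inter> {- g k..})"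
  proof (intro Lim_emeasure_incseq)
    show "incseq (\<lambda>k. B \<inter> {- g k..})"
      using g(1) by (force simp: incseq_def)
  qed auto
  have B': "(\<Union>k. B \<inter> {- g k..}) = B"
  proof -
    have "\<exists>k. - g k \<le> b" if "b \<in> B" for b using g(3)[of "- b"] that by (auto simp: minus_le_iff)
    then show ?thesis by auto
  qed
  have "(\<lambda>k. emeasure lborel (A \<inter> {..f k}) + emeasure lborel (B \<inter> {- g k..})) \<longlonglongrightarrow> emeasure lborel A + emeasure lborel B"
    using A B unfolding A' B' by (intro tendsto_add)
  moreover have "\<forall>k. emeasure lborel (A \<inter> {..f k}) + emeasure lborel (B \<inter> {- g k..}) \<le> 2 * emeasure lborel C"
  proof
    fix k
    have "g k \<in> uminus ` B" using g(2) by auto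
    then have "- g k \<in> B" by auto
    moreover have "f k \<in> A" using f(2) by auto
    ultimately show "emeasure lborel (A \<inter> {..f k}) + emeasure lborel (B \<inter> {- g k..}) \<le> 2 * emeasure lborel C" using step by blast
  qed
  ultimately show ?thesis by (intro LIMSEQ_le_const2) auto
qed

lemma nn_integral_layer_cake:
  fixes f :: "real \<Rightarrow> ennreal"
  assumes [measurable]: "f \<in> borel_measurable borel"
  shows "(\<integral>\<^sup>+x. f x \<partial>lborel) = (\<integral>\<^sup>+s. indicator {0..} s * emeasure lborel {x. ennreal s < f x} \<partial>lborel)"
proof -
  have pt: "f x = (\<integral>\<^sup>+s. indicator {0..} s * indicator {x. ennreal s < f x} x \<partial>lborel)" for x
  proof (cases "f x" rule: ennreal_cases)
    case (real r)
    have "(\<integral>\<^sup>+s. indicator {0..} s * indicator {x. ennreal s < f x} x \<partial>lborel) = (\<integral>\<^sup>+s. indicator {0..<r} s \<partial>lborel)"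
      using real by (intro nn_integral_cong) (auto simp: indicator_def ennreal_less_iff)
    then show ?thesis using real by simp
  next
    case top
    have "(\<integral>\<^sup>+s. indicator {0..} s * indicator {x. ennreal s < f x} x \<partial>lborel) = (\<integral>\<^sup>+s. indicator {0::real..} s \<partial>lborel)"
      using top by (intro nn_integral_cong) (auto simp: indicator_def)
    also have "\<dots> = emeasure lborel {0::real..}" by simp
    also have "\<dots> = \<infinity>"
    proof -
      have *: "of_nat n \<le> emeasure lborel {0::real..}" for n
      proof -
        have "emeasure lborel {0..real n} \<le> emeasure lborel {0::real..}" by (intro emeasure_mono) auto
        then show ?thesis by (simp add: ennreal_of_nat_eq_real_of_nat)
      qed
      have "(SUP n. of_nat n) \<le> emeasure lborel {0::real..}" by (intro SUP_least *)
      then show ?thesis by (simp add: ennreal_SUP_of_nat_eq_top top_unique)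
    qed
    finally show ?thesis using top by simp
  qed
  have "(\<integral>\<^sup>+x. f x \<partial>lborel) = (\<integral>\<^sup>+x. \<integral>\<^sup>+s. indicator {0..} s * indicator {x. ennreal s < f x} x \<partial>lborel \<partial>lborel)"
    by (rule nn_integral_cong) (rule pt)
  also have "\<dots> = (\<integral>\<^sup>+s. \<integral>\<^sup>+x. indicator {0..} s * indicator {x. ennreal s < f x} x \<partial>lborel \<partial>lborel)"
  proof (rule lborel_pair.Fubini')
    have "(\<lambda>(s, x). indicator {0..} s * indicator {x. ennreal s < f x} x) = (\<lambda>p. indicator {0..} (fst p) * (indicator {p. ennreal (fst p) < f (snd p)} p :: ennreal))"
      by (auto simp: fun_eq_iff indicator_def)
    then show "(\<lambda>(s, x). indicator {0..} s * indicator {x. ennreal s < f x} x :: ennreal) \<in> borel_measurable (lborel \<Otimes>\<^sub>M lborel)"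
      by simp
  qed
  also have "\<dots> = (\<integral>\<^sup>+s. indicator {0..} s * emeasure lborel {x. ennreal s < f x} \<partial>lborel)"
    by (intro nn_integral_cong) (simp add: nn_integral_cmult)
  finally show ?thesis .
qed

lemma ennreal_amgm:
  fixes x y z :: ennreal
  assumes "x + y \<le> 2 * z"
  shows "x * y \<le> z\<^sup>2"
proof (cases z rule: ennreal_cases)
  case z: (real c)
  have "2 * z < top" using z by (simp add: ennreal_mult_less_top)
  with assms have "x + y < top" by (rule le_less_trans)
  then obtain a b where ab: "x = ennreal a" "0 \<le> a" "y = ennreal b" "0 \<le> b"
    by (cases x rule: ennreal_cases; cases y rule: ennreal_cases) auto
  have "ennreal (a + b) \<le> ennreal (2 * c)"
    using assms z ab by (simp add: ennreal_plus ennreal_mult)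
  then have *: "a + b \<le> 2 * c" using z by (simp add: ennreal_le_iff)
  have "4 * (a * b) \<le> (a + b)\<^sup>2" using sum_squares_bound[of a b] by (simp add: power2_sum)
  also have "\<dots> \<le> (2 * c)\<^sup>2" using * ab by (intro power_mono) auto
  finally have "a * b \<le> c\<^sup>2" by (simp add: power_mult_distrib)
  then show ?thesis using ab z by (simp add: ennreal_power ennreal_leI flip: ennreal_mult)
qed (simp add: power2_eq_square)

text \<open>Scaling the levels by the suprema makes the level sets of \<open>f\<close> and
  \<open>g\<close> nonempty for the same parameters \<open>0 \<le> s < 1\<close>, as Brunn-Minkowski
  demands. With \<open>c = sqrt (a * b)\<close> the midpoints land in the level set of
  \<open>h\<close>, so the layer-cake integrals satisfy \<open>?A + ?B \<le> 2 * ?C\<close>, and the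
  arithmetic-geometric mean inequality finishes.\<close>

lemma prekopa_leindler_real_bounded:
  fixes f g h :: "real \<Rightarrow> ennreal"
  assumes [measurable]: "f \<in> borel_measurable borel" "g \<in> borel_measurable borel" "h \<in> borel_measurable borel"
    and fgh: "\<And>x y. f x * g y \<le> (h ((x + y) / 2))\<^sup>2"
    and a: "(SUP x. f x) = ennreal a" "0 < a" and b: "(SUP x. g x) = ennreal b" "0 < b"
  shows "(\<integral>\<^sup>+x. f x \<partial>lborel) * (\<integral>\<^sup>+x. g x \<partial>lborel) \<le> (\<integral>\<^sup>+x. h x \<partial>lborel)\<^sup>2"
proof -
  define c where "c = sqrt (a * b)"
  have c: "0 < c" "c\<^sup>2 = a * b" using a b by (auto simp: c_def)
  have cake: "(\<integral>\<^sup>+x. u x \<partial>lborel) = ennreal k * (\<integral>\<^sup>+s. indicator {0..} s * emeasure lborel {x. ennreal (k * s) < u x} \<partial>lborel)"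
    if [measurable]: "u \<in> borel_measurable borel" and k: "0 < k" for u :: "real \<Rightarrow> ennreal" and k :: real
  proof -
    have [measurable]: "(\<lambda>s. emeasure lborel {x. ennreal s < u x}) \<in> borel_measurable borel"
    proof -
      have "{p \<in> space (borel \<Otimes>\<^sub>M lborel). ennreal (fst p) < u (snd p)} \<in> sets (borel \<Otimes>\<^sub>M lborel)" by measurable
      from lborel.measurable_emeasure_Pair[OF this] show ?thesis
        by (simp add: space_pair_measure vimage_def)
    qed
    have "(\<integral>\<^sup>+x. u x \<partial>lborel) = ennreal \<bar>k\<bar> * (\<integral>\<^sup>+s. indicator {0..} (0 + k * s) * emeasure lborel {x. ennreal (0 + k * s) < u x} \<partial>lborel)"
      unfolding nn_integral_layer_cake[OF that(1)] using k by (intro nn_integral_real_affine) simp_all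
    moreover have "indicator {0..} (0 + k * s) = (indicator {0..} s :: ennreal)" for s
      using k by (simp add: indicator_def zero_le_mult_iff)
    ultimately show ?thesis using k by simp
  qed
  define m where "m u k s = (indicator {0..} s * emeasure lborel {x. ennreal (k * s) < u x})" for u :: "real \<Rightarrow> ennreal" and k s
  have mm: "m u k \<in> borel_measurable borel" if [measurable]: "u \<in> borel_measurable borel" for u :: "real \<Rightarrow> ennreal" and k :: real
  proof -
    have "{p \<in> space (borel \<Otimes>\<^sub>M lborel). ennreal (k * fst p) < u (snd p)} \<in> sets (borel \<Otimes>\<^sub>M lborel)" by measurable
    from lborel.measurable_emeasure_Pair[OF this] have [measurable]: "(\<lambda>s. emeasure lborel {x. ennreal (k * s) < u x}) \<in> borel_measurable borel"
      by (simp add: space_pair_measure vimage_def)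
    show ?thesis unfolding m_def by measurable
  qed
  note [measurable] = mm[OF assms(1)] mm[OF assms(2)] mm[OF assms(3)]
  have lev: "m f a s + m g b s \<le> 2 * m h c s" for s
  proof (cases "0 \<le> s \<and> s < 1")
    case True
    have "ennreal (a * s) < (SUP x. f x)" using True a by (simp add: ennreal_less_iff)
    then obtain x where x: "ennreal (a * s) < f x" by (auto simp: less_SUP_iff)
    have "ennreal (b * s) < (SUP x. g x)" using True b by (simp add: ennreal_less_iff)
    then obtain y where y: "ennreal (b * s) < g y" by (auto simp: less_SUP_iff)
    have "emeasure lborel {x. ennreal (a * s) < f x} + emeasure lborel {x. ennreal (b * s) < g x}
        \<le> 2 * emeasure lborel {x. ennreal (c * s) < h x}"
    proof (rule brunn_minkowski_real_half)
      fix x y assume "x \<in> {x. ennreal (a * s) < f x}" "y \<in> {x. ennreal (b * s) < g x}"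
      then have xy: "ennreal (a * s) < f x" "ennreal (b * s) < g y" by auto
      have "ennreal ((c * s)\<^sup>2) = ennreal (a * s) * ennreal (b * s)"
        using a b True c by (simp add: power_mult_distrib mult_ac power2_eq_square flip: ennreal_mult)
      also have "\<dots> < f x * g y" 
      \<comment> \<open>Multiplying by \<open>ennreal (b * s)\<close> keeps an inequality strict
        only if this factor is positive.\<close>
      proof (cases "b * s = 0")
        case True
        moreover have "0 < f x" using zero_le xy(1) by (rule le_less_trans)
        moreover have "0 < g y" using zero_le xy(2) by (rule le_less_trans)
        ultimately show ?thesis using True by (simp only: ennreal_0 mult_zero_right ennreal_zero_less_mult_iff)
      next
        case False
        then have "0 < b * s" using b True by (simp add: less_le)
        then have "ennreal (a * s) * ennreal (b * s) < f x * ennreal (b * s)"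
          by (intro ennreal_mult_strict_right_mono xy) simp_all
        also have "\<dots> \<le> f x * g y" using xy(2) by (intro mult_left_mono) auto
        finally show ?thesis .
      qed
      also have "\<dots> \<le> (h ((x + y) / 2))\<^sup>2" by (rule fgh)
      finally have "(ennreal (c * s))\<^sup>2 < (h ((x + y) / 2))\<^sup>2" using c True by (simp add: ennreal_power)
      then have "ennreal (c * s) < h ((x + y) / 2)"
        by (meson leD le_less_linear power_mono zero_le)
      then show "(x + y) / 2 \<in> {x. ennreal (c * s) < h x}" by simp
    qed (use x y in auto)
    then show ?thesis using True by (simp add: m_def)
  next
    case False
    show ?thesis
    proof (cases "0 \<le> s")
      case True
      with False have s: "1 \<le> s" by simp
      have "f x \<le> ennreal (a * s)" for x
      proof -
        have "f x \<le> ennreal a" unfolding a(1)[symmetric] by (intro SUP_upper) auto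
        also have "\<dots> \<le> ennreal (a * s)" using a s by (intro ennreal_leI) auto
        finally show ?thesis .
      qed
      moreover have "g x \<le> ennreal (b * s)" for x
      proof -
        have "g x \<le> ennreal b" unfolding b(1)[symmetric] by (intro SUP_upper) auto
        also have "\<dots> \<le> ennreal (b * s)" using b s by (intro ennreal_leI) auto
        finally show ?thesis .
      qed
      ultimately have "{x. ennreal (a * s) < f x} = {}" "{x. ennreal (b * s) < g x} = {}" by (auto simp: not_less)
      then show ?thesis by (simp add: m_def)
    qed (simp add: m_def)
  qed
  let ?A = "\<integral>\<^sup>+s. m f a s \<partial>lborel" and ?B = "\<integral>\<^sup>+s. m g b s \<partial>lborel" and ?C = "\<integral>\<^sup>+s. m h c s \<partial>lborel"
  have "?A + ?B = (\<integral>\<^sup>+s. m f a s + m g b s \<partial>lborel)" by (simp add: nn_integral_add)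
  also have "\<dots> \<le> (\<integral>\<^sup>+s. 2 * m h c s \<partial>lborel)" using lev by (intro nn_integral_mono) auto
  also have "\<dots> = 2 * ?C" by (simp add: nn_integral_cmult)
  finally have "?A * ?B \<le> ?C\<^sup>2" by (rule ennreal_amgm)
  then have "ennreal (a * b) * (?A * ?B) \<le> ennreal (c\<^sup>2) * ?C\<^sup>2"
    unfolding c(2) by (intro mult_left_mono) auto
  moreover have "ennreal (c\<^sup>2) * ?C\<^sup>2 = (ennreal c * ?C)\<^sup>2"
    using c by (simp add: power_mult_distrib ennreal_power)
  moreover have "(\<integral>\<^sup>+x. f x \<partial>lborel) = ennreal a * ?A" "(\<integral>\<^sup>+x. g x \<partial>lborel) = ennreal b * ?B"
    "(\<integral>\<^sup>+x. h x \<partial>lborel) = ennreal c * ?C"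
    unfolding m_def using a b c by (intro cake; simp)+
  ultimately show ?thesis
    using a b by (simp add: ennreal_mult mult_ac)
qed

text \<open>Truncating \<open>f\<close> and \<open>g\<close> makes their suprema finite and only
  lowers the left-hand side, so \<open>h\<close> stays as it is; a vanishing supremum makes the
  left-hand side zero. Monotone convergence removes one truncation at a time.\<close>

lemma prekopa_leindler_real:
  fixes f g h :: "real \<Rightarrow> ennreal"
  assumes [measurable]: "f \<in> borel_measurable borel" "g \<in> borel_measurable borel" "h \<in> borel_measurable borel"
    and fgh: "\<And>x y. f x * g y \<le> (h ((x + y) / 2))\<^sup>2"
  shows "(\<integral>\<^sup>+x. f x \<partial>lborel) * (\<integral>\<^sup>+x. g x \<partial>lborel) \<le> (\<integral>\<^sup>+x. h x \<partial>lborel)\<^sup>2"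
proof -
  have trunc: "(\<integral>\<^sup>+x. u x \<partial>lborel) = (SUP N. \<integral>\<^sup>+x. min (u x) (of_nat N) \<partial>lborel)"
    if [measurable]: "u \<in> borel_measurable borel" for u :: "real \<Rightarrow> ennreal"
  proof -
    have "(SUP N. \<integral>\<^sup>+x. min (u x) (of_nat N) \<partial>lborel) = (\<integral>\<^sup>+x. (SUP N. min (u x) (of_nat N)) \<partial>lborel)"
      by (intro nn_integral_monotone_convergence_SUP[symmetric])
         (auto simp: incseq_def le_fun_def simp del: min.bounded_iff intro!: min.mono)
    moreover have "(SUP N. min (u x) (of_nat N)) = u x" for x
    proof -
      have "(SUP N. inf (u x) (of_nat N)) = inf (u x) (SUP N. of_nat N)"
        by (rule inf_SUP[symmetric])
      then show ?thesis by (simp add: ennreal_SUP_of_nat_eq_top inf_min)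
    qed
    ultimately show ?thesis by simp
  qed
  have bd: "(\<integral>\<^sup>+x. min (f x) (of_nat N) \<partial>lborel) * (\<integral>\<^sup>+x. min (g x) (of_nat M) \<partial>lborel) \<le> (\<integral>\<^sup>+x. h x \<partial>lborel)\<^sup>2" for N M :: nat
  proof -
    let ?f = "\<lambda>x. min (f x) (of_nat N)" and ?g = "\<lambda>x. min (g x) (of_nat M)"
    have "(SUP x. ?f x) \<le> of_nat N" "(SUP x. ?g x) \<le> of_nat M" by (auto intro!: SUP_least)
    then have "(SUP x. ?f x) < top" "(SUP x. ?g x) < top" by (auto intro: le_less_trans simp: of_nat_less_top)
    then obtain a b where ab: "(SUP x. ?f x) = ennreal a" "0 \<le> a" "(SUP x. ?g x) = ennreal b" "0 \<le> b"
      by (metis ennreal_cases less_irrefl)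
    show ?thesis
    proof (cases "a = 0 \<or> b = 0")
      case True
      then have "(\<forall>x. ?f x = 0) \<or> (\<forall>x. ?g x = 0)"
        using ab by (smt (verit, ccfv_threshold) SUP_upper UNIV_I ennreal_0 le_zero_eq)
      then show ?thesis by (elim disjE) (simp_all only: nn_integral_const mult_zero_left mult_zero_right zero_le)
    next
      case False
      show ?thesis
      proof (rule prekopa_leindler_real_bounded[where a=a and b=b])
        fix x y
        have "?f x * ?g y \<le> f x * g y" by (intro mult_mono) auto
        also note fgh
        finally show "?f x * ?g y \<le> (h ((x + y) / 2))\<^sup>2" .
      qed (use ab False in auto)
    qed
  qed
  have "(\<integral>\<^sup>+x. f x \<partial>lborel) * (\<integral>\<^sup>+x. min (g x) (of_nat M) \<partial>lborel) \<le> (\<integral>\<^sup>+x. h x \<partial>lborel)\<^sup>2" for M :: nat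
    unfolding trunc[OF assms(1)] by (subst SUP_mult_right_ennreal) (auto intro!: SUP_least bd)
  then show ?thesis
    unfolding trunc[OF assms(2)] by (subst SUP_mult_left_ennreal) (auto intro!: SUP_least)
qed

definition midpt :: "nat set \<Rightarrow> (nat \<Rightarrow> real) \<Rightarrow> (nat \<Rightarrow> real) \<Rightarrow> nat \<Rightarrow> real" where
  "midpt I x y = (\<lambda>i\<in>I. (x i + y i) / 2)"

lemma midpt_in_space: "midpt I x y \<in> space (Pi\<^sub>M I (\<lambda>_. lborel))"
  by (auto simp: midpt_def space_PiM)

text \<open>Tensorization: with all coordinates but one fixed, the inequality on the line says that
  the partial integrals satisfy the hypothesis in one dimension less. The index set is a general
  finite one so that the induction can remove a coordinate.\<close>

theorem prekopa_leindler:
  fixes f g h :: "(nat \<Rightarrow> real) \<Rightarrow> ennreal"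
  assumes "finite I"
    and "f \<in> borel_measurable (Pi\<^sub>M I (\<lambda>_. lborel))" "g \<in> borel_measurable (Pi\<^sub>M I (\<lambda>_. lborel))"
      "h \<in> borel_measurable (Pi\<^sub>M I (\<lambda>_. lborel))"
    and "\<And>x y. x \<in> space (Pi\<^sub>M I (\<lambda>_. lborel)) \<Longrightarrow> y \<in> space (Pi\<^sub>M I (\<lambda>_. lborel)) \<Longrightarrow>
      f x * g y \<le> (h (midpt I x y))\<^sup>2"
  shows "(\<integral>\<^sup>+x. f x \<partial>Pi\<^sub>M I (\<lambda>_. lborel)) * (\<integral>\<^sup>+x. g x \<partial>Pi\<^sub>M I (\<lambda>_. lborel)) \<le> (\<integral>\<^sup>+x. h x \<partial>Pi\<^sub>M I (\<lambda>_. lborel))\<^sup>2"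
  using assms
proof (induction I arbitrary: f g h rule: finite_induct)
  case empty
  have "midpt {} (\<lambda>_. undefined) (\<lambda>_. undefined) = (\<lambda>_. undefined)" by (auto simp: midpt_def)
  with empty(4)[of "\<lambda>_. undefined" "\<lambda>_. undefined"] show ?case
    by (simp add: PiM_empty nn_integral_count_space_finite space_PiM)
next
  case (insert i I)
  note [measurable] = insert.prems(1-3)
  interpret product_sigma_finite "\<lambda>_::nat. lborel :: real measure" by standard
  have sp: "x(i := s) \<in> space (Pi\<^sub>M (insert i I) (\<lambda>_. lborel))" if "x \<in> space (Pi\<^sub>M I (\<lambda>_. lborel))" for x and s :: real
    using that by (auto simp: space_PiM PiE_def extensional_def)
  have 1: "(\<integral>\<^sup>+s. f (x(i := s)) \<partial>lborel) * (\<integral>\<^sup>+s. g (y(i := s)) \<partial>lborel) \<le> (\<integral>\<^sup>+s. h ((midpt I x y)(i := s)) \<partial>lborel)\<^sup>2"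
    if x: "x \<in> space (Pi\<^sub>M I (\<lambda>_. lborel))" and y: "y \<in> space (Pi\<^sub>M I (\<lambda>_. lborel))" for x y
  proof (rule prekopa_leindler_real)
    note [measurable] = x y midpt_in_space[of I x y]
    have up: "(\<lambda>s. z(i := s)) \<in> borel \<rightarrow>\<^sub>M Pi\<^sub>M (insert i I) (\<lambda>_. lborel)" if "z \<in> space (Pi\<^sub>M I (\<lambda>_. lborel))" for z :: "nat \<Rightarrow> real"
      using that by (intro measurable_fun_upd[where J=I]) auto
    show "(\<lambda>s. f (x(i := s))) \<in> borel_measurable borel" "(\<lambda>s. g (y(i := s))) \<in> borel_measurable borel"
      "(\<lambda>s. h ((midpt I x y)(i := s))) \<in> borel_measurable borel"
      using up[OF x] up[OF y] up[OF midpt_in_space] by measurable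
    fix s t
    have "midpt (insert i I) (x(i := s)) (y(i := t)) = (midpt I x y)(i := (s + t) / 2)"
      using \<open>i \<notin> I\<close> by (auto simp: midpt_def fun_eq_iff)
    then show "f (x(i := s)) * g (y(i := t)) \<le> (h ((midpt I x y)(i := (s + t) / 2)))\<^sup>2"
      using insert.prems(4)[OF sp[OF x, of s] sp[OF y, of t]] by (simp only:)
  qed
  show ?case
    using insert.hyps
    by (simp add: product_nn_integral_insert) (intro insert.IH 1; measurable)
qed

section \<open>Elementary inequalities\<close>

lemma power_div_fact_le_exp:
  fixes x :: real
  assumes "0 \<le> x"
  shows "x ^ k \<le> fact k * exp x"
proof -
  have "(\<lambda>n. x ^ n /\<^sub>R fact n) sums exp x" by (rule exp_converges)
  then have s: "summable (\<lambda>n. x ^ n /\<^sub>R fact n)" "exp x = (\<Sum>n. x ^ n /\<^sub>R fact n)"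
    by (auto simp: sums_iff)
  have "(\<Sum>n\<in>{k}. x ^ n /\<^sub>R fact n) \<le> exp x"
    unfolding s(2) using assms by (intro sum_le_suminf s) auto
  then show ?thesis by (simp add: field_simps)
qed

lemma geometric_sum_bound:
  fixes q :: real
  assumes "0 \<le> q" "q < 1"
  shows "(\<Sum>j<J. q ^ j) \<le> 1 / (1 - q)"
  using assms by (simp add: sum_gp_strict divide_right_mono)

text \<open>Multiplication by \<open>1 - q\<close> telescopes: it turns quadratic coefficients into
  linear ones and these into constants, so three factors leave at most \<open>2\<close>. The product
  form includes \<open>q = 1\<close>.\<close>

lemma weighted_geometric_sum_bound:
  fixes q :: real
  assumes q: "0 \<le> q" "q \<le> 1"
  shows "(1 - q) ^ 3 * (\<Sum>j<J. (real j + 1)\<^sup>2 * q ^ j) \<le> 2"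
proof -
  define s1 s2 s3 where "s1 = (\<Sum>j<J. q ^ j)" and "s2 = (\<Sum>j<J. (real j + 1) * q ^ j)"
    and "s3 = (\<Sum>j<J. (real j + 1) * (real j + 2) * q ^ j)"
  have "(1 - q) * s1 = 1 - q ^ J"
    unfolding s1_def by (rule one_diff_power_eq[symmetric])
  then have 1: "(1 - q) * s1 \<le> 1" using q by simp
  have "(1 - q) * s2 = s1 - real J * q ^ J"
    unfolding s1_def s2_def
  proof (induction J)
    case (Suc J)
    show ?case unfolding sum.lessThan_Suc by (subst distrib_left, subst Suc.IH) (simp add: algebra_simps)
  qed simp
  then have 2: "(1 - q) * s2 \<le> s1" using q by simp
  have "(1 - q) * s3 = 2 * s2 - real J * (real J + 1) * q ^ J"
    unfolding s2_def s3_def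
  proof (induction J)
    case (Suc J)
    show ?case unfolding sum.lessThan_Suc by (subst distrib_left, subst Suc.IH) (simp add: algebra_simps)
  qed simp
  then have 3: "(1 - q) * s3 \<le> 2 * s2" using q by simp
  have "(\<Sum>j<J. (real j + 1)\<^sup>2 * q ^ j) \<le> s3"
    unfolding s3_def power2_eq_square using q by (intro sum_mono mult_right_mono mult_left_mono) auto
  then have "(1 - q) ^ 3 * (\<Sum>j<J. (real j + 1)\<^sup>2 * q ^ j) \<le> (1 - q) ^ 3 * s3"
    using q by (intro mult_left_mono) auto
  also have "\<dots> = (1 - q)\<^sup>2 * ((1 - q) * s3)" by (simp add: power2_eq_square power3_eq_cube)
  also have "\<dots> \<le> (1 - q)\<^sup>2 * (2 * s2)" using 3 q by (intro mult_left_mono) auto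
  also have "\<dots> = 2 * (1 - q) * ((1 - q) * s2)" by (simp add: power2_eq_square)
  also have "\<dots> \<le> 2 * (1 - q) * s1" using 2 q by (intro mult_left_mono) auto
  also have "\<dots> \<le> 2" using 1 by (simp only: mult.assoc)
  finally show ?thesis .
qed

text \<open>Midpoint log-concavity makes the ratio \<open>T (s + h) / T s\<close> decrease in
  \<open>s\<close>, so a step with ratio at most \<open>r\<close> passes this bound on to all later
  steps of the same length. Monotonicity settles the case of a zero denominator.\<close>

lemma logconcave_tail_ratio:
  fixes T :: "real \<Rightarrow> real"
  assumes lc: "\<And>s t. T s * T t \<le> (T ((s + t) / 2))\<^sup>2" and nn: "\<And>s. 0 \<le> T s" and mono: "antimono T"
    and h: "0 \<le> h" and r: "T (s + h) \<le> r * T s"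
  shows "T (s + real (Suc j) * h) \<le> r * T (s + real j * h)"
proof (induction j)
  case (Suc j)
  let ?a = "T (s + real j * h)" and ?b = "T (s + real (Suc j) * h)" and ?c = "T (s + real (Suc (Suc j)) * h)"
  have eq: "((s + real (Suc (Suc j)) * h) + (s + real j * h)) / 2 = s + real (Suc j) * h"
    by (simp add: field_simps)
  from lc[of "s + real (Suc (Suc j)) * h" "s + real j * h", unfolded eq] have "?c * ?a \<le> ?b * ?b" by (simp add: power2_eq_square)
  also have "\<dots> \<le> ?b * (r * ?a)" using Suc nn by (intro mult_left_mono) auto
  finally have *: "?c * ?a \<le> (r * ?b) * ?a" by (simp add: mult_ac)
  show ?case
  proof (cases "?a = 0")
    case True
    have "?b \<le> ?a" "?c \<le> ?a" using h by (intro antimonoD[OF mono]; simp add: mult_right_mono)+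
    with True nn[of "s + real (Suc j) * h"] nn[of "s + real (Suc (Suc j)) * h"] show ?thesis by simp
  next
    case False
    then show ?thesis using * nn[of "s + real j * h"] by (simp add: mult_le_cancel_right)
  qed
qed (use r in simp)

lemma logconcave_tail_geometric:
  fixes T :: "real \<Rightarrow> real"
  assumes lc: "\<And>s t. T s * T t \<le> (T ((s + t) / 2))\<^sup>2" and nn: "\<And>s. 0 \<le> T s" and mono: "antimono T"
    and h: "0 \<le> h" and r: "T (s + h) \<le> r * T s" "0 \<le> r" and le1: "T s \<le> 1"
  shows "T (s + real j * h) \<le> r ^ j"
proof (induction j)
  case (Suc j)
  have "T (s + real (Suc j) * h) \<le> r * T (s + real j * h)"
    using logconcave_tail_ratio[of T, OF lc nn mono h r(1)] .
  also have "\<dots> \<le> r * r ^ j" using Suc r by (intro mult_left_mono) auto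
  finally show ?case by simp
qed (use le1 in simp)

text \<open>Constant for the \<open>k\<close>-th absolute moment relative to the root mean square. A
  geometric series over layers contributes \<open>2 * 3\<close>, the two signs double it, and
  \<open>8 ^ k * fact k\<close> stems from \<open>y ^ k \<le> fact k * exp y\<close> at the scale
  \<open>8 * a\<close>.\<close>

definition mom :: "nat \<Rightarrow> real" where
  "mom k = 12 * 8 ^ k * fact k"

lemma mom_pos: "0 < mom k"
  by (simp add: mom_def)

lemma of_bool_le_add3:
  "(P \<Longrightarrow> Q \<Longrightarrow> A \<or> C) \<Longrightarrow> of_bool P \<le> of_bool A + of_bool C + (of_bool (\<not> Q) :: real)"
  by (cases P; cases Q; cases A; cases C) auto

lemma of_bool_add_le:
  "(Q \<Longrightarrow> A \<or> C \<Longrightarrow> \<not> S \<and> \<not> B) \<Longrightarrow> \<not> (A \<and> C) \<Longrightarrow>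
    of_bool A + of_bool C \<le> of_bool (\<not> S) * of_bool (\<not> B) + (of_bool (\<not> Q) :: real)"
  by (cases Q; cases A; cases C) auto

lemma sum_of_bool_eq_mult:
  fixes j n :: nat
  assumes "j < n"
  shows "(\<Sum>k<n. of_bool (k = j) * g k) = (g j :: real)"
proof -
  have "(\<Sum>k<n. of_bool (k = j) * g k) = (\<Sum>k<n. if k = j then g k else 0)"
    by (intro sum.cong) auto
  then show ?thesis using assms by simp
qed

lemma square_sum_le: "(a + b)\<^sup>2 \<le> 2 * a\<^sup>2 + 2 * (b :: real)\<^sup>2"
  using zero_le_power2[of "a - b"] by (simp add: power2_eq_square algebra_simps)

text \<open>Growth rate of the square of \<open>\<Phi>\<close> per unit of time and of
  \<open>lam\<close>: the first summand accounts for the full tensor of third moments, the second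
  for its contraction with the covariance.\<close>

definition C1 :: real where
  "C1 = 2 * (sqrt (mom 4) * (1 + mom 4)) + 4 * mom 4"

lemma C1_pos: "0 < C1"
  using mom_pos[of 4] by (simp add: C1_def add_pos_pos)

text \<open>One summand for each term of \<open>thin_shell\<close>, once its parameters are set to
  powers of \<open>n\<close>.\<close>

definition CV :: real where
  "CV = 512 * (16 + 8 * mom 4) + 32 * mom 8 + 8 * exp (C1 / 2)"

lemma CV_pos: "0 < CV"
  using mom_pos[of 4] mom_pos[of 8] by (simp add: CV_def add_pos_pos)

lemma sum_square_mean:
  fixes a :: "nat \<Rightarrow> real"
  shows "(\<Sum>i<n. a i)\<^sup>2 \<le> real n * (\<Sum>i<n. (a i)\<^sup>2)"
  using Cauchy_Schwarz_ineq_sum[of "\<lambda>_. 1" a "{..<n}"] by simp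

lemma sum_power4_mean:
  fixes a :: "nat \<Rightarrow> real"
  shows "(\<Sum>i<n. a i) ^ 4 \<le> real n ^ 3 * (\<Sum>i<n. a i ^ 4)"
proof -
  define s q where "s = (\<Sum>i<n. a i)" and "q = (\<Sum>i<n. (a i)\<^sup>2)"
  have "s\<^sup>2 \<le> real n * q" unfolding s_def q_def by (rule sum_square_mean)
  then have "(s\<^sup>2)\<^sup>2 \<le> (real n * q)\<^sup>2" by (rule power_mono) simp
  also have "\<dots> = (real n)\<^sup>2 * q\<^sup>2" by (rule power_mult_distrib)
  also have "\<dots> \<le> (real n)\<^sup>2 * (real n * (\<Sum>i<n. ((a i)\<^sup>2)\<^sup>2))"
    unfolding q_def by (rule mult_left_mono[OF sum_square_mean]) simp
  also have "\<dots> = real n ^ 3 * (\<Sum>i<n. a i ^ 4)"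
    by (simp only: power2_eq_square power3_eq_cube power4_eq_xxxx mult.assoc)
  also have "(s\<^sup>2)\<^sup>2 = s ^ 4" by simp
  finally show ?thesis unfolding s_def .
qed

lemma log_concave_midpoint:
  assumes lc: "log_concave_fun n g" and x: "x \<in> space (lborel_pow n)" and y: "y \<in> space (lborel_pow n)"
  shows "g x * g y \<le> (g (midpt {..<n} x y))\<^sup>2"
proof (cases "g x = 0 \<or> g y = 0")
  case True
  then show ?thesis by auto
next
  case False
  let ?m = "midpt {..<n} x y"
  have nn: "0 \<le> g x" "0 \<le> g y" "0 \<le> g ?m"
    using lc x y midpt_in_space[of "{..<n}" x y] by (auto simp: log_concave_fun_def)
  then have pos: "0 < g x" "0 < g y" using False by auto
  have "(\<lambda>i\<in>{..<n}. (1 - 1/2) * x i + 1/2 * y i) = ?m" by (auto simp: midpt_def)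
  moreover have "neg_log (g (\<lambda>i\<in>{..<n}. (1 - 1/2) * x i + 1/2 * y i)) \<le> ereal (1 - 1/2) * neg_log (g x) + ereal (1/2) * neg_log (g y)"
  proof -
    have half: "(1/2 :: real) \<in> {0..1}" by simp
    have "\<forall>x\<in>space (lborel_pow n). \<forall>y\<in>space (lborel_pow n). \<forall>t\<in>{0..1::real}.
      neg_log (g (\<lambda>i\<in>{..<n}. (1 - t) * x i + t * y i)) \<le> ereal (1 - t) * neg_log (g x) + ereal t * neg_log (g y)"
      using lc by (simp add: log_concave_fun_def convex_ereal_def)
    from this[rule_format, OF x y half] show ?thesis .
  qed
  moreover have "neg_log (g x) = ereal (- ln (g x))" "neg_log (g y) = ereal (- ln (g y))"
    using pos by (auto simp: neg_log_def)
  ultimately have le: "neg_log (g ?m) \<le> ereal ((1 - 1/2) * (- ln (g x)) + 1/2 * (- ln (g y)))"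
    by (simp only: times_ereal.simps plus_ereal.simps)
  then have "neg_log (g ?m) \<noteq> \<infinity>" by auto
  then have m0: "g ?m \<noteq> 0" by (auto simp: neg_log_def)
  then have m: "0 < g ?m" using nn by simp
  have "neg_log (g ?m) = ereal (- ln (g ?m))" using m0 by (simp add: neg_log_def)
  with le have "- ln (g ?m) \<le> (1 - 1/2) * (- ln (g x)) + 1/2 * (- ln (g y))" by (simp only: ereal_less_eq)
  then have "ln (g x) + ln (g y) \<le> 2 * ln (g ?m)" by simp
  then have "exp (ln (g x) + ln (g y)) \<le> exp (ln (g ?m) + ln (g ?m))" by simp
  then show ?thesis using pos m by (simp only: exp_add exp_ln power2_eq_square)
qed

section \<open>Log-concave weights on a cube\<close>

text \<open>On a cube every polynomial is bounded, and a small multiple of an affine function is at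
  most \<open>1/2\<close> in absolute value, so its tilts stay positive. The estimates that are
  carried back to the whole space have constants free of \<open>R\<close>.\<close>

locale box =
  fixes n :: nat and R :: real
  assumes n_pos: "0 < n" and R_pos: "0 < R"
begin

abbreviation \<Lambda> :: "(nat \<Rightarrow> real) measure" where
  "\<Lambda> \<equiv> lborel_pow n"

definition cube :: "(nat \<Rightarrow> real) set" where
  "cube = {x \<in> space \<Lambda>. \<forall>i<n. \<bar>x i\<bar> \<le> R}"

text \<open>The test functions: bounded where the densities live, hence an algebra that contains the
  coordinates, with all members integrable against every density.\<close>

definition bfun :: "((nat \<Rightarrow> real) \<Rightarrow> real) \<Rightarrow> bool" where
  "bfun f \<longleftrightarrow> f \<in> borel_measurable \<Lambda> \<and> (\<exists>C. \<forall>x\<in>cube. \<bar>f x\<bar> \<le> C)"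

definition dens :: "((nat \<Rightarrow> real) \<Rightarrow> real) \<Rightarrow> bool" where
  "dens \<rho> \<longleftrightarrow> \<rho> \<in> borel_measurable \<Lambda> \<and> (\<forall>x\<in>space \<Lambda>. 0 \<le> \<rho> x) \<and>
     (\<forall>x\<in>space \<Lambda>. \<rho> x \<noteq> 0 \<longrightarrow> x \<in> cube) \<and> integrable \<Lambda> \<rho> \<and> integral\<^sup>L \<Lambda> \<rho> = 1"

text \<open>The exponential records a gain over log-concavity: \<open>\<kappa> = 0\<close> is plain midpoint log-concavity, and
  \<open>\<kappa> i = k\<close> for all \<open>i\<close> holds for the product of \<open>exp (- 2 * k * (norm x)\<^sup>2)\<close> and a log-concave function.\<close>

definition weight :: "(nat \<Rightarrow> real) \<Rightarrow> ((nat \<Rightarrow> real) \<Rightarrow> real) \<Rightarrow> bool" where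
  "weight \<kappa> \<rho> \<longleftrightarrow> dens \<rho> \<and> (\<forall>i<n. 0 \<le> \<kappa> i) \<and>
     (\<forall>x\<in>space \<Lambda>. \<forall>y\<in>space \<Lambda>. \<rho> x * \<rho> y \<le>
        (\<rho> (midpt {..<n} x y))\<^sup>2 * exp (- (\<Sum>i<n. \<kappa> i * (x i - y i)\<^sup>2)))"

definition ex :: "((nat \<Rightarrow> real) \<Rightarrow> real) \<Rightarrow> ((nat \<Rightarrow> real) \<Rightarrow> real) \<Rightarrow> real" where
  "ex \<rho> f = (\<integral>x. \<rho> x * f x \<partial>\<Lambda>)"

section \<open>Test functions and their expectations\<close>

lemma cubeD: "x \<in> cube \<Longrightarrow> x \<in> space \<Lambda>" "x \<in> cube \<Longrightarrow> i < n \<Longrightarrow> \<bar>x i\<bar> \<le> R"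
  by (auto simp: cube_def)

lemma bfun_measurable: "bfun f \<Longrightarrow> f \<in> borel_measurable \<Lambda>"
  by (simp add: bfun_def)

lemma bfun_bound:
  assumes "bfun f"
  obtains C where "0 < C" "\<And>x. x \<in> cube \<Longrightarrow> \<bar>f x\<bar> \<le> C"
proof -
  obtain C where "\<forall>x\<in>cube. \<bar>f x\<bar> \<le> C" using assms by (auto simp: bfun_def)
  then have "\<bar>f x\<bar> \<le> max C 1" if "x \<in> cube" for x using that by (auto intro: max.coboundedI1)
  then show thesis using that[of "max C 1"] by simp
qed

lemma bfunI: "f \<in> borel_measurable \<Lambda> \<Longrightarrow> (\<And>x. x \<in> cube \<Longrightarrow> \<bar>f x\<bar> \<le> C) \<Longrightarrow> bfun f"
  by (auto simp: bfun_def)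

lemma bfun_const [simp, intro]: "bfun (\<lambda>x. c)"
  by (auto simp: bfun_def)

lemma measurable_coord [measurable]: "(\<lambda>x. x i) \<in> borel_measurable \<Lambda>"
proof (cases "i < n")
  case False
  have "(\<lambda>x. x i) \<in> borel_measurable \<Lambda> \<longleftrightarrow> (\<lambda>x::nat \<Rightarrow> real. undefined :: real) \<in> borel_measurable \<Lambda>"
    using False by (intro measurable_cong) (auto simp: space_PiM PiE_def extensional_def)
  then show ?thesis by simp
qed measurable

text \<open>For \<open>i \<ge> n\<close> the coordinate \<open>x i\<close> of a point of the space is the constant \<open>undefined\<close>.\<close>

lemma bfun_coord [simp, intro]: "bfun (\<lambda>x. x i)"
proof (rule bfunI[where C="max R \<bar>undefined\<bar>"])
  fix x assume "x \<in> cube"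
  then show "\<bar>x i\<bar> \<le> max R \<bar>undefined\<bar>"
    by (cases "i < n") (auto simp: cube_def space_PiM PiE_def extensional_def)
qed measurable

lemma bfun_add [simp, intro]:
  assumes "bfun f" "bfun g" shows "bfun (\<lambda>x. f x + g x)"
proof -
  note [measurable] = assms[THEN bfun_measurable]
  obtain C where C: "0 < C" "\<And>x. x \<in> cube \<Longrightarrow> \<bar>f x\<bar> \<le> C" using bfun_bound[OF assms(1)] by blast
  obtain D where D: "0 < D" "\<And>x. x \<in> cube \<Longrightarrow> \<bar>g x\<bar> \<le> D" using bfun_bound[OF assms(2)] by blast
  show ?thesis
  proof (rule bfunI[where C="C + D"])
    fix x assume "x \<in> cube"
    then show "\<bar>f x + g x\<bar> \<le> C + D" using C(2)[of x] D(2)[of x] by linarith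
  qed measurable
qed

lemma bfun_mult [simp, intro]:
  assumes "bfun f" "bfun g" shows "bfun (\<lambda>x. f x * g x)"
proof -
  note [measurable] = assms[THEN bfun_measurable]
  obtain C where C: "0 < C" "\<And>x. x \<in> cube \<Longrightarrow> \<bar>f x\<bar> \<le> C" using bfun_bound[OF assms(1)] by blast
  obtain D where D: "0 < D" "\<And>x. x \<in> cube \<Longrightarrow> \<bar>g x\<bar> \<le> D" using bfun_bound[OF assms(2)] by blast
  show ?thesis
  proof (rule bfunI[where C="C * D"])
    fix x assume "x \<in> cube"
    then show "\<bar>f x * g x\<bar> \<le> C * D" unfolding abs_mult using C D by (intro mult_mono) auto
  qed measurable
qed

lemma bfun_minus [simp, intro]: "bfun f \<Longrightarrow> bfun (\<lambda>x. - f x)"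
  using bfun_mult[of "\<lambda>x. -1" f] by simp

lemma bfun_diff [simp, intro]: "bfun f \<Longrightarrow> bfun g \<Longrightarrow> bfun (\<lambda>x. f x - g x)"
  using bfun_add[of f "\<lambda>x. - g x"] by simp

lemma bfun_divide [simp, intro]: "bfun f \<Longrightarrow> bfun (\<lambda>x. f x / c)"
  using bfun_mult[of f "\<lambda>x. 1 / c"] by simp

lemma bfun_power [simp, intro]: "bfun f \<Longrightarrow> bfun (\<lambda>x. f x ^ k)"
  by (induction k) auto

lemma bfun_sum [simp, intro]: "(\<And>i. i \<in> I \<Longrightarrow> bfun (f i)) \<Longrightarrow> bfun (\<lambda>x. \<Sum>i\<in>I. f i x)"
  by (induction I rule: infinite_finite_induct) auto

lemma bfun_abs [simp, intro]: "bfun f \<Longrightarrow> bfun (\<lambda>x. \<bar>f x\<bar>)"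
  by (auto simp: bfun_def)

lemma bfun_exp [simp, intro]: "bfun f \<Longrightarrow> bfun (\<lambda>x. exp (f x))"
proof -
  assume f: "bfun f"
  from bfun_bound[OF f] obtain C where "\<And>x. x \<in> cube \<Longrightarrow> \<bar>f x\<bar> \<le> C" by blast
  with f show ?thesis
    by (intro bfunI[where C="exp C"]) (auto dest: bfun_measurable simp: abs_le_iff)
qed

lemma bfun_indicator [simp, intro]: "A \<in> sets \<Lambda> \<Longrightarrow> bfun (\<lambda>x. indicator A x)"
  by (intro bfunI[where C=1]) (auto simp: indicator_def)

lemma densD:
  assumes "dens \<rho>"
  shows "\<rho> \<in> borel_measurable \<Lambda>" "\<And>x. x \<in> space \<Lambda> \<Longrightarrow> 0 \<le> \<rho> x"
    "\<And>x. x \<in> space \<Lambda> \<Longrightarrow> x \<notin> cube \<Longrightarrow> \<rho> x = 0" "integrable \<Lambda> \<rho>" "integral\<^sup>L \<Lambda> \<rho> = 1"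
  using assms by (auto simp: dens_def)

lemma weight_dens: "weight \<kappa> \<rho> \<Longrightarrow> dens \<rho>"
  by (simp add: weight_def)

lemma ex_integrable:
  assumes "dens \<rho>" "bfun f"
  shows "integrable \<Lambda> (\<lambda>x. \<rho> x * f x)"
proof -
  note [measurable] = densD(1)[OF assms(1)] bfun_measurable[OF assms(2)]
  obtain C where C: "\<And>x. x \<in> cube \<Longrightarrow> \<bar>f x\<bar> \<le> C" using bfun_bound[OF assms(2)] by blast
  show ?thesis
  proof (rule Bochner_Integration.integrable_bound[where f="\<lambda>x. C * \<rho> x"])
    show "AE x in \<Lambda>. norm (\<rho> x * f x) \<le> norm (C * \<rho> x)"
    proof (rule AE_I2)
      fix x assume x: "x \<in> space \<Lambda>"
      show "norm (\<rho> x * f x) \<le> norm (C * \<rho> x)"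
      proof (cases "x \<in> cube")
        case True
        then show ?thesis using C[OF True] by (simp add: abs_mult mult.commute[of C] mult_left_mono)
      next
        case False
        then show ?thesis using densD(3)[OF assms(1) x] by simp
      qed
    qed
  qed (use densD(4)[OF assms(1)] in auto)
qed

lemma ex_add: "dens \<rho> \<Longrightarrow> bfun f \<Longrightarrow> bfun g \<Longrightarrow> ex \<rho> (\<lambda>x. f x + g x) = ex \<rho> f + ex \<rho> g"
  unfolding ex_def distrib_left by (intro Bochner_Integration.integral_add ex_integrable)

lemma ex_diff: "dens \<rho> \<Longrightarrow> bfun f \<Longrightarrow> bfun g \<Longrightarrow> ex \<rho> (\<lambda>x. f x - g x) = ex \<rho> f - ex \<rho> g"
  unfolding ex_def right_diff_distrib by (intro Bochner_Integration.integral_diff ex_integrable)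

lemma ex_cmult: "ex \<rho> (\<lambda>x. c * f x) = c * ex \<rho> f"
proof -
  have "(\<lambda>x. \<rho> x * (c * f x)) = (\<lambda>x. c * (\<rho> x * f x))" by (simp add: mult_ac)
  then show ?thesis unfolding ex_def by simp
qed

lemma ex_multc: "ex \<rho> (\<lambda>x. f x * c) = ex \<rho> f * c"
  using ex_cmult[of \<rho> c f] by (simp add: mult.commute)

lemma ex_divide: "ex \<rho> (\<lambda>x. f x / c) = ex \<rho> f / c"
  using ex_multc[of \<rho> f "1 / c"] by simp

lemma ex_minus: "ex \<rho> (\<lambda>x. - f x) = - ex \<rho> f"
  using ex_cmult[of \<rho> "-1" f] by simp

lemma ex_const: "dens \<rho> \<Longrightarrow> ex \<rho> (\<lambda>x. c) = c"
  using densD(5)[of \<rho>] by (simp add: ex_def)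

lemma ex_sum: "dens \<rho> \<Longrightarrow> (\<And>i. i \<in> I \<Longrightarrow> bfun (f i)) \<Longrightarrow> ex \<rho> (\<lambda>x. \<Sum>i\<in>I. f i x) = (\<Sum>i\<in>I. ex \<rho> (f i))"
proof (induction I rule: infinite_finite_induct)
  case (insert i I)
  then show ?case by (simp add: ex_add)
qed (auto simp: ex_const)

lemma ex_mono:
  assumes "dens \<rho>" "bfun f" "bfun g" "\<And>x. x \<in> cube \<Longrightarrow> f x \<le> g x"
  shows "ex \<rho> f \<le> ex \<rho> g"
  unfolding ex_def
proof (intro integral_mono ex_integrable assms)
  fix x assume x: "x \<in> space \<Lambda>"
  show "\<rho> x * f x \<le> \<rho> x * g x"
    using densD(2,3)[OF assms(1) x] assms(4)[of x] by (cases "x \<in> cube") (auto intro: mult_left_mono)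
qed

lemma ex_cong:
  assumes "dens \<rho>" "\<And>x. x \<in> cube \<Longrightarrow> f x = g x"
  shows "ex \<rho> f = ex \<rho> g"
  unfolding ex_def
proof (intro Bochner_Integration.integral_cong refl)
  fix x assume x: "x \<in> space \<Lambda>"
  show "\<rho> x * f x = \<rho> x * g x"
    using densD(3)[OF assms(1) x] assms(2)[of x] by (cases "x \<in> cube") auto
qed

lemma ex_nonneg: "dens \<rho> \<Longrightarrow> bfun f \<Longrightarrow> (\<And>x. x \<in> cube \<Longrightarrow> 0 \<le> f x) \<Longrightarrow> 0 \<le> ex \<rho> f"
  using ex_mono[of \<rho> "\<lambda>x. 0" f] by (simp add: ex_const)

lemma ex_abs_le: "dens \<rho> \<Longrightarrow> bfun f \<Longrightarrow> (\<And>x. x \<in> cube \<Longrightarrow> \<bar>f x\<bar> \<le> C) \<Longrightarrow> \<bar>ex \<rho> f\<bar> \<le> C"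
  using ex_mono[of \<rho> f "\<lambda>x. C"] ex_mono[of \<rho> "\<lambda>x. - C" f] by (force simp: ex_const abs_le_iff)

lemmas ex_linear = ex_add ex_diff ex_cmult ex_multc ex_divide ex_minus ex_const ex_sum

lemma ex_cauchy_schwarz:
  assumes \<rho>: "dens \<rho>" and f: "bfun f" and g: "bfun g"
  shows "(ex \<rho> (\<lambda>x. f x * g x))\<^sup>2 \<le> ex \<rho> (\<lambda>x. (f x)\<^sup>2) * ex \<rho> (\<lambda>x. (g x)\<^sup>2)"
proof -
  define a b c where "a = ex \<rho> (\<lambda>x. (f x)\<^sup>2)" and "b = ex \<rho> (\<lambda>x. f x * g x)" and "c = ex \<rho> (\<lambda>x. (g x)\<^sup>2)"
  have nn: "0 \<le> a - 2 * s * b + s\<^sup>2 * c" for s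
  proof -
    have "0 \<le> ex \<rho> (\<lambda>x. (f x - s * g x)\<^sup>2)" using \<rho> f g by (intro ex_nonneg) auto
    also have "(\<lambda>x. (f x - s * g x)\<^sup>2) = (\<lambda>x. (f x)\<^sup>2 - 2 * s * (f x * g x) + s\<^sup>2 * (g x)\<^sup>2)"
      by (auto simp: power2_eq_square algebra_simps)
    also have "ex \<rho> \<dots> = a - 2 * s * b + s\<^sup>2 * c"
      using \<rho> f g by (simp add: ex_linear a_def b_def c_def)
    finally show ?thesis .
  qed
  have c0: "0 \<le> c" unfolding c_def using \<rho> g by (intro ex_nonneg) auto
  have "b\<^sup>2 \<le> a * c"
  proof (cases "c = 0")
    case True
    have "b = 0"
    proof (rule ccontr)
      assume "b \<noteq> 0"
      then show False using nn[of "(a + 1) / (2 * b)"] True by (simp add: field_simps)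
    qed
    then show ?thesis using True by simp
  next
    case False
    with c0 have "0 < c" by simp
    then show ?thesis using nn[of "b / c"] by (simp add: field_simps power2_eq_square)
  qed
  then show ?thesis by (simp add: a_def b_def c_def)
qed

lemma ex_square_le: "dens \<rho> \<Longrightarrow> bfun f \<Longrightarrow> (ex \<rho> f)\<^sup>2 \<le> ex \<rho> (\<lambda>x. (f x)\<^sup>2)"
  using ex_cauchy_schwarz[of \<rho> f "\<lambda>x. 1"] by (simp add: ex_const)

lemma midpt_cube: "x \<in> cube \<Longrightarrow> y \<in> cube \<Longrightarrow> midpt {..<n} x y \<in> cube"
proof -
  assume *: "x \<in> cube" "y \<in> cube"
  have "\<bar>(x i + y i) / 2\<bar> \<le> R" if "i < n" for i
    using cubeD(2)[OF *(1) that] cubeD(2)[OF *(2) that] by (auto simp: abs_le_iff)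
  then show ?thesis using midpt_in_space[of "{..<n}" x y] by (auto simp: cube_def midpt_def)
qed

text \<open>Prekopa-Leindler for the products of the weight with \<open>f\<close>, \<open>g\<close>
  and \<open>h\<close>. The gain recorded in \<open>\<kappa>\<close> enters as an exponential factor
  that weakens the hypothesis on the three functions.\<close>

lemma ex_prekopa_leindler:
  assumes w: "weight \<kappa> \<rho>" and b: "bfun f" "bfun g" "bfun h"
    and nn: "\<And>x. x \<in> cube \<Longrightarrow> 0 \<le> f x" "\<And>x. x \<in> cube \<Longrightarrow> 0 \<le> g x" "\<And>x. x \<in> cube \<Longrightarrow> 0 \<le> h x"
    and fgh: "\<And>x y. x \<in> cube \<Longrightarrow> y \<in> cube \<Longrightarrow>
      f x * g y * exp (- (\<Sum>i<n. \<kappa> i * (x i - y i)\<^sup>2)) \<le> (h (midpt {..<n} x y))\<^sup>2"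
  shows "ex \<rho> f * ex \<rho> g \<le> (ex \<rho> h)\<^sup>2"
proof -
  have \<rho>: "dens \<rho>" using w by (rule weight_dens)
  note [measurable] = densD(1)[OF \<rho>] b[THEN bfun_measurable]
  have pos: "0 \<le> \<rho> x * u x" if "x \<in> space \<Lambda>" "\<And>x. x \<in> cube \<Longrightarrow> 0 \<le> u x" for x u
    using densD(2,3)[OF \<rho> that(1)] that(2)[of x] by (cases "x \<in> cube") auto
  have nn_ex: "(\<integral>\<^sup>+x. ennreal (\<rho> x * u x) \<partial>\<Lambda>) = ennreal (ex \<rho> u)" if "bfun u" "\<And>x. x \<in> cube \<Longrightarrow> 0 \<le> u x" for u
    unfolding ex_def using that pos by (intro nn_integral_eq_integral ex_integrable \<rho> AE_I2) auto
  have "(\<integral>\<^sup>+x. ennreal (\<rho> x * f x) \<partial>\<Lambda>) * (\<integral>\<^sup>+x. ennreal (\<rho> x * g x) \<partial>\<Lambda>) \<le> (\<integral>\<^sup>+x. ennreal (\<rho> x * h x) \<partial>\<Lambda>)\<^sup>2"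
  proof (rule prekopa_leindler)
    fix x y assume x: "x \<in> space \<Lambda>" and y: "y \<in> space \<Lambda>"
    let ?m = "midpt {..<n} x y"
    show "ennreal (\<rho> x * f x) * ennreal (\<rho> y * g y) \<le> (ennreal (\<rho> ?m * h ?m))\<^sup>2"
    proof (cases "x \<in> cube \<and> y \<in> cube")
      case True
      then have m: "?m \<in> cube" by (auto intro: midpt_cube)
      have "(\<rho> x * f x) * (\<rho> y * g y) = (\<rho> x * \<rho> y) * (f x * g y)" by (simp add: mult_ac)
      also have "\<dots> \<le> ((\<rho> ?m)\<^sup>2 * exp (- (\<Sum>i<n. \<kappa> i * (x i - y i)\<^sup>2))) * (f x * g y)"
        using w x y nn True by (intro mult_right_mono) (auto simp: weight_def)
      also have "\<dots> = (\<rho> ?m)\<^sup>2 * (f x * g y * exp (- (\<Sum>i<n. \<kappa> i * (x i - y i)\<^sup>2)))" by (simp add: mult_ac)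
      also have "\<dots> \<le> (\<rho> ?m)\<^sup>2 * (h ?m)\<^sup>2" using fgh True by (intro mult_left_mono) auto
      finally have "(\<rho> x * f x) * (\<rho> y * g y) \<le> (\<rho> ?m * h ?m)\<^sup>2" by (simp add: power_mult_distrib)
      then show ?thesis
        using pos[of x f] pos[of y g] pos[of ?m h] x y cubeD(1)[OF m] nn
        by (simp add: ennreal_power ennreal_leI flip: ennreal_mult)
    next
      case False
      then show ?thesis using densD(3)[OF \<rho> x] densD(3)[OF \<rho> y] by auto
    qed
  qed (simp, measurable)
  then have "ennreal (ex \<rho> f * ex \<rho> g) \<le> ennreal ((ex \<rho> h)\<^sup>2)"
    using ex_nonneg[OF \<rho> b(1) nn(1)] ex_nonneg[OF \<rho> b(2) nn(2)] ex_nonneg[OF \<rho> b(3) nn(3)]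
    by (simp add: nn_ex[OF b(1) nn(1)] nn_ex[OF b(2) nn(2)] nn_ex[OF b(3) nn(3)] ennreal_mult ennreal_power)
  then show ?thesis by (simp add: ennreal_le_iff)
qed

section \<open>Tilting a weight by an affine function\<close>

definition tilt :: "((nat \<Rightarrow> real) \<Rightarrow> real) \<Rightarrow> ((nat \<Rightarrow> real) \<Rightarrow> real) \<Rightarrow> (nat \<Rightarrow> real) \<Rightarrow> real" where
  "tilt \<rho> l = (\<lambda>x. \<rho> x * (1 + l x))"

lemma ex_tilt:
  assumes "dens \<rho>" "bfun l" "bfun f"
  shows "ex (tilt \<rho> l) f = ex \<rho> f + ex \<rho> (\<lambda>x. f x * l x)"
proof -
  have "ex (tilt \<rho> l) f = ex \<rho> (\<lambda>x. f x + f x * l x)"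
    unfolding ex_def tilt_def by (simp add: algebra_simps)
  then show ?thesis using assms by (simp add: ex_linear)
qed

lemma dens_tilt:
  assumes \<rho>: "dens \<rho>" and l: "bfun l" "ex \<rho> l = 0" "\<And>x. x \<in> cube \<Longrightarrow> \<bar>l x\<bar> \<le> 1"
  shows "dens (tilt \<rho> l)"
proof -
  note [measurable] = densD(1)[OF \<rho>] bfun_measurable[OF l(1)]
  have "integrable \<Lambda> (\<lambda>x. \<rho> x * (1 + l x))" using \<rho> l by (intro ex_integrable) auto
  moreover have "(\<integral>x. \<rho> x * (1 + l x) \<partial>\<Lambda>) = 1"
    using ex_add[OF \<rho>, of "\<lambda>x. 1" l] l ex_const[OF \<rho>, of 1] by (simp add: ex_def)
  moreover have "0 \<le> \<rho> x * (1 + l x)" if "x \<in> space \<Lambda>" for x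
    using densD(2,3)[OF \<rho> that] l(3)[of x] by (cases "x \<in> cube") (auto simp: abs_le_iff intro!: mult_nonneg_nonneg)
  ultimately show ?thesis using densD(3)[OF \<rho>] by (auto simp: dens_def tilt_def)
qed

text \<open>With \<open>u = 1 + l x\<close>, \<open>v = 1 + l y\<close> and \<open>m = (u + v) / 2\<close> one has
  \<open>u * v = m\<^sup>2 * (1 - ((u - v) / (2 * m))\<^sup>2)\<close>: a tilt by an affine function gains convexity along its gradient.\<close>

lemma weight_tilt_gain:
  assumes w: "weight \<kappa> \<rho>" and l: "bfun l" "ex \<rho> l = 0" "\<And>x. x \<in> cube \<Longrightarrow> \<bar>l x\<bar> \<le> 1/2"
    and aff: "\<And>x y. x \<in> cube \<Longrightarrow> y \<in> cube \<Longrightarrow> l (midpt {..<n} x y) = (l x + l y) / 2"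
    and \<kappa>': "\<And>i. i < n \<Longrightarrow> 0 \<le> \<kappa>' i"
    and gain: "\<And>x y. x \<in> cube \<Longrightarrow> y \<in> cube \<Longrightarrow>
      (\<Sum>i<n. \<kappa>' i * (x i - y i)\<^sup>2) \<le> (\<Sum>i<n. \<kappa> i * (x i - y i)\<^sup>2) + (l x - l y)\<^sup>2 / 16"
  shows "weight \<kappa>' (tilt \<rho> l)"
proof -
  have \<rho>: "dens \<rho>" using w by (rule weight_dens)
  have d: "dens (tilt \<rho> l)" using l by (intro dens_tilt \<rho>) force+
  have "tilt \<rho> l x * tilt \<rho> l y \<le> (tilt \<rho> l (midpt {..<n} x y))\<^sup>2 * exp (- (\<Sum>i<n. \<kappa>' i * (x i - y i)\<^sup>2))"
    if x: "x \<in> space \<Lambda>" and y: "y \<in> space \<Lambda>" for x y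
  proof (cases "x \<in> cube \<and> y \<in> cube")
    case True
    let ?m = "midpt {..<n} x y"
    define u v where "u = 1 + l x" and "v = 1 + l y"
    have uv: "1/2 \<le> u" "u \<le> 3/2" "1/2 \<le> v" "v \<le> 3/2"
      using l(3)[of x] l(3)[of y] True by (auto simp: u_def v_def abs_le_iff)
    define m where "m = (u + v) / 2"
    have m: "1/2 \<le> m" "m \<le> 3/2" using uv by (auto simp: m_def)
    have lm: "1 + l ?m = m" using aff True by (simp add: m_def u_def v_def)
    have "u * v = m\<^sup>2 * (1 - ((u - v) / (2 * m))\<^sup>2)"
      using m by (simp add: power_divide right_diff_distrib) (simp add: m_def power2_eq_square field_simps)
    also have "\<dots> \<le> m\<^sup>2 * exp (- (l x - l y)\<^sup>2 / 16)"
    proof (rule mult_left_mono)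
      have "(u - v)\<^sup>2 / 16 \<le> (u - v)\<^sup>2 / (2 * m)\<^sup>2"
      proof (rule divide_left_mono)
        have "(2 * m)\<^sup>2 \<le> 4\<^sup>2" using m by (intro power_mono) auto
        then show "(2 * m)\<^sup>2 \<le> 16" by simp
        show "0 < 16 * (2 * m)\<^sup>2" using m by simp
      qed simp
      moreover have "1 + - ((u - v)\<^sup>2 / 16) \<le> exp (- ((u - v)\<^sup>2 / 16))" by (rule exp_ge_add_one_self)
      ultimately have "1 - ((u - v) / (2 * m))\<^sup>2 \<le> exp (- ((u - v)\<^sup>2 / 16))" by (simp add: power_divide)
      then show "1 - ((u - v) / (2 * m))\<^sup>2 \<le> exp (- (l x - l y)\<^sup>2 / 16)" by (simp add: u_def v_def)
    qed simp
    finally have uvm: "u * v \<le> m\<^sup>2 * exp (- (l x - l y)\<^sup>2 / 16)" .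
    have "tilt \<rho> l x * tilt \<rho> l y = (\<rho> x * \<rho> y) * (u * v)" by (simp add: tilt_def u_def v_def mult_ac)
    also have "\<dots> \<le> ((\<rho> ?m)\<^sup>2 * exp (- (\<Sum>i<n. \<kappa> i * (x i - y i)\<^sup>2))) * (m\<^sup>2 * exp (- (l x - l y)\<^sup>2 / 16))"
    proof (rule mult_mono)
      show "\<rho> x * \<rho> y \<le> (\<rho> ?m)\<^sup>2 * exp (- (\<Sum>i<n. \<kappa> i * (x i - y i)\<^sup>2))"
        using w x y by (auto simp: weight_def)
      show "0 \<le> u * v" using uv by (intro mult_nonneg_nonneg) auto
    qed (use uvm in auto)
    also have "\<dots> = (\<rho> ?m * m)\<^sup>2 * exp (- ((\<Sum>i<n. \<kappa> i * (x i - y i)\<^sup>2) + (l x - l y)\<^sup>2 / 16))"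
      unfolding minus_add_distrib exp_add by (simp add: power_mult_distrib mult_ac)
    also have "\<dots> \<le> (\<rho> ?m * m)\<^sup>2 * exp (- (\<Sum>i<n. \<kappa>' i * (x i - y i)\<^sup>2))"
      using gain[of x y] True by (intro mult_left_mono) auto
    finally show ?thesis by (simp add: tilt_def lm)
  next
    case False
    then show ?thesis using densD(3)[OF \<rho> x] densD(3)[OF \<rho> y] by (auto simp: tilt_def)
  qed
  with d \<kappa>' show ?thesis by (simp add: weight_def)
qed

lemma weight_tilt:
  assumes "weight \<kappa> \<rho>" "bfun l" "ex \<rho> l = 0" "\<And>x. x \<in> cube \<Longrightarrow> \<bar>l x\<bar> \<le> 1/2"
    and "\<And>x y. x \<in> cube \<Longrightarrow> y \<in> cube \<Longrightarrow> l (midpt {..<n} x y) = (l x + l y) / 2"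
  shows "weight \<kappa> (tilt \<rho> l)"
  using assms by (intro weight_tilt_gain[of \<kappa>]) (auto simp: weight_def)

section \<open>One-dimensional marginals\<close>

abbreviation pr :: "((nat \<Rightarrow> real) \<Rightarrow> real) \<Rightarrow> ((nat \<Rightarrow> real) \<Rightarrow> bool) \<Rightarrow> real" where
  "pr \<rho> P \<equiv> ex \<rho> (\<lambda>x. of_bool (P x))"

text \<open>Required at midpoints only, the form in which affinity meets midpoint
  log-concavity.\<close>

definition affine :: "((nat \<Rightarrow> real) \<Rightarrow> real) \<Rightarrow> bool" where
  "affine l \<longleftrightarrow> bfun l \<and> (\<forall>x\<in>cube. \<forall>y\<in>cube. l (midpt {..<n} x y) = (l x + l y) / 2)"

lemma affine_bfun [simp]: "affine l \<Longrightarrow> bfun l"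
  by (simp add: affine_def)

lemma affine_const [simp, intro]: "affine (\<lambda>x. c)"
  by (simp add: affine_def)

lemma affine_coord [simp, intro]: "i < n \<Longrightarrow> affine (\<lambda>x. x i)"
  by (simp add: affine_def midpt_def)

lemma affine_add [simp, intro]: "affine f \<Longrightarrow> affine g \<Longrightarrow> affine (\<lambda>x. f x + g x)"
  by (simp add: affine_def field_simps)

lemma affine_diff [simp, intro]: "affine f \<Longrightarrow> affine g \<Longrightarrow> affine (\<lambda>x. f x - g x)"
  by (simp add: affine_def field_simps)

lemma affine_cmult [simp, intro]: "affine f \<Longrightarrow> affine (\<lambda>x. c * f x)"
  by (simp add: affine_def field_simps)

lemma affine_minus [simp, intro]: "affine f \<Longrightarrow> affine (\<lambda>x. - f x)"
  using affine_cmult[of f "-1"] by simp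

lemma affine_sum [simp, intro]: "(\<And>i. i \<in> I \<Longrightarrow> affine (f i)) \<Longrightarrow> affine (\<lambda>x. \<Sum>i\<in>I. f i x)"
  by (induction I rule: infinite_finite_induct) auto

lemma bfun_of_bool: "Measurable.pred \<Lambda> P \<Longrightarrow> bfun (\<lambda>x. of_bool (P x))"
  by (intro bfunI[where C=1]) auto

lemma bfun_of_bool_less [simp, intro]:
  assumes "bfun f" "bfun g"
  shows "bfun (\<lambda>x. of_bool (f x < g x))"
proof -
  note [measurable] = assms[THEN bfun_measurable]
  show ?thesis by (intro bfun_of_bool) measurable
qed

lemma bfun_of_bool_le [simp, intro]:
  assumes "bfun f" "bfun g"
  shows "bfun (\<lambda>x. of_bool (f x \<le> g x))"
proof -
  have "(\<lambda>x. of_bool (f x \<le> g x)) = (\<lambda>x. 1 - of_bool (g x < f x) :: real)" by auto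
  then show ?thesis using assms by simp
qed

lemma bfun_max [simp, intro]:
  assumes "bfun f" "bfun g"
  shows "bfun (\<lambda>x. max (f x) (g x))"
proof -
  have "(\<lambda>x. max (f x) (g x)) = (\<lambda>x. (f x + g x + \<bar>f x - g x\<bar>) / 2)" by (auto simp: max_def)
  then show ?thesis using assms by simp
qed

section \<open>Tails and moments of affine functions\<close>

lemma pr_le_1: "dens \<rho> \<Longrightarrow> bfun (\<lambda>x. of_bool (P x)) \<Longrightarrow> pr \<rho> P \<le> 1"
  using ex_mono[of \<rho> "\<lambda>x. of_bool (P x)" "\<lambda>x. 1"] by (simp add: ex_const)

lemma pr_nonneg: "dens \<rho> \<Longrightarrow> bfun (\<lambda>x. of_bool (P x)) \<Longrightarrow> 0 \<le> pr \<rho> P"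
  by (intro ex_nonneg) auto

text \<open>Prekopa-Leindler for indicators of parallel half-spaces. The law of \<open>l\<close> is
  studied through this inequality for tails; a density of the marginal is never formed.\<close>

lemma tail_logconcave:
  assumes w: "weight \<kappa> \<rho>" and l: "affine l"
  shows "pr \<rho> (\<lambda>x. s < l x) * pr \<rho> (\<lambda>x. t < l x) \<le> (pr \<rho> (\<lambda>x. (s + t) / 2 < l x))\<^sup>2"
proof (rule ex_prekopa_leindler[OF w])
  fix x y assume xy: "x \<in> cube" "y \<in> cube"
  have e: "exp (- (\<Sum>i<n. \<kappa> i * (x i - y i)\<^sup>2)) \<le> 1"
    using w by (auto simp: weight_def intro!: sum_nonneg)
  show "of_bool (s < l x) * of_bool (t < l y) * exp (- (\<Sum>i<n. \<kappa> i * (x i - y i)\<^sup>2))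
      \<le> ((of_bool ((s + t) / 2 < l (midpt {..<n} x y)))\<^sup>2 :: real)"
  proof (cases "s < l x \<and> t < l y")
    case True
    then have "(s + t) / 2 < l (midpt {..<n} x y)" using l xy by (auto simp: affine_def)
    then show ?thesis using True e by simp
  qed auto
qed (use l in auto)

lemma tail_antimono:
  assumes "dens \<rho>" "bfun l"
  shows "antimono (\<lambda>s. pr \<rho> (\<lambda>x. s < l x))"
  using assms by (intro antimonoI ex_mono) auto

text \<open>In the layer between \<open>u + j * h\<close> and \<open>u + (j + 1) * h\<close> the
  value is at most that at the upper end, and the mass at most the tail at the lower end.
  Boundedness of \<open>l\<close> on the cube leaves finitely many layers.\<close>

lemma ex_layer:
  assumes \<rho>: "dens \<rho>" and l: "bfun l" and \<phi>l: "bfun (\<lambda>x. \<phi> (l x))" and \<phi>: "mono \<phi>" "\<And>z. z \<le> u \<Longrightarrow> \<phi> z = 0"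
    and h: "0 < h" and r: "\<And>j. pr \<rho> (\<lambda>x. u + real j * h < l x) \<le> r ^ j"
  shows "\<exists>J. ex \<rho> (\<lambda>x. \<phi> (l x)) \<le> (\<Sum>j<J. \<phi> (u + (real j + 1) * h) * r ^ j)"
proof -
  have \<phi>0: "0 \<le> \<phi> z" for z
    using monoD[OF \<phi>(1), of "min u z" z] \<phi>(2)[of "min u z"] by auto
  obtain B where B: "0 < B" "\<And>x. x \<in> cube \<Longrightarrow> \<bar>l x\<bar> \<le> B" using bfun_bound[OF l] by blast
  obtain J :: nat where J: "(B - u) / h < real J" using reals_Archimedean2 by blast
  have pt: "\<phi> (l x) \<le> (\<Sum>j<J. \<phi> (u + (real j + 1) * h) * of_bool (u + real j * h < l x))" if x: "x \<in> cube" for x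
  proof (cases "l x \<le> u")
    case False
    have ex: "l x \<le> u + real J * h" using J B(2)[OF x] h by (simp add: field_simps abs_le_iff)
    define m where "m = (LEAST m. l x \<le> u + real m * h)"
    have m: "l x \<le> u + real m * h" unfolding m_def using ex by (rule LeastI)
    have mJ: "m \<le> J" unfolding m_def using ex by (rule Least_le)
    obtain j where j: "m = Suc j" using m False by (cases m) auto
    have lt: "u + real j * h < l x" using not_less_Least[of j "\<lambda>m. l x \<le> u + real m * h"] j by (auto simp: m_def)
    have "\<phi> (l x) \<le> \<phi> (u + (real j + 1) * h)" using m j by (intro monoD[OF \<phi>(1)]) (simp add: add.commute)
    also have "\<dots> = \<phi> (u + (real j + 1) * h) * of_bool (u + real j * h < l x)" using lt by simp
    also have "\<dots> \<le> (\<Sum>j<J. \<phi> (u + (real j + 1) * h) * of_bool (u + real j * h < l x))"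
      using mJ j \<phi>0 by (intro member_le_sum) auto
    finally show ?thesis .
  qed (use \<phi> \<phi>0 in \<open>auto intro!: sum_nonneg\<close>)
  have bs: "bfun (\<lambda>x. \<phi> (u + (real j + 1) * h) * of_bool (u + real j * h < l x))" for j
    using l by (intro bfun_mult bfun_const bfun_of_bool_less)
  have "ex \<rho> (\<lambda>x. \<phi> (l x)) \<le> ex \<rho> (\<lambda>x. \<Sum>j<J. \<phi> (u + (real j + 1) * h) * of_bool (u + real j * h < l x))"
    using pt by (intro ex_mono \<rho> \<phi>l bfun_sum bs)
  also have "\<dots> = (\<Sum>j<J. \<phi> (u + (real j + 1) * h) * pr \<rho> (\<lambda>x. u + real j * h < l x))"
    by (subst ex_sum[OF \<rho> bs]) (simp add: ex_cmult)
  also have "\<dots> \<le> (\<Sum>j<J. \<phi> (u + (real j + 1) * h) * r ^ j)"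
    using r \<phi>0 by (intro sum_mono mult_left_mono) auto
  finally show ?thesis by blast
qed

lemma pr_chebyshev:
  assumes \<rho>: "dens \<rho>" and l: "bfun l" and a: "0 < a" "ex \<rho> (\<lambda>x. (l x)\<^sup>2) \<le> a\<^sup>2"
  shows "pr \<rho> (\<lambda>x. 2 * a \<le> \<bar>l x\<bar>) \<le> 1 / 4"
proof -
  have "4 * a\<^sup>2 * pr \<rho> (\<lambda>x. 2 * a \<le> \<bar>l x\<bar>) = ex \<rho> (\<lambda>x. 4 * a\<^sup>2 * of_bool (2 * a \<le> \<bar>l x\<bar>))"
    by (simp add: ex_cmult)
  also have "\<dots> \<le> ex \<rho> (\<lambda>x. (l x)\<^sup>2)"
  proof (rule ex_mono[OF \<rho>])
    fix x
    show "4 * a\<^sup>2 * of_bool (2 * a \<le> \<bar>l x\<bar>) \<le> (l x)\<^sup>2"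
    proof (cases "2 * a \<le> \<bar>l x\<bar>")
      case True
      have "(2 * a)\<^sup>2 \<le> \<bar>l x\<bar>\<^sup>2" using True a by (intro power_mono) auto
      then show ?thesis using True by (simp add: power_mult_distrib)
    qed auto
  qed (use l in auto)
  also note a(2)
  finally have "a\<^sup>2 * (4 * pr \<rho> (\<lambda>x. 2 * a \<le> \<bar>l x\<bar>)) \<le> a\<^sup>2 * 1" by (simp add: mult_ac)
  then have "4 * pr \<rho> (\<lambda>x. 2 * a \<le> \<bar>l x\<bar>) \<le> 1"
    using a(1) by (subst (asm) mult_le_cancel_left_pos) simp_all
  then show ?thesis by simp
qed

text \<open>By Chebyshev the tail is at least \<open>3/4\<close> at \<open>- 2 * a\<close> and at
  most \<open>1/4\<close> at \<open>2 * a\<close>: one step of length \<open>4 * a\<close> loses a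
  factor of \<open>1/3\<close>, and log-concavity repeats the loss.\<close>

lemma tail_third:
  assumes w: "weight \<kappa> \<rho>" and l: "affine l" and a: "0 < a" "ex \<rho> (\<lambda>x. (l x)\<^sup>2) \<le> a\<^sup>2"
  shows "pr \<rho> (\<lambda>x. - 2 * a + real j * (4 * a) < l x) \<le> (1 / 3) ^ j"
proof -
  have \<rho>: "dens \<rho>" using w by (rule weight_dens)
  let ?T = "\<lambda>s. pr \<rho> (\<lambda>x. s < l x)"
  have cheb: "pr \<rho> (\<lambda>x. 2 * a \<le> \<bar>l x\<bar>) \<le> 1 / 4" using pr_chebyshev[OF \<rho> affine_bfun[OF l] a] .
  have "?T (2 * a) \<le> pr \<rho> (\<lambda>x. 2 * a \<le> \<bar>l x\<bar>)" using \<rho> l by (intro ex_mono) auto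
  then have 1: "?T (2 * a) \<le> 1/4" using cheb by simp
  have "1 = ex \<rho> (\<lambda>x. 1)" using \<rho> by (simp add: ex_const)
  also have "\<dots> \<le> ex \<rho> (\<lambda>x. of_bool (- 2 * a < l x) + of_bool (2 * a \<le> \<bar>l x\<bar>))"
    using \<rho> l by (intro ex_mono) auto
  also have "\<dots> = ?T (- 2 * a) + pr \<rho> (\<lambda>x. 2 * a \<le> \<bar>l x\<bar>)" using \<rho> l by (simp add: ex_add)
  finally have 2: "3/4 \<le> ?T (- 2 * a)" using cheb by simp
  show ?thesis
  proof (rule logconcave_tail_geometric[where T="?T" and s="-2*a" and h="4*a" and r="1/3"])
    show "?T s * ?T t \<le> (?T ((s + t) / 2))\<^sup>2" for s t by (rule tail_logconcave[OF w l])
    show "antimono ?T" using \<rho> l by (intro tail_antimono) auto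
  qed (use 1 2 a \<rho> l in \<open>auto intro!: pr_nonneg pr_le_1\<close>)
qed

text \<open>A reverse Hoelder inequality: the layers of width \<open>4 * a\<close> have mass at most
  \<open>(1/3) ^ j\<close>, which beats the growth of the \<open>k\<close>-th power. Positive and
  negative parts are treated alike.\<close>

lemma moment_bound:
  assumes w: "weight \<kappa> \<rho>" and l: "affine l" and a: "0 < a" "ex \<rho> (\<lambda>x. (l x)\<^sup>2) \<le> a\<^sup>2" and k: "0 < k"
  shows "ex \<rho> (\<lambda>x. \<bar>l x\<bar> ^ k) \<le> mom k * a ^ k"
proof -
  have \<rho>: "dens \<rho>" using w by (rule weight_dens)
  let ?\<phi> = "\<lambda>z::real. (max 0 z) ^ k"
  have half: "ex \<rho> (\<lambda>x. ?\<phi> (l x)) \<le> 6 * 8 ^ k * fact k * a ^ k"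
    if l: "affine l" and a2: "ex \<rho> (\<lambda>x. (l x)\<^sup>2) \<le> a\<^sup>2" for l
  proof -
    have "\<exists>J. ex \<rho> (\<lambda>x. ?\<phi> (l x)) \<le> (\<Sum>j<J. ?\<phi> (- 2 * a + (real j + 1) * (4 * a)) * (1/3) ^ j)"
    proof (rule ex_layer[OF \<rho>])
      show "mono ?\<phi>" by (intro monoI power_mono) auto
      show "pr \<rho> (\<lambda>x. - 2 * a + real j * (4 * a) < l x) \<le> (1 / 3) ^ j" for j
        by (rule tail_third[OF w l a(1) a2])
    qed (use l a k in auto)
    then obtain J where J: "ex \<rho> (\<lambda>x. ?\<phi> (l x)) \<le> (\<Sum>j<J. ?\<phi> (- 2 * a + (real j + 1) * (4 * a)) * (1/3) ^ j)" by blast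
    also have "\<dots> \<le> (\<Sum>j<J. 2 * 8 ^ k * fact k * a ^ k * (2/3) ^ j)"
    proof (rule sum_mono)
      fix j
      \<comment> \<open>At the scale \<open>8 * a\<close> the bound for the power grows by
        \<open>exp (1/2) \<le> 2\<close> per layer, so the series has ratio
        \<open>2/3\<close>.\<close>
      have z: "- 2 * a + (real j + 1) * (4 * a) = 8 * a * (real j / 2 + 1/4)" by (simp add: algebra_simps)
      have "exp (real j / 2 + 1/4) = exp (1/2) ^ j * exp (1/4)"
        by (simp add: exp_add flip: exp_of_nat_mult)
      also have "\<dots> \<le> 2 ^ j * 2"
      proof -
        have "exp (1/2) \<le> (2::real)" using exp_bound[of "1/2"] by (simp add: power2_eq_square)
        moreover have "exp (1/4) \<le> (2::real)" using exp_bound[of "1/4"] by (simp add: power2_eq_square)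
        ultimately show ?thesis by (intro mult_mono power_mono) auto
      qed
      finally have e: "exp (real j / 2 + 1/4) \<le> 2 ^ j * 2" .
      have "?\<phi> (- 2 * a + (real j + 1) * (4 * a)) = 8 ^ k * a ^ k * (real j / 2 + 1/4) ^ k"
        unfolding z using a by (simp add: max_def power_mult_distrib)
      also have "\<dots> \<le> 8 ^ k * a ^ k * (fact k * exp (real j / 2 + 1/4))"
        using a by (intro mult_left_mono power_div_fact_le_exp) auto
      also have "\<dots> \<le> 8 ^ k * a ^ k * (fact k * (2 ^ j * 2))"
        using a e by (intro mult_left_mono) auto
      finally have "?\<phi> (- 2 * a + (real j + 1) * (4 * a)) * (1/3) ^ j \<le> 8 ^ k * a ^ k * (fact k * (2 ^ j * 2)) * (1/3) ^ j"
        by (intro mult_right_mono) auto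
      also have "\<dots> = 2 * 8 ^ k * fact k * a ^ k * (2/3) ^ j" by (simp add: power_divide)
      finally show "?\<phi> (- 2 * a + (real j + 1) * (4 * a)) * (1/3) ^ j \<le> 2 * 8 ^ k * fact k * a ^ k * (2/3) ^ j" .
    qed
    also have "\<dots> = 2 * 8 ^ k * fact k * a ^ k * (\<Sum>j<J. (2/3) ^ j)" by (simp add: sum_distrib_left)
    also have "\<dots> \<le> 2 * 8 ^ k * fact k * a ^ k * 3"
      using geometric_sum_bound[of "2/3" J] a by (intro mult_left_mono) auto
    finally show ?thesis by simp
  qed
  have "ex \<rho> (\<lambda>x. \<bar>l x\<bar> ^ k) = ex \<rho> (\<lambda>x. ?\<phi> (l x) + ?\<phi> (- l x))"
    using k by (intro ex_cong[OF \<rho>]) (auto simp: max_def abs_if)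
  also have "\<dots> = ex \<rho> (\<lambda>x. ?\<phi> (l x)) + ex \<rho> (\<lambda>x. ?\<phi> (- l x))" using \<rho> l by (intro ex_add) auto
  also have "\<dots> \<le> mom k * a ^ k"
    using half[OF l a(2)] half[of "\<lambda>x. - l x"] l a by (simp add: mom_def)
  finally show ?thesis .
qed

text \<open>The moment bound with \<open>a\<close> the root mean square. If that is zero,
  boundedness of \<open>l\<close> compares the fourth power with the second, since
  \<open>moment_bound\<close> asks for \<open>0 < a\<close>.\<close>

lemma fourth_moment:
  assumes w: "weight \<kappa> \<rho>" and l: "affine l"
  shows "ex \<rho> (\<lambda>x. l x ^ 4) \<le> mom 4 * (ex \<rho> (\<lambda>x. (l x)\<^sup>2))\<^sup>2"
proof -
  have \<rho>: "dens \<rho>" using w by (rule weight_dens)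
  define s where "s = ex \<rho> (\<lambda>x. (l x)\<^sup>2)"
  have s0: "0 \<le> s" unfolding s_def using \<rho> l by (intro ex_nonneg) auto
  show ?thesis
  proof (cases "s = 0")
    case True
    obtain B where B: "0 < B" "\<And>x. x \<in> cube \<Longrightarrow> \<bar>l x\<bar> \<le> B" using bfun_bound[of l] l by auto
    have "ex \<rho> (\<lambda>x. l x ^ 4) \<le> ex \<rho> (\<lambda>x. B\<^sup>2 * (l x)\<^sup>2)"
    proof (intro ex_mono[OF \<rho>])
      fix x assume "x \<in> cube"
      then have "\<bar>l x\<bar>\<^sup>2 \<le> B\<^sup>2" using B by (intro power_mono) auto
      then have "(l x)\<^sup>2 * (l x)\<^sup>2 \<le> B\<^sup>2 * (l x)\<^sup>2" by (intro mult_right_mono) auto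
      then show "l x ^ 4 \<le> B\<^sup>2 * (l x)\<^sup>2" by (simp add: power4_eq_xxxx power2_eq_square)
    qed (use l in auto)
    also have "\<dots> = 0" using True by (simp add: ex_cmult s_def)
    finally show ?thesis using True by (simp add: s_def)
  next
    case False
    then have "ex \<rho> (\<lambda>x. \<bar>l x\<bar> ^ 4) \<le> mom 4 * sqrt s ^ 4"
      using s0 by (intro moment_bound[OF w l]) (auto simp: s_def)
    moreover have "sqrt s ^ 4 = s\<^sup>2" using s0 real_sqrt_pow2[of s] by (metis power_mult numeral_times_numeral semiring_norm(13) mult_2_right num.distinct(1) power2_eq_square power4_eq_xxxx mult.assoc)
    ultimately show ?thesis by (simp add: s_def)
  qed
qed

section \<open>Small-ball estimates and the variance of a square\<close>

definition var :: "((nat \<Rightarrow> real) \<Rightarrow> real) \<Rightarrow> ((nat \<Rightarrow> real) \<Rightarrow> real) \<Rightarrow> real" where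
  "var \<rho> f = ex \<rho> (\<lambda>x. (f x - ex \<rho> f)\<^sup>2)"

lemma var_nonneg: "dens \<rho> \<Longrightarrow> bfun f \<Longrightarrow> 0 \<le> var \<rho> f"
  unfolding var_def by (intro ex_nonneg) auto

lemma var_alt: "dens \<rho> \<Longrightarrow> bfun f \<Longrightarrow> ex \<rho> (\<lambda>x. (f x - c)\<^sup>2) = var \<rho> f + (ex \<rho> f - c)\<^sup>2"
proof -
  assume a: "dens \<rho>" "bfun f"
  have "ex \<rho> (\<lambda>x. (f x - c)\<^sup>2) = ex \<rho> (\<lambda>x. (f x - ex \<rho> f)\<^sup>2 + 2 * (ex \<rho> f - c) * (f x - ex \<rho> f) + (ex \<rho> f - c)\<^sup>2)"
    by (intro ex_cong[OF a(1)]) (simp add: power2_eq_square algebra_simps)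
  also have "\<dots> = var \<rho> f + (ex \<rho> f - c)\<^sup>2"
    using a by (simp add: ex_linear var_def)
  finally show ?thesis .
qed

lemma var_le: "dens \<rho> \<Longrightarrow> bfun f \<Longrightarrow> var \<rho> f \<le> ex \<rho> (\<lambda>x. (f x - c)\<^sup>2)"
  using var_alt[of \<rho> f c] by simp

text \<open>If the interval has mass \<open>p\<close>, then
  \<open>T (u + h) \<le> T u - p \<le> (1 - p) * T u\<close>, so the tail beyond \<open>u\<close>
  decays geometrically in steps of \<open>h\<close>, and \<open>p ^ 3\<close> times the second
  moment about \<open>u\<close> on that side is at most \<open>2 * h\<^sup>2\<close>. The same holds
  for \<open>- l\<close> from the other end of the interval, and the two sides together dominate the
  variance.\<close>

lemma small_ball:
  assumes w: "weight \<kappa> \<rho>" and l: "affine l" and h: "0 < h"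
  shows "(pr \<rho> (\<lambda>x. u < l x \<and> l x < u + h)) ^ 3 * var \<rho> l \<le> 4 * h\<^sup>2"
proof -
  have \<rho>: "dens \<rho>" using w by (rule weight_dens)
  define p where "p = pr \<rho> (\<lambda>x. u < l x \<and> l x < u + h)"
  have [measurable]: "l \<in> borel_measurable \<Lambda>" using l by (simp add: bfun_measurable)
  have bp: "bfun (\<lambda>x. of_bool (u < l x \<and> l x < u + h))" by (intro bfun_of_bool) measurable
  have p01: "0 \<le> p" "p \<le> 1" unfolding p_def using \<rho> bp by (auto intro: pr_nonneg pr_le_1)
  have side: "p ^ 3 * ex \<rho> (\<lambda>x. (max 0 (l x - u))\<^sup>2) \<le> 2 * h\<^sup>2"
    if l: "affine l" and r: "pr \<rho> (\<lambda>x. u + h < l x) \<le> pr \<rho> (\<lambda>x. u < l x) - p" for l u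
  proof -
    let ?T = "\<lambda>s. pr \<rho> (\<lambda>x. s < l x)"
    have le1: "?T u \<le> 1" using \<rho> l by (intro pr_le_1) auto
    have "p * ?T u \<le> p * 1" using p01 le1 by (intro mult_left_mono) auto
    with r have r': "?T (u + h) \<le> (1 - p) * ?T u" by (simp add: algebra_simps)
    have geo: "?T (u + real j * h) \<le> (1 - p) ^ j" for j
    proof (rule logconcave_tail_geometric[where T="?T"])
      show "?T s * ?T t \<le> (?T ((s + t) / 2))\<^sup>2" for s t by (rule tail_logconcave[OF w l])
      show "antimono ?T" using \<rho> l by (intro tail_antimono) auto
    qed (use r' p01 h le1 \<rho> l in \<open>auto intro!: pr_nonneg\<close>)
    have "\<exists>J. ex \<rho> (\<lambda>x. (max 0 (l x - u))\<^sup>2) \<le> (\<Sum>j<J. (max 0 (u + (real j + 1) * h - u))\<^sup>2 * (1 - p) ^ j)"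
    proof (rule ex_layer[OF \<rho>])
      show "mono (\<lambda>z. (max 0 (z - u))\<^sup>2)" by (intro monoI power_mono) auto
    qed (use l h geo in auto)
    then obtain J where "ex \<rho> (\<lambda>x. (max 0 (l x - u))\<^sup>2) \<le> (\<Sum>j<J. (max 0 (u + (real j + 1) * h - u))\<^sup>2 * (1 - p) ^ j)" by blast
    also have "\<dots> = h\<^sup>2 * (\<Sum>j<J. (real j + 1)\<^sup>2 * (1 - p) ^ j)"
      using h by (simp add: sum_distrib_left max_def power_mult_distrib mult_ac)
    finally have "p ^ 3 * ex \<rho> (\<lambda>x. (max 0 (l x - u))\<^sup>2) \<le> p ^ 3 * (h\<^sup>2 * (\<Sum>j<J. (real j + 1)\<^sup>2 * (1 - p) ^ j))"
      using p01 by (intro mult_left_mono) auto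
    also have "\<dots> = h\<^sup>2 * ((1 - (1 - p)) ^ 3 * (\<Sum>j<J. (real j + 1)\<^sup>2 * (1 - p) ^ j))" by simp
    also have "\<dots> \<le> h\<^sup>2 * 2" using p01 by (intro mult_left_mono weighted_geometric_sum_bound) auto
    finally show ?thesis by simp
  qed
  have "pr \<rho> (\<lambda>x. u + h < l x) + p = ex \<rho> (\<lambda>x. of_bool (u + h < l x) + of_bool (u < l x \<and> l x < u + h))"
    unfolding p_def using \<rho> l bp by (intro ex_add[symmetric]) auto
  also have "\<dots> \<le> pr \<rho> (\<lambda>x. u < l x)"
    using h \<rho> l bp by (intro ex_mono) auto
  finally have 1: "p ^ 3 * ex \<rho> (\<lambda>x. (max 0 (l x - u))\<^sup>2) \<le> 2 * h\<^sup>2"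
    using side[OF l, of u] by simp
  have "pr \<rho> (\<lambda>x. - (u + h) + h < - l x) + p = ex \<rho> (\<lambda>x. of_bool (- (u + h) + h < - l x) + of_bool (u < l x \<and> l x < u + h))"
    unfolding p_def using \<rho> l bp by (intro ex_add[symmetric]) auto
  also have "\<dots> \<le> pr \<rho> (\<lambda>x. - (u + h) < - l x)"
    using h \<rho> l bp by (intro ex_mono) auto
  finally have 2: "p ^ 3 * ex \<rho> (\<lambda>x. (max 0 (- l x - (- (u + h))))\<^sup>2) \<le> 2 * h\<^sup>2"
    using l by (intro side) auto
  have "var \<rho> l \<le> ex \<rho> (\<lambda>x. (l x - u)\<^sup>2)" using \<rho> l by (intro var_le) auto
  also have "\<dots> \<le> ex \<rho> (\<lambda>x. (max 0 (l x - u))\<^sup>2 + (max 0 (- l x - (- (u + h))))\<^sup>2)"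
  proof (rule ex_mono[OF \<rho>])
    fix x
    show "(l x - u)\<^sup>2 \<le> (max 0 (l x - u))\<^sup>2 + (max 0 (- l x - (- (u + h))))\<^sup>2"
    proof (cases "u \<le> l x")
      case False
      then have "(u - l x)\<^sup>2 \<le> (u + h - l x)\<^sup>2" using h by (intro power_mono) auto
      then show ?thesis using False h by (simp add: max_def power2_commute)
    qed (simp add: max_def)
  qed (use l in auto)
  also have "\<dots> = ex \<rho> (\<lambda>x. (max 0 (l x - u))\<^sup>2) + ex \<rho> (\<lambda>x. (max 0 (- l x - (- (u + h))))\<^sup>2)"
    using \<rho> l by (intro ex_add) auto
  finally have "p ^ 3 * var \<rho> l \<le> p ^ 3 * (ex \<rho> (\<lambda>x. (max 0 (l x - u))\<^sup>2) + ex \<rho> (\<lambda>x. (max 0 (- l x - (- (u + h))))\<^sup>2))"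
    using p01 by (intro mult_left_mono) auto
  with 1 2 show ?thesis unfolding p_def[symmetric] distrib_left by linarith
qed

definition ip :: "(nat \<Rightarrow> real) \<Rightarrow> (nat \<Rightarrow> real) \<Rightarrow> real" where
  "ip u x = (\<Sum>i<n. u i * x i)"

lemma affine_ip [simp, intro]: "affine (ip u)"
  unfolding ip_def by auto

lemma bfun_ip [simp, intro]: "bfun (\<lambda>x. ip u x)"
  using affine_bfun[OF affine_ip, of u] by simp

text \<open>Completing the square, \<open>s * ip u (x - y) - k * norm (x - y)\<^sup>2 \<le> s\<^sup>2 * norm u\<^sup>2 / (4 * k)\<close>, so that
  the weights \<open>exp (s * ip u x)\<close> and \<open>exp (- s * ip u x)\<close> satisfy the hypothesis of Prekopa-Leindler.\<close>

lemma strong_variance: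
  assumes w: "weight \<kappa> \<rho>" and k: "0 < k" "\<And>i. i < n \<Longrightarrow> k \<le> \<kappa> i" and U: "ip u u \<le> U" "0 < U"
  shows "var \<rho> (ip u) \<le> 2 * U / k"
proof -
  have \<rho>: "dens \<rho>" using w by (rule weight_dens)
  define l where "l = (\<lambda>x. ip u x - ex \<rho> (ip u))"
  have al: "affine l" unfolding l_def by auto
  have bl [simp, intro]: "bfun l" using al by simp
  have l0: "ex \<rho> l = 0" unfolding l_def using \<rho> by (simp add: ex_linear)
  \<comment> \<open>Makes \<open>s\<^sup>2 * U / (4 * k) = 1\<close>, the exponent lost in
    completing the square.\<close>
  define s where "s = sqrt (4 * k / U)"
  have s2: "s\<^sup>2 = 4 * k / U" using k U by (simp add: s_def)
  have PL: "ex \<rho> (\<lambda>x. exp (s * l x)) * ex \<rho> (\<lambda>x. exp (- (s * l x))) \<le> (ex \<rho> (\<lambda>x. exp (1/2)))\<^sup>2"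
  proof (rule ex_prekopa_leindler[OF w])
    fix x y assume xy: "x \<in> cube" "y \<in> cube"
    have "s * l x - s * l y - (\<Sum>i<n. \<kappa> i * (x i - y i)\<^sup>2) = (\<Sum>i<n. s * u i * (x i - y i) - \<kappa> i * (x i - y i)\<^sup>2)"
      by (simp add: l_def ip_def sum_subtractf sum.distrib sum_distrib_left algebra_simps)
    also have "\<dots> \<le> (\<Sum>i<n. (s\<^sup>2 / (4 * k)) * (u i * u i))"
    proof (rule sum_mono)
      fix i assume "i \<in> {..<n}"
      then have "k * (x i - y i)\<^sup>2 \<le> \<kappa> i * (x i - y i)\<^sup>2" using k by (intro mult_right_mono) auto
      moreover have "s * u i * (x i - y i) - k * (x i - y i)\<^sup>2 \<le> (s\<^sup>2 / (4 * k)) * (u i * u i)"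
      proof -
        have "0 \<le> (s * u i - 2 * k * (x i - y i))\<^sup>2 / (4 * k)" using k by simp
        also have "\<dots> = (s\<^sup>2 / (4 * k)) * (u i * u i) - (s * u i * (x i - y i) - k * (x i - y i)\<^sup>2)"
          using k by (simp add: field_simps power2_eq_square)
        finally show ?thesis by simp
      qed
      ultimately show "s * u i * (x i - y i) - \<kappa> i * (x i - y i)\<^sup>2 \<le> (s\<^sup>2 / (4 * k)) * (u i * u i)" by linarith
    qed
    also have "\<dots> = (s\<^sup>2 / (4 * k)) * ip u u" by (simp add: ip_def sum_distrib_left)
    also have "\<dots> \<le> (s\<^sup>2 / (4 * k)) * U" using U k by (intro mult_left_mono) auto
    also have "\<dots> = 1" using s2 k U by (simp add: field_simps)
    finally have "exp (s * l x - s * l y - (\<Sum>i<n. \<kappa> i * (x i - y i)\<^sup>2)) \<le> exp 1" by simp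
    then show "exp (s * l x) * exp (- (s * l y)) * exp (- (\<Sum>i<n. \<kappa> i * (x i - y i)\<^sup>2)) \<le> (exp (1/2))\<^sup>2"
      by (simp add: power2_eq_square flip: exp_add)
  qed (auto)
  have "(ex \<rho> (\<lambda>x. exp (1/2)))\<^sup>2 = exp 1" using \<rho> by (simp add: ex_const power2_eq_square flip: exp_add)
  with PL have PL': "ex \<rho> (\<lambda>x. exp (s * l x)) * ex \<rho> (\<lambda>x. exp (- (s * l x))) \<le> 3"
    using exp_le by linarith
  \<comment> \<open>Both exponential moments are at least \<open>1\<close> because \<open>l\<close>
    is centred; so a bound for their product bounds each of them.\<close>
  have ge1: "1 \<le> ex \<rho> (\<lambda>x. exp (c * l x))" for c
  proof -
    have "1 = ex \<rho> (\<lambda>x. 1 + c * l x)" using \<rho> l0 by (simp add: ex_linear)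
    also have "\<dots> \<le> ex \<rho> (\<lambda>x. exp (c * l x))" using \<rho> by (intro ex_mono) auto
    finally show ?thesis .
  qed
  let ?P = "ex \<rho> (\<lambda>x. exp (s * l x))" and ?M = "ex \<rho> (\<lambda>x. exp (- (s * l x)))"
  have g: "1 \<le> ?P" "1 \<le> ?M" using ge1[of s] ge1[of "- s"] by auto
  have "?P * 1 \<le> ?P * ?M" "1 * ?M \<le> ?P * ?M" using g by (intro mult_mono; simp)+
  then have "?P \<le> 3" "?M \<le> 3" using PL' by auto
  have "2 + c * var \<rho> (ip u) = ex \<rho> (\<lambda>x. 2 + c * (l x)\<^sup>2)" for c
    using \<rho> by (simp add: ex_add ex_const ex_cmult var_def l_def)
  then have "2 + s\<^sup>2 / 2 * var \<rho> (ip u) = ex \<rho> (\<lambda>x. 2 + s\<^sup>2 / 2 * (l x)\<^sup>2)" .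
  also have "\<dots> \<le> ex \<rho> (\<lambda>x. exp (s * l x) + exp (- (s * l x)))"
  proof (rule ex_mono[OF \<rho>])
    fix x
    have c: "2 + z\<^sup>2 / 2 \<le> exp z + exp (- z)" if "0 \<le> z" for z :: real
      using exp_lower_Taylor_quadratic[OF that] exp_ge_add_one_self[of "- z"] by simp
    show "2 + s\<^sup>2 / 2 * (l x)\<^sup>2 \<le> exp (s * l x) + exp (- (s * l x))"
      using c[of "s * l x"] c[of "- (s * l x)"] by (cases "0 \<le> s * l x") (auto simp: power_mult_distrib)
  qed auto
  also have "\<dots> = ?P + ?M" using \<rho> by (intro ex_add) auto
  finally have "s\<^sup>2 * var \<rho> (ip u) \<le> 8" using \<open>?P \<le> 3\<close> \<open>?M \<le> 3\<close> by simp
  then show ?thesis using k U unfolding s2 by (simp add: field_simps)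
qed

text \<open>If the square of \<open>l\<close> is within \<open>\<eta>\<close> of its mean, then
  \<open>l x\<close> or \<open>- l x\<close> lies in a fixed interval of length \<open>h\<close>.
  With \<open>h\<^sup>2\<close> the variance divided by \<open>256\<close>, each of these two events
  has probability at most \<open>1/4\<close>. So the square is off its mean by
  \<open>\<eta>\<close>, the variance divided by \<open>2048\<close>, with probability at least
  \<open>1/2\<close>; and \<open>8388608 = 2 * 2048 ^ 2\<close>.\<close>

lemma quadratic_variance:
  assumes w: "weight \<kappa> \<rho>" and l: "affine l"
  shows "(var \<rho> l)\<^sup>2 \<le> 8388608 * var \<rho> (\<lambda>x. (l x)\<^sup>2)"
proof (cases "var \<rho> l = 0")
  case True
  then show ?thesis using weight_dens[OF w] l by (simp add: var_nonneg)
next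
  case False
  have \<rho>: "dens \<rho>" using w by (rule weight_dens)
  have bl: "bfun l" using l by simp
  define v where "v = var \<rho> l"
  have v: "0 < v" using False var_nonneg[OF \<rho> bl] by (simp add: v_def)
  define m where "m = ex \<rho> (\<lambda>x. (l x)\<^sup>2)"
  have m0: "0 \<le> m" unfolding m_def using \<rho> bl by (intro ex_nonneg) auto
  define h where "h = sqrt (v / 256)"
  have h: "0 < h" "h\<^sup>2 = v / 256" using v by (auto simp: h_def)
  define \<eta> where "\<eta> = h\<^sup>2 / 8"
  have \<eta>: "0 < \<eta>" "\<eta> = v / 2048" using h by (auto simp: \<eta>_def)
  \<comment> \<open>The values of \<open>\<bar>z\<bar>\<close> reach at most \<open>h / 2\<close>
    above the square root; the shift by \<open>h / 4\<close> leaves room for strict inequalities at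
    both ends. The maximum covers a mean below \<open>\<eta>\<close>.\<close>
  define u where "u = sqrt (max 0 (m - \<eta>)) - h / 4"
  have near: "u < \<bar>z\<bar> \<and> \<bar>z\<bar> < u + h" if z: "\<bar>z\<^sup>2 - m\<bar> < \<eta>" for z
  proof
    have "max 0 (m - \<eta>) \<le> z\<^sup>2" using z by auto
    then have "sqrt (max 0 (m - \<eta>)) \<le> \<bar>z\<bar>" by (metis real_sqrt_abs real_sqrt_le_iff)
    then show "u < \<bar>z\<bar>" using h by (simp add: u_def)
    have "(h / 2)\<^sup>2 = 2 * \<eta>" by (simp add: \<eta>_def power_divide)
    then have "z\<^sup>2 \<le> max 0 (m - \<eta>) + (h / 2)\<^sup>2" using z by linarith
    then have "\<bar>z\<bar> \<le> sqrt (max 0 (m - \<eta>) + (h / 2)\<^sup>2)" by (metis real_sqrt_abs real_sqrt_le_iff)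
    also have "\<dots> \<le> sqrt (max 0 (m - \<eta>)) + sqrt ((h / 2)\<^sup>2)" by (rule sqrt_add_le_add_sqrt) auto
    also have "\<dots> = sqrt (max 0 (m - \<eta>)) + h / 2" using h by simp
    finally show "\<bar>z\<bar> < u + h" using h by (simp add: u_def)
  qed
  have bp: "bfun (\<lambda>x. of_bool (u < g x \<and> g x < u + h))" if "bfun g" for g
  proof -
    note [measurable] = bfun_measurable[OF that]
    show ?thesis by (intro bfun_of_bool) measurable
  qed
  have sb: "pr \<rho> (\<lambda>x. u < g x \<and> g x < u + h) \<le> 1/4" if g: "affine g" "var \<rho> g = v" for g
  proof -
    let ?p = "pr \<rho> (\<lambda>x. u < g x \<and> g x < u + h)"
    have "?p ^ 3 * v \<le> 4 * h\<^sup>2" using small_ball[OF w g(1) h(1), of u] g by simp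
    then have "?p ^ 3 \<le> (1/4) ^ 3" using v unfolding h(2) by (simp add: field_simps power3_eq_cube)
    then have "?p ^ Suc 2 \<le> (1/4) ^ Suc 2" by (simp only: eval_nat_numeral)
    then show ?thesis by (rule power_le_imp_le_base) simp
  qed
  have vm: "var \<rho> (\<lambda>x. - l x) = v"
  proof -
    have "(- l x - ex \<rho> (\<lambda>x. - l x))\<^sup>2 = (l x - ex \<rho> l)\<^sup>2" for x
      by (simp add: ex_minus power2_commute)
    then show ?thesis by (simp add: var_def v_def)
  qed
  have "\<eta>\<^sup>2 = ex \<rho> (\<lambda>x. \<eta>\<^sup>2)" using \<rho> by (simp add: ex_const)
  also have "\<dots> \<le> ex \<rho> (\<lambda>x. ((l x)\<^sup>2 - m)\<^sup>2 + \<eta>\<^sup>2 * (of_bool (u < l x \<and> l x < u + h) + of_bool (u < - l x \<and> - l x < u + h)))"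
  proof (rule ex_mono[OF \<rho>])
    fix x
    show "\<eta>\<^sup>2 \<le> ((l x)\<^sup>2 - m)\<^sup>2 + \<eta>\<^sup>2 * (of_bool (u < l x \<and> l x < u + h) + of_bool (u < - l x \<and> - l x < u + h))"
    proof (cases "\<bar>(l x)\<^sup>2 - m\<bar> < \<eta>")
      case True
      from near[OF this] have "(u < l x \<and> l x < u + h) \<or> (u < - l x \<and> - l x < u + h)"
        by (cases "0 \<le> l x") auto
      then have "\<eta>\<^sup>2 * 1 \<le> \<eta>\<^sup>2 * (of_bool (u < l x \<and> l x < u + h) + of_bool (u < - l x \<and> - l x < u + h))"
        by (intro mult_left_mono) auto
      moreover have "0 \<le> ((l x)\<^sup>2 - m)\<^sup>2" by simp
      ultimately show ?thesis by linarith
    next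
      case False
      then have "\<eta>\<^sup>2 \<le> \<bar>(l x)\<^sup>2 - m\<bar>\<^sup>2" using \<eta> by (intro power_mono) auto
      then show ?thesis by (intro add_increasing2) auto
    qed
  qed (use bl bp[of l] bp[of "\<lambda>x. - l x"] in auto)
  also have "\<dots> = var \<rho> (\<lambda>x. (l x)\<^sup>2) + \<eta>\<^sup>2 * (pr \<rho> (\<lambda>x. u < l x \<and> l x < u + h) + pr \<rho> (\<lambda>x. u < - l x \<and> - l x < u + h))"
    using \<rho> bl bp[of l] bp[of "\<lambda>x. - l x"] by (simp add: ex_add ex_cmult var_def m_def)
  also have "\<dots> \<le> var \<rho> (\<lambda>x. (l x)\<^sup>2) + \<eta>\<^sup>2 * (1/4 + 1/4)"
    using sb[OF l] sb[of "\<lambda>x. - l x"] l vm by (intro add_left_mono mult_left_mono add_mono) (auto simp: v_def)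
  finally have "\<eta>\<^sup>2 \<le> 2 * var \<rho> (\<lambda>x. (l x)\<^sup>2)" by simp
  then show ?thesis unfolding \<eta>(2) by (simp add: power_divide v_def)
qed

section \<open>Isoperimetry in terms of one affine function\<close>

lemma ex_tendsto:
  assumes \<rho>: "dens \<rho>" and f: "\<And>k. bfun (f k)" "bfun g" and bd: "\<And>k x. x \<in> cube \<Longrightarrow> \<bar>f k x\<bar> \<le> C"
    and lim: "\<And>x. x \<in> cube \<Longrightarrow> (\<lambda>k. f k x) \<longlonglongrightarrow> g x"
  shows "(\<lambda>k. ex \<rho> (f k)) \<longlonglongrightarrow> ex \<rho> g"
  unfolding ex_def
proof (rule integral_dominated_convergence)
  note [measurable] = densD(1)[OF \<rho>] f[THEN bfun_measurable]
  show "integrable \<Lambda> (\<lambda>x. C * \<rho> x)" using densD(4)[OF \<rho>] by simp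
  show "(\<lambda>x. \<rho> x * g x) \<in> borel_measurable \<Lambda>" "(\<lambda>x. \<rho> x * f k x) \<in> borel_measurable \<Lambda>" for k by measurable
  show "AE x in \<Lambda>. (\<lambda>k. \<rho> x * f k x) \<longlonglongrightarrow> \<rho> x * g x"
  proof (rule AE_I2)
    fix x assume "x \<in> space \<Lambda>"
    then show "(\<lambda>k. \<rho> x * f k x) \<longlonglongrightarrow> \<rho> x * g x"
      using lim[of x] densD(3)[OF \<rho>, of x] by (cases "x \<in> cube") (auto intro: tendsto_mult_left)
  qed
  show "AE x in \<Lambda>. norm (\<rho> x * f k x) \<le> C * \<rho> x" for k
  proof (rule AE_I2)
    fix x assume "x \<in> space \<Lambda>"
    then show "norm (\<rho> x * f k x) \<le> C * \<rho> x"
      using bd[of x k] densD(2,3)[OF \<rho>, of x]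
      by (cases "x \<in> cube") (auto simp: abs_mult mult.commute[of C] intro: mult_left_mono)
  qed
qed

lemma pr_not:
  assumes "dens \<rho>" "bfun (\<lambda>x. of_bool (P x))"
  shows "pr \<rho> (\<lambda>x. \<not> P x) = 1 - pr \<rho> P"
  using ex_diff[of \<rho> "\<lambda>x. 1" "\<lambda>x. of_bool (P x)"] assms by (simp add: ex_const of_bool_not_iff)

text \<open>The infimum of the points with tail at most \<open>1/2\<close>; dominated convergence
  along \<open>m + e k\<close> and \<open>m - e k\<close> transfers the bounds. As the law of
  \<open>l\<close> may have atoms, both events leave out \<open>m\<close> itself.\<close>

lemma median_exists:
  assumes \<rho>: "dens \<rho>" and l: "bfun l"
  shows "\<exists>m. pr \<rho> (\<lambda>x. m < l x) \<le> 1/2 \<and> pr \<rho> (\<lambda>x. l x < m) \<le> 1/2"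
proof -
  let ?T = "\<lambda>s. pr \<rho> (\<lambda>x. s < l x)"
  obtain B where B: "0 < B" "\<And>x. x \<in> cube \<Longrightarrow> \<bar>l x\<bar> \<le> B" using bfun_bound[OF l] by blast
  define X where "X = {s. ?T s \<le> 1/2}"
  have "?T B = ex \<rho> (\<lambda>x. 0)" using B by (intro ex_cong[OF \<rho>]) (force simp: abs_le_iff)
  then have "B \<in> X" using \<rho> by (simp add: X_def ex_const)
  have low: "- B \<le> s" if "s \<in> X" for s
  proof (rule ccontr)
    assume "\<not> - B \<le> s"
    then have "?T s = ex \<rho> (\<lambda>x. 1)" using B(2) by (intro ex_cong[OF \<rho>]) (force simp: abs_le_iff)
    then show False using that \<rho> by (simp add: X_def ex_const)
  qed
  then have bdd: "bdd_below X" by (auto simp: bdd_below_def)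
  define m where "m = Inf X"
  define e where "e k = 1 / (real k + 1)" for k :: nat
  have e0: "0 < e k" for k by (simp add: e_def)
  have elim: "e \<longlonglongrightarrow> 0" unfolding e_def using LIMSEQ_inverse_real_of_nat by (simp add: inverse_eq_divide add.commute)
  have anti: "antimono ?T" using \<rho> l by (rule tail_antimono)
  have 1: "?T (m + e k) \<le> 1/2" for k
  proof -
    have "Inf X < m + e k" using e0[of k] by (simp add: m_def)
    then obtain s where "s \<in> X" "s < m + e k" using \<open>B \<in> X\<close> cInf_less_iff[OF _ bdd, of "m + e k"] by blast
    then show ?thesis using antimonoD[OF anti, of s "m + e k"] by (simp add: X_def)
  qed
  have "(\<lambda>k. ?T (m + e k)) \<longlonglongrightarrow> ?T m"
  proof (rule ex_tendsto[OF \<rho>, where C=1])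
    fix x
    show "(\<lambda>k. of_bool (m + e k < l x)) \<longlonglongrightarrow> (of_bool (m < l x) :: real)"
    proof (cases "m < l x")
      case True
      have "\<forall>\<^sub>F k in sequentially. e k < l x - m" using elim True by (intro order_tendstoD(2)) auto
      then have "\<forall>\<^sub>F k in sequentially. of_bool (m + e k < l x) = (1::real)" by eventually_elim auto
      then show ?thesis using True by (simp add: tendsto_eventually)
    next
      case False
      then have "\<not> m + e k < l x" for k using e0[of k] by linarith
      then show ?thesis using False by simp
    qed
  qed (use l in auto)
  then have m1: "?T m \<le> 1/2" using 1 by (intro LIMSEQ_le_const2) auto
  have 2: "pr \<rho> (\<lambda>x. l x \<le> m - e k) \<le> 1/2" for k
  proof -
    have "m - e k \<notin> X" using cInf_lower[OF _ bdd, of "m - e k"] e0[of k] by (auto simp: m_def)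
    then have "1/2 < ?T (m - e k)" by (simp add: X_def)
    moreover have "pr \<rho> (\<lambda>x. \<not> m - e k < l x) = 1 - ?T (m - e k)" using \<rho> l by (intro pr_not) auto
    ultimately show ?thesis by (simp add: not_less)
  qed
  have "(\<lambda>k. pr \<rho> (\<lambda>x. l x \<le> m - e k)) \<longlonglongrightarrow> pr \<rho> (\<lambda>x. l x < m)"
  proof (rule ex_tendsto[OF \<rho>, where C=1])
    fix x
    show "(\<lambda>k. of_bool (l x \<le> m - e k)) \<longlonglongrightarrow> (of_bool (l x < m) :: real)"
    proof (cases "l x < m")
      case True
      have "\<forall>\<^sub>F k in sequentially. e k < m - l x" using elim True by (intro order_tendstoD(2)) auto
      then have "\<forall>\<^sub>F k in sequentially. of_bool (l x \<le> m - e k) = (1::real)" by eventually_elim auto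
      then show ?thesis using True by (simp add: tendsto_eventually)
    next
      case False
      then have "\<not> l x \<le> m - e k" for k using e0[of k] by linarith
      then show ?thesis using False by simp
    qed
  qed (use l in auto)
  then have "pr \<rho> (\<lambda>x. l x < m) \<le> 1/2" using 2 by (intro LIMSEQ_le_const2) auto
  with m1 show ?thesis by blast
qed

text \<open>If the tail dropped by less than the stated factor in one step of length \<open>h\<close> above the median,
  log-concavity would force the same at each of the \<open>J\<close> steps leading from below \<open>-2 * a\<close> to the
  median, and the tail at the median would exceed \<open>3/4 * (1 - J * h / (20 * a)) > 1/2\<close>.\<close>

lemma tail_decay_above_median:
  assumes w: "weight \<kappa> \<rho>" and l: "affine l" and a: "ex \<rho> (\<lambda>x. (l x)\<^sup>2) \<le> a\<^sup>2" and h: "0 < h" "h \<le> a"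
    and m: "pr \<rho> (\<lambda>x. m < l x) \<le> 1/2" "pr \<rho> (\<lambda>x. l x < m) \<le> 1/2"
  shows "pr \<rho> (\<lambda>x. m + real (Suc i) * h < l x) \<le> (1 - h / (20 * a)) * pr \<rho> (\<lambda>x. m + real i * h < l x)"
proof (rule ccontr)
  assume neg: "\<not> ?thesis"
  have \<rho>: "dens \<rho>" and bl: "bfun l" using w l by (auto simp: weight_dens)
  let ?T = "\<lambda>s. pr \<rho> (\<lambda>x. s < l x)"
  have a0: "0 < a" using h by simp
  define c where "c = h / (20 * a)"
  have c: "0 < c" "c \<le> 1/20" using h a0 by (auto simp: c_def field_simps)
  have cheb: "pr \<rho> (\<lambda>x. 2 * a \<le> \<bar>l x\<bar>) \<le> 1 / 4" using pr_chebyshev[OF \<rho> bl a0 a] .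
  have m2: "m \<le> 2 * a"
  proof (rule ccontr)
    assume "\<not> m \<le> 2 * a"
    have "1 = ex \<rho> (\<lambda>x. 1)" using \<rho> by (simp add: ex_const)
    also have "\<dots> \<le> ex \<rho> (\<lambda>x. of_bool (l x < m) + of_bool (2 * a \<le> \<bar>l x\<bar>))"
      using \<rho> bl \<open>\<not> m \<le> 2 * a\<close> by (intro ex_mono) auto
    also have "\<dots> = pr \<rho> (\<lambda>x. l x < m) + pr \<rho> (\<lambda>x. 2 * a \<le> \<bar>l x\<bar>)" using \<rho> bl by (intro ex_add) auto
    finally show False using cheb m by simp
  qed
  define J where "J = nat \<lceil>4 * a / h\<rceil>"
  have J: "4 * a / h \<le> real J" "real J \<le> 5 * a / h"
  proof -
    have "1 \<le> a / h" using h by (simp add: field_simps)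
    moreover have "0 \<le> 4 * a / h" using h by simp
    ultimately show "4 * a / h \<le> real J" "real J \<le> 5 * a / h"
      unfolding J_def by (linarith, simp add: of_nat_nat) (linarith)
  qed
  define s0 where "s0 = m - real J * h"
  have "s0 \<le> - 2 * a" using J(1) h m2 by (simp add: s0_def field_simps)
  then have "pr \<rho> (\<lambda>x. l x \<le> s0) \<le> pr \<rho> (\<lambda>x. 2 * a \<le> \<bar>l x\<bar>)" using \<rho> bl a0 by (intro ex_mono) auto
  moreover have "pr \<rho> (\<lambda>x. \<not> s0 < l x) = 1 - ?T s0" using \<rho> bl by (intro pr_not) auto
  ultimately have Ts0: "3/4 \<le> ?T s0" using cheb by (simp add: not_less)
  have anti: "antimono ?T" using \<rho> bl by (rule tail_antimono)
  have nn: "0 \<le> ?T s" for s using \<rho> bl by (intro pr_nonneg) auto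
  have step: "(1 - c) * ?T (s0 + real j * h) < ?T (s0 + real j * h + h)" if "j \<le> J" for j
  proof (rule ccontr)
    assume "\<not> ?thesis"
    then have r: "?T (s0 + real j * h + h) \<le> (1 - c) * ?T (s0 + real j * h)" by simp
    \<comment> \<open>The step in which the claim is assumed to fail lies \<open>J - j + i\<close>
      steps above step \<open>j\<close>.\<close>
    have "?T ((s0 + real j * h) + real (Suc (J - j + i)) * h) \<le> (1 - c) * ?T ((s0 + real j * h) + real (J - j + i) * h)"
      using logconcave_tail_ratio[of ?T, OF tail_logconcave[OF w l] nn anti less_imp_le[OF h(1)] r, of "J - j + i"] .
    moreover have "(s0 + real j * h) + real (J - j + i) * h = m + real i * h"
      using that by (simp add: s0_def of_nat_diff algebra_simps)
    moreover have "(s0 + real j * h) + real (Suc (J - j + i)) * h = m + real (Suc i) * h"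
      using that by (simp add: s0_def of_nat_diff algebra_simps)
    ultimately show False using neg by (simp add: c_def)
  qed
  have "(1 - c) ^ j * ?T s0 \<le> ?T (s0 + real j * h)" if "j \<le> J" for j
    using that
  proof (induction j)
    case (Suc j)
    have "(1 - c) ^ Suc j * ?T s0 = (1 - c) * ((1 - c) ^ j * ?T s0)" by simp
    also have "\<dots> \<le> (1 - c) * ?T (s0 + real j * h)" using Suc c by (intro mult_left_mono) auto
    also have "\<dots> \<le> ?T (s0 + real j * h + h)" using step[of j] Suc.prems by simp
    finally show ?case by (simp add: algebra_simps)
  qed simp
  from this[of J] have "(1 - c) ^ J * ?T s0 \<le> ?T m" by (simp add: s0_def)
  moreover have "3/4 \<le> (1 - c) ^ J"
  proof -
    have "1 - real J * c \<le> (1 - c) ^ J" using Bernoulli_inequality[of "- c" J] c by simp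
    moreover have "real J * c \<le> (5 * a / h) * c" using J c by (intro mult_right_mono) auto
    moreover have "(5 * a / h) * c = 1/4" using h a0 by (simp add: c_def field_simps)
    ultimately show ?thesis by linarith
  qed
  then have "3/4 * (3/4) \<le> (1 - c) ^ J * ?T s0" using Ts0 by (intro mult_mono) auto
  ultimately show False using m(1) by simp
qed

text \<open>A one-dimensional Cheeger inequality on cells of width \<open>h\<close>, numbered from
  \<open>1\<close> above the median. Between \<open>0\<close> and a cell of \<open>W\<close> the
  membership in \<open>U\<close> changes, so the mass of \<open>W\<close> is at most the sum of the
  tails at all changes. By tail decay such a tail is at most \<open>20 * a / h\<close> times the
  mass of the one cell that follows, and this cell belongs to \<open>N\<close>.\<close>

lemma cell_bound_above_median:
  assumes w: "weight \<kappa> \<rho>" and l: "affine l" and a: "ex \<rho> (\<lambda>x. (l x)\<^sup>2) \<le> a\<^sup>2" and h: "0 < h" "h \<le> a"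
    and m: "pr \<rho> (\<lambda>x. m < l x) \<le> 1/2" "pr \<rho> (\<lambda>x. l x < m) \<le> 1/2"
    and WU: "\<And>i. i \<in> W \<Longrightarrow> (i \<in> U) \<noteq> (0 \<in> U)"
    and NU: "\<And>i. (i \<in> U) \<noteq> (Suc i \<in> U) \<Longrightarrow> Suc i \<in> N"
  shows "pr \<rho> (\<lambda>x. m < l x \<and> nat \<lceil>(l x - m) / h\<rceil> \<in> W)
    \<le> 20 * a / h * pr \<rho> (\<lambda>x. m < l x \<and> nat \<lceil>(l x - m) / h\<rceil> \<in> N)"
proof -
  have \<rho>: "dens \<rho>" and bl: "bfun l" using w l by (auto simp: weight_dens)
  note [measurable] = bfun_measurable[OF bl]
  let ?T = "\<lambda>s. pr \<rho> (\<lambda>x. s < l x)" and ?k = "\<lambda>x. nat \<lceil>(l x - m) / h\<rceil>"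
  have a0: "0 < a" using h by simp
  obtain B where B: "0 < B" "\<And>x. x \<in> cube \<Longrightarrow> \<bar>l x\<bar> \<le> B" using bfun_bound[OF bl] by blast
  define K where "K = nat \<lceil>(B - m) / h\<rceil>"
  define g where "g i = (of_bool ((i \<in> U) \<noteq> (Suc i \<in> U)) :: real)" for i
  have g0: "0 \<le> g i" for i by (simp add: g_def)
  have bW: "bfun (\<lambda>x. of_bool (m < l x \<and> ?k x \<in> W))" for W by (intro bfun_of_bool) measurable
  have kless: "m + real i * h < l x \<longleftrightarrow> i < ?k x" if "m < l x" for x i
  proof -
    have "m + real i * h < l x \<longleftrightarrow> real i < (l x - m) / h" using h by (simp add: field_simps)
    also have "\<dots> \<longleftrightarrow> int i < \<lceil>(l x - m) / h\<rceil>" by (simp add: less_ceiling_iff)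
    also have "\<dots> \<longleftrightarrow> i < ?k x" by linarith
    finally show ?thesis .
  qed
  have kK: "?k x \<le> K" if "x \<in> cube" for x
  proof -
    have "(l x - m) / h \<le> (B - m) / h" using B(2)[OF that] h by (intro divide_right_mono) (auto simp: abs_le_iff)
    then show ?thesis unfolding K_def by (intro nat_mono ceiling_mono)
  qed
  have jump: "\<exists>i<k. (i \<in> U) \<noteq> (Suc i \<in> U)" if "(k \<in> U) \<noteq> (0 \<in> U)" for k
    using that
  proof (induction k)
    case (Suc k)
    show ?case
    proof (cases "(k \<in> U) = (0 \<in> U)")
      case True
      then show ?thesis using Suc.prems by (intro exI[of _ k]) auto
    next
      case False
      then show ?thesis using Suc.IH less_Suc_eq by blast
    qed
  qed simp
  have "pr \<rho> (\<lambda>x. m < l x \<and> ?k x \<in> W) \<le> ex \<rho> (\<lambda>x. \<Sum>i<K. g i * of_bool (m + real i * h < l x))"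
  proof (rule ex_mono[OF \<rho> bW])
    show "bfun (\<lambda>x. \<Sum>i<K. g i * of_bool (m + real i * h < l x))"
      using bl by (intro bfun_sum bfun_mult bfun_const bfun_of_bool_less)
    fix x assume x: "x \<in> cube"
    show "of_bool (m < l x \<and> ?k x \<in> W) \<le> (\<Sum>i<K. g i * of_bool (m + real i * h < l x))"
    proof (cases "m < l x \<and> ?k x \<in> W")
      case True
      then obtain i where i: "i < ?k x" "(i \<in> U) \<noteq> (Suc i \<in> U)" using jump WU by blast
      have "(1::real) = g i * of_bool (m + real i * h < l x)" using i kless True by (simp add: g_def)
      also have "\<dots> \<le> (\<Sum>i<K. g i * of_bool (m + real i * h < l x))"
        using less_le_trans[OF i(1) kK[OF x]] g0 by (intro member_le_sum) auto
      finally show ?thesis using True by simp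
    next
      case False
      then have "of_bool (m < l x \<and> ?k x \<in> W) = (0::real)" by simp
      also have "\<dots> \<le> (\<Sum>i<K. g i * of_bool (m + real i * h < l x))"
        using g0 by (intro sum_nonneg mult_nonneg_nonneg) auto
      finally show ?thesis .
    qed
  qed
  also have "\<dots> = (\<Sum>i<K. g i * ?T (m + real i * h))"
    using bl by (subst ex_sum[OF \<rho>]) (auto intro!: bfun_mult simp: ex_cmult)
  also have "\<dots> \<le> (\<Sum>i<K. g i * (20 * a / h * (?T (m + real i * h) - ?T (m + real (Suc i) * h))))"
  proof (intro sum_mono mult_left_mono g0)
    fix i
    have "h / (20 * a) * ?T (m + real i * h) \<le> ?T (m + real i * h) - ?T (m + real (Suc i) * h)"
      using tail_decay_above_median[OF w l a h m, of i] by (simp add: algebra_simps)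
    then have "20 * a / h * (h / (20 * a) * ?T (m + real i * h)) \<le> 20 * a / h * (?T (m + real i * h) - ?T (m + real (Suc i) * h))"
      using h a0 by (intro mult_left_mono) auto
    moreover have "20 * a / h * (h / (20 * a) * ?T (m + real i * h)) = ?T (m + real i * h)"
      using h a0 by simp
    ultimately show "?T (m + real i * h) \<le> 20 * a / h * (?T (m + real i * h) - ?T (m + real (Suc i) * h))" by simp
  qed
  also have "\<dots> = 20 * a / h * ex \<rho> (\<lambda>x. \<Sum>i<K. g i * (of_bool (m + real i * h < l x) - of_bool (m + real (Suc i) * h < l x)))"
  proof -
    have "ex \<rho> (\<lambda>x. \<Sum>i<K. g i * (of_bool (m + real i * h < l x) - of_bool (m + real (Suc i) * h < l x)))
      = (\<Sum>i<K. g i * (?T (m + real i * h) - ?T (m + real (Suc i) * h)))"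
      using bl by (subst ex_sum[OF \<rho>]) (auto intro!: bfun_mult bfun_diff simp: ex_cmult ex_diff[OF \<rho>] simp del: of_nat_Suc)
    then show ?thesis by (simp add: sum_distrib_left mult_ac)
  qed
  also have "\<dots> \<le> 20 * a / h * pr \<rho> (\<lambda>x. m < l x \<and> ?k x \<in> N)"
  proof (intro mult_left_mono ex_mono[OF \<rho>] bW)
    show "bfun (\<lambda>x. \<Sum>i<K. g i * (of_bool (m + real i * h < l x) - of_bool (m + real (Suc i) * h < l x)))"
      using bl by (intro bfun_sum bfun_mult bfun_diff bfun_const bfun_of_bool_less)
    fix x assume x: "x \<in> cube"
    show "(\<Sum>i<K. g i * (of_bool (m + real i * h < l x) - of_bool (m + real (Suc i) * h < l x))) \<le> of_bool (m < l x \<and> ?k x \<in> N)"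
    proof (cases "m < l x")
      case True
      have "(\<Sum>i<K. g i * (of_bool (m + real i * h < l x) - of_bool (m + real (Suc i) * h < l x)))
        = (\<Sum>i<K. if i = ?k x - 1 then g i * of_bool (0 < ?k x) else 0)"
        unfolding kless[OF True] by (intro sum.cong) auto
      also have "\<dots> = (if ?k x - 1 < K then g (?k x - 1) * of_bool (0 < ?k x) else 0)" by simp
      also have "\<dots> \<le> of_bool (?k x \<in> N)"
        using NU[of "?k x - 1"] by (cases "0 < ?k x") (auto simp: g_def)
      finally show ?thesis using True by simp
    next
      case False
      have "\<not> m + real i * h < l x" for i using False h by (smt (verit) mult_nonneg_nonneg of_nat_0_le_iff)
      then have "(\<Sum>i<K. g i * (of_bool (m + real i * h < l x) - of_bool (m + real (Suc i) * h < l x))) = 0"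
        by (intro sum.neutral) (simp del: of_nat_Suc)
      then show ?thesis by simp
    qed
  qed (use h a0 in auto)
  finally show ?thesis .
qed

text \<open>\<open>Q\<close> marks the points where \<open>l\<close> separates \<open>S\<close> from
  \<open>B\<close>; the cells met by \<open>S\<close> and by \<open>B\<close> within
  \<open>Q\<close> are at least three apart. Whether the median cell is close to those of
  \<open>B\<close> decides which of the two sets the gap cuts off from the median. Only the mass of
  that set is bounded, whence the minimum.\<close>

lemma line_isoperimetry:
  assumes w: "weight \<kappa> \<rho>" and l: "affine l" and a: "ex \<rho> (\<lambda>x. (l x)\<^sup>2) \<le> a\<^sup>2" and h: "0 < h" "h \<le> a"
    and b: "bfun (\<lambda>x. of_bool (S x))" "bfun (\<lambda>x. of_bool (B x))" "bfun (\<lambda>x. of_bool (Q x))"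
    and sep: "\<And>x y. x \<in> cube \<Longrightarrow> y \<in> cube \<Longrightarrow> S x \<Longrightarrow> Q x \<Longrightarrow> B y \<Longrightarrow> Q y \<Longrightarrow> 4 * h \<le> \<bar>l x - l y\<bar>"
  shows "min (pr \<rho> S) (pr \<rho> B) \<le>
    20 * a / h * (ex \<rho> (\<lambda>x. of_bool (\<not> S x) * of_bool (\<not> B x)) + pr \<rho> (\<lambda>x. \<not> Q x)) + pr \<rho> (\<lambda>x. \<not> Q x)"
proof -
  have \<rho>: "dens \<rho>" and bl: "bfun l" using w l by (auto simp: weight_dens)
  note [measurable] = bfun_measurable[OF bl]
  have a0: "0 < a" using h by simp
  obtain m where m: "pr \<rho> (\<lambda>x. m < l x) \<le> 1/2" "pr \<rho> (\<lambda>x. l x < m) \<le> 1/2"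
    using median_exists[OF \<rho> bl] by blast
  \<comment> \<open>Cells are counted outwards from the median, so that the bound above the median
    serves both \<open>l\<close> and \<open>- l\<close>. The cell \<open>0\<close> consists of the
    points with \<open>l x = m\<close>.\<close>
  define Z where "Z x = (if m < l x then int (nat \<lceil>(l x - m) / h\<rceil>) else - int (nat \<lceil>(m - l x) / h\<rceil>))" for x
  have Zpos: "Z x = \<lceil>(l x - m) / h\<rceil>" if "m < l x" for x
  proof -
    have "0 \<le> (l x - m) / h" using that h by simp
    then show ?thesis using that by (simp add: Z_def)
  qed
  have Zneg: "Z x = - \<lceil>(m - l x) / h\<rceil>" if "\<not> m < l x" for x
  proof -
    have "0 \<le> (m - l x) / h" using that h by simp
    then show ?thesis using that by (simp add: Z_def)
  qed
  have Zlo: "(l x - m) / h - 1 \<le> real_of_int (Z x) \<and> real_of_int (Z x) \<le> (l x - m) / h + 1" for x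
  proof (cases "m < l x")
    case True
    then show ?thesis unfolding Zpos[OF True] by linarith
  next
    case False
    have "(m - l x) / h = - ((l x - m) / h)" using h by (simp add: field_simps)
    then show ?thesis unfolding Zneg[OF False] by linarith
  qed
  have Zsep: "3 \<le> \<bar>Z x - Z y\<bar>" if "x \<in> cube" "y \<in> cube" "S x" "Q x" "B y" "Q y" for x y
  proof -
    have up: "3 \<le> Z x - Z y" if *: "4 * h \<le> l x - l y" for x y
    proof -
      define p q where "p = (l x - m) / h" and "q = (l y - m) / h"
      have "4 \<le> (l x - l y) / h" using * h by (simp add: field_simps)
      then have pq: "4 \<le> p - q" by (simp add: p_def q_def diff_divide_distrib)
      show ?thesis
      proof (cases "m < l x")
        case x: True
        show ?thesis
        proof (cases "m < l y")
          case True
          then show ?thesis using pq unfolding Zpos[OF x] Zpos[OF True] p_def[symmetric] q_def[symmetric] by linarith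
        next
          case False
          have "(m - l y) / h = - q" using h by (simp add: q_def field_simps)
          then show ?thesis using pq unfolding Zpos[OF x] Zneg[OF False] p_def[symmetric] by linarith
        qed
      next
        case x: False
        then have y: "\<not> m < l y" using * h by linarith
        have "(m - l y) / h = - q" "(m - l x) / h = - p" using h by (simp_all add: p_def q_def field_simps)
        then show ?thesis using pq unfolding Zneg[OF x] Zneg[OF y] by linarith
      qed
    qed
    have "4 * h \<le> \<bar>l x - l y\<bar>" using sep that by blast
    then show ?thesis using up[of x y] up[of y x] by (cases "l y \<le> l x") auto
  qed
  define CS CB where "CS = Z ` {x \<in> cube. S x \<and> Q x}" and "CB = Z ` {x \<in> cube. B x \<and> Q x}"
  have sepC: "3 \<le> \<bar>s - t\<bar>" if "s \<in> CS" "t \<in> CB" for s t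
    using that Zsep by (auto simp: CS_def CB_def)
  \<comment> \<open>One more cell on each side of \<open>CB\<close>: where membership in
    \<open>U\<close> changes, both neighbouring cells then avoid \<open>CS\<close> and
    \<open>CB\<close>, which the distance \<open>3\<close> permits, and so belong to the
    gap.\<close>
  define U where "U = {i. \<exists>t\<in>CB. \<bar>i - t\<bar> \<le> 1}"
  define N where "N = - (CS \<union> CB)"
  have CBU: "CB \<subseteq> U" unfolding U_def by force
  have CSU: "CS \<inter> U = {}" using sepC by (force simp: U_def)
  have jump: "i \<in> N \<and> j \<in> N" if ij: "i \<in> U" "j \<notin> U" "\<bar>i - j\<bar> = 1" for i j
  proof -
    obtain t where t: "t \<in> CB" "\<bar>i - t\<bar> \<le> 1" using ij by (auto simp: U_def)
    have "i \<notin> CS" using CSU ij by blast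
    moreover have "j \<notin> CS" using sepC[of j t] t ij by auto
    moreover have "j \<notin> CB" using CBU ij by blast
    moreover have "i \<notin> CB" using ij by (auto simp: U_def)
    ultimately show ?thesis by (simp add: N_def)
  qed
  let ?R = "\<lambda>x. nat \<lceil>(l x - m) / h\<rceil>" and ?L = "\<lambda>x. nat \<lceil>(- l x - (- m)) / h\<rceil>"
  have ZR: "Z x = int (?R x)" if "m < l x" for x using that by (simp only: Z_def if_True)
  have ZL: "Z x = - int (?L x)" if "- m < - l x" for x
  proof -
    have "\<not> m < l x" "- l x - (- m) = m - l x" using that by auto
    then show ?thesis by (simp only: Z_def if_False)
  qed
  have bR: "bfun (\<lambda>x. of_bool (m < l x \<and> ?R x \<in> W))" and bL: "bfun (\<lambda>x. of_bool (- m < - l x \<and> ?L x \<in> W))" for W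
    by (intro bfun_of_bool, measurable)+
  have bQ: "bfun (\<lambda>x. of_bool (\<not> Q x))" "bfun (\<lambda>x. of_bool (\<not> S x))" "bfun (\<lambda>x. of_bool (\<not> B x))"
    using b by (simp_all add: of_bool_not_iff)
  let ?G = "ex \<rho> (\<lambda>x. of_bool (\<not> S x) * of_bool (\<not> B x)) + pr \<rho> (\<lambda>x. \<not> Q x)"
  have main: "pr \<rho> P \<le> 20 * a / h * ?G + pr \<rho> (\<lambda>x. \<not> Q x)"
    if P: "bfun (\<lambda>x. of_bool (P x))" and WU: "\<And>i. i \<in> W \<Longrightarrow> (i \<in> U) \<noteq> (0 \<in> U)"
      and PW: "\<And>x. x \<in> cube \<Longrightarrow> P x \<Longrightarrow> Q x \<Longrightarrow> Z x \<in> W" for P W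
  proof -
    let ?WR = "{k. int k \<in> W}" and ?WL = "{k. - int k \<in> W}" and ?NR = "{k. int k \<in> N}" and ?NL = "{k. - int k \<in> N}"
    have R: "pr \<rho> (\<lambda>x. m < l x \<and> ?R x \<in> ?WR) \<le> 20 * a / h * pr \<rho> (\<lambda>x. m < l x \<and> ?R x \<in> ?NR)"
    proof (rule cell_bound_above_median[OF w l a h m, where U="{k. int k \<in> U}"])
      fix i assume "(i \<in> {k. int k \<in> U}) \<noteq> (Suc i \<in> {k. int k \<in> U})"
      then show "Suc i \<in> ?NR" using jump[of "int i" "int (Suc i)"] jump[of "int (Suc i)" "int i"] by auto
    qed (use WU in auto)
    have L: "pr \<rho> (\<lambda>x. - m < - l x \<and> ?L x \<in> ?WL) \<le> 20 * a / h * pr \<rho> (\<lambda>x. - m < - l x \<and> ?L x \<in> ?NL)"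
    proof (rule cell_bound_above_median[OF w _ _ h, where U="{k. - int k \<in> U}"])
      fix i assume "(i \<in> {k. - int k \<in> U}) \<noteq> (Suc i \<in> {k. - int k \<in> U})"
      then show "Suc i \<in> ?NL" using jump[of "- int i" "- int (Suc i)"] jump[of "- int (Suc i)" "- int i"] by auto
    qed (use WU l a m in auto)
    have "pr \<rho> (\<lambda>x. m < l x \<and> ?R x \<in> ?NR) + pr \<rho> (\<lambda>x. - m < - l x \<and> ?L x \<in> ?NL)
        = ex \<rho> (\<lambda>x. of_bool (m < l x \<and> ?R x \<in> ?NR) + of_bool (- m < - l x \<and> ?L x \<in> ?NL))"
      by (simp only: ex_add[OF \<rho>] bR bL)
    also have "\<dots> \<le> ex \<rho> (\<lambda>x. of_bool (\<not> S x) * of_bool (\<not> B x) + of_bool (\<not> Q x))"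
    proof (rule ex_mono[OF \<rho>])
      fix x assume x: "x \<in> cube"
      have "\<not> S x \<and> \<not> B x" if "Q x" "(m < l x \<and> ?R x \<in> ?NR) \<or> (- m < - l x \<and> ?L x \<in> ?NL)"
      proof -
        have "Z x \<in> N" using that(2)
        proof
          assume *: "m < l x \<and> ?R x \<in> ?NR"
          then have "int (?R x) \<in> N" by blast
          with * ZR show ?thesis by simp
        next
          assume *: "- m < - l x \<and> ?L x \<in> ?NL"
          then have "- int (?L x) \<in> N" by blast
          with * ZL show ?thesis by simp
        qed
        then show ?thesis using x that(1) by (auto simp: N_def CS_def CB_def)
      qed
      then show "of_bool (m < l x \<and> ?R x \<in> ?NR) + of_bool (- m < - l x \<and> ?L x \<in> ?NL)
          \<le> of_bool (\<not> S x) * of_bool (\<not> B x) + (of_bool (\<not> Q x) :: real)"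
        by (rule of_bool_add_le) auto
    qed (intro bfun_add bfun_mult bR bL bQ)+
    also have "\<dots> = ?G" by (simp only: ex_add[OF \<rho>] bfun_mult bQ)
    finally have NG: "pr \<rho> (\<lambda>x. m < l x \<and> ?R x \<in> ?NR) + pr \<rho> (\<lambda>x. - m < - l x \<and> ?L x \<in> ?NL) \<le> ?G" .
    have "pr \<rho> P \<le> ex \<rho> (\<lambda>x. of_bool (m < l x \<and> ?R x \<in> ?WR) + of_bool (- m < - l x \<and> ?L x \<in> ?WL) + of_bool (\<not> Q x))"
    proof (rule ex_mono[OF \<rho> P])
      fix x assume x: "x \<in> cube"
      have "(m < l x \<and> ?R x \<in> ?WR) \<or> (- m < - l x \<and> ?L x \<in> ?WL)" if "P x" "Q x"
      proof -
        have ZW: "Z x \<in> W" using PW x that by blast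
        consider "m < l x" | "l x = m" | "l x < m" by linarith
        then show ?thesis
        proof cases
          case 2
          then have "Z x = 0" by (simp add: Z_def)
          then show ?thesis using ZW WU[of 0] by simp
        next
          case 1
          then show ?thesis using ZW unfolding ZR[OF 1] by blast
        next
          case 3
          then have "- m < - l x" by simp
          then show ?thesis using ZW unfolding ZL[OF \<open>- m < - l x\<close>] by blast
        qed
      qed
      then show "of_bool (P x) \<le> of_bool (m < l x \<and> ?R x \<in> ?WR) + of_bool (- m < - l x \<and> ?L x \<in> ?WL) + (of_bool (\<not> Q x) :: real)"
        by (rule of_bool_le_add3)
    qed (intro bfun_add bR bL bQ)
    also have "\<dots> = pr \<rho> (\<lambda>x. m < l x \<and> ?R x \<in> ?WR) + pr \<rho> (\<lambda>x. - m < - l x \<and> ?L x \<in> ?WL) + pr \<rho> (\<lambda>x. \<not> Q x)"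
      by (simp only: ex_add[OF \<rho>] bfun_add bR bL bQ)
    also have "\<dots> \<le> 20 * a / h * (pr \<rho> (\<lambda>x. m < l x \<and> ?R x \<in> ?NR) + pr \<rho> (\<lambda>x. - m < - l x \<and> ?L x \<in> ?NL)) + pr \<rho> (\<lambda>x. \<not> Q x)"
      using R L unfolding distrib_left by linarith
    also have "\<dots> \<le> 20 * a / h * ?G + pr \<rho> (\<lambda>x. \<not> Q x)"
      using mult_left_mono[OF NG, of "20 * a / h"] h a0 by simp
    finally show ?thesis .
  qed
  show ?thesis
  proof (cases "0 \<in> U")
    case True
    have "pr \<rho> S \<le> 20 * a / h * ?G + pr \<rho> (\<lambda>x. \<not> Q x)"
      using True CSU by (intro main[where W=CS] b) (auto simp: CS_def)
    then show ?thesis by linarith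
  next
    case False
    have "pr \<rho> B \<le> 20 * a / h * ?G + pr \<rho> (\<lambda>x. \<not> Q x)"
      using False CBU by (intro main[where W=CB] b) (auto simp: CB_def)
    then show ?thesis by linarith
  qed
qed

section \<open>Needles\<close>

abbreviation mn :: "((nat \<Rightarrow> real) \<Rightarrow> real) \<Rightarrow> nat \<Rightarrow> real" where
  "mn \<rho> i \<equiv> ex \<rho> (\<lambda>x. x i)"

definition ce :: "((nat \<Rightarrow> real) \<Rightarrow> real) \<Rightarrow> nat \<Rightarrow> (nat \<Rightarrow> real) \<Rightarrow> real" where
  "ce \<rho> i x = x i - mn \<rho> i"

definition along :: "((nat \<Rightarrow> real) \<Rightarrow> real) \<Rightarrow> (nat \<Rightarrow> real) \<Rightarrow> (nat \<Rightarrow> real) \<Rightarrow> real" where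
  "along \<rho> e x = (\<Sum>k<n. e k * ce \<rho> k x)"

definition across :: "((nat \<Rightarrow> real) \<Rightarrow> real) \<Rightarrow> (nat \<Rightarrow> real) \<Rightarrow> nat \<Rightarrow> (nat \<Rightarrow> real) \<Rightarrow> real" where
  "across \<rho> e j x = ce \<rho> j x - e j * along \<rho> e x"

text \<open>For a unit vector \<open>e\<close>, the mean squared distance from the line through the
  mean in direction \<open>e\<close>, that is, the trace of the covariance minus the variance along
  \<open>e\<close>. It is small exactly for weights close to a needle in this direction.\<close>

definition defect :: "((nat \<Rightarrow> real) \<Rightarrow> real) \<Rightarrow> (nat \<Rightarrow> real) \<Rightarrow> real" where
  "defect \<rho> e = ex \<rho> (\<lambda>x. \<Sum>j<n. (across \<rho> e j x)\<^sup>2)"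

definition nsq :: "(nat \<Rightarrow> real) \<Rightarrow> real" where
  "nsq x = (\<Sum>i<n. (x i)\<^sup>2)"

lemma bfun_ce [simp, intro]: "bfun (\<lambda>x. ce \<rho> i x)"
  by (auto simp: ce_def)

lemma affine_ce [simp, intro]: "i < n \<Longrightarrow> affine (\<lambda>x. ce \<rho> i x)"
  by (auto simp: ce_def)

lemma affine_along [simp, intro]: "affine (\<lambda>x. along \<rho> e x)"
  by (auto simp: along_def)

lemma bfun_along [simp, intro]: "bfun (\<lambda>x. along \<rho> e x)"
  by (auto simp: along_def)

lemma affine_across [simp, intro]: "j < n \<Longrightarrow> affine (\<lambda>x. across \<rho> e j x)"
  by (auto simp: across_def)

lemma bfun_across [simp, intro]: "bfun (\<lambda>x. across \<rho> e j x)"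
  by (auto simp: across_def)

lemma bfun_nsq [simp, intro]: "bfun (\<lambda>x. nsq x)"
  by (auto simp: nsq_def)

lemma bfun_nsq' [simp, intro]: "bfun nsq"
  using bfun_nsq by simp

lemma ex_ce [simp]: "dens \<rho> \<Longrightarrow> ex \<rho> (\<lambda>x. ce \<rho> i x) = 0"
  by (simp add: ce_def ex_linear)

lemma ex_along [simp]: "dens \<rho> \<Longrightarrow> ex \<rho> (\<lambda>x. along \<rho> e x) = 0"
  by (simp add: along_def ex_linear)

lemma abs_mn_le: "dens \<rho> \<Longrightarrow> i < n \<Longrightarrow> \<bar>mn \<rho> i\<bar> \<le> R"
  by (rule ex_abs_le) (auto simp: cubeD)

lemma abs_ce_le: "dens \<rho> \<Longrightarrow> i < n \<Longrightarrow> x \<in> cube \<Longrightarrow> \<bar>ce \<rho> i x\<bar> \<le> 2 * R"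
  using abs_mn_le[of \<rho> i] cubeD(2)[of x i] unfolding ce_def by linarith

text \<open>The middle term is odd in \<open>l\<close>. Averaged over \<open>l\<close> and
  \<open>- l\<close>, the variance drops by exactly the squared correlation of \<open>g\<close> with
  \<open>l\<close>: this makes the trace decrease in the needle argument and limits the loss of
  variance in the thin-shell argument.\<close>

lemma var_tilt:
  assumes \<rho>: "dens \<rho>" and l: "bfun l" "ex \<rho> l = 0" "\<And>x. x \<in> cube \<Longrightarrow> \<bar>l x\<bar> \<le> 1" and g: "bfun g"
  shows "var (tilt \<rho> l) g = var \<rho> g + ex \<rho> (\<lambda>x. (g x - ex \<rho> g)\<^sup>2 * l x) - (ex \<rho> (\<lambda>x. (g x - ex \<rho> g) * l x))\<^sup>2"
proof -
  have d: "dens (tilt \<rho> l)" using \<rho> l by (rule dens_tilt)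
  have "ex \<rho> (\<lambda>x. (g x - ex \<rho> g) * l x) = ex \<rho> (\<lambda>x. g x * l x - ex \<rho> g * l x)"
    by (simp add: algebra_simps)
  then have e: "ex (tilt \<rho> l) g - ex \<rho> g = ex \<rho> (\<lambda>x. (g x - ex \<rho> g) * l x)"
    using \<rho> l g by (simp add: ex_tilt ex_diff ex_cmult)
  have "ex (tilt \<rho> l) (\<lambda>x. (g x - ex \<rho> g)\<^sup>2) = var \<rho> g + ex \<rho> (\<lambda>x. (g x - ex \<rho> g)\<^sup>2 * l x)"
    using \<rho> l g by (simp add: ex_tilt var_def)
  then show ?thesis using var_alt[OF d g, of "ex \<rho> g"] by (simp add: e)
qed

lemma var_coord: "var \<rho> (\<lambda>x. x i) = ex \<rho> (\<lambda>x. (ce \<rho> i x)\<^sup>2)"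
  by (simp add: var_def ce_def)

lemma across_alt: "j < n \<Longrightarrow> across \<rho> e j x = (\<Sum>k<n. (of_bool (k = j) - e j * e k) * ce \<rho> k x)"
  unfolding across_def along_def
  by (simp only: left_diff_distrib sum_subtractf sum_of_bool_eq_mult mult.assoc sum_distrib_left)

lemma unit_coord_le: "ip e e = 1 \<Longrightarrow> k < n \<Longrightarrow> \<bar>e k\<bar> \<le> 1"
proof -
  assume e: "ip e e = 1" and k: "k < n"
  have "e k * e k \<le> ip e e" unfolding ip_def using k by (intro member_le_sum) auto
  then show ?thesis using e abs_square_le_1[of "e k"] by (simp add: power2_eq_square)
qed

lemma abs_across_le:
  assumes "dens \<rho>" "ip e e = 1" "j < n" "x \<in> cube"
  shows "\<bar>across \<rho> e j x\<bar> \<le> 4 * real n * R"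
proof -
  have "\<bar>along \<rho> e x\<bar> \<le> (\<Sum>k<n. \<bar>e k * ce \<rho> k x\<bar>)" unfolding along_def by (rule sum_abs)
  also have "\<dots> \<le> (\<Sum>k<n. 1 * (2 * R))"
    unfolding abs_mult using assms unit_coord_le abs_ce_le by (intro sum_mono mult_mono) auto
  finally have 1: "\<bar>along \<rho> e x\<bar> \<le> 2 * real n * R" by simp
  have "\<bar>e j * along \<rho> e x\<bar> \<le> 1 * (2 * real n * R)"
    unfolding abs_mult using assms 1 unit_coord_le by (intro mult_mono) auto
  moreover have "\<bar>ce \<rho> j x\<bar> \<le> 2 * R" using assms by (intro abs_ce_le)
  moreover have "2 * R \<le> 2 * real n * R" using n_pos R_pos by simp
  ultimately show ?thesis unfolding across_def by linarith
qed

text \<open>The supremum of \<open>ex \<rho> \<psi> - \<zeta> * (trace of the covariance)\<close> over the weights with \<open>ex \<rho> f = 0\<close>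
  cannot be positive: a near-maximiser has defect bounded below, so tilting it by plus or minus a small
  multiple of some \<open>across \<rho> e j\<close>, which is orthogonal to \<open>f\<close>, lowers the trace on average by a fixed amount.\<close>

theorem needle_principle:
  assumes w0: "weight \<kappa> \<rho>0" and f: "bfun f" "ex \<rho>0 f = 0" and \<psi>: "bfun \<psi>"
    and leaf: "\<And>\<rho> e. weight \<kappa> \<rho> \<Longrightarrow> ex \<rho> f = 0 \<Longrightarrow> ip e e = 1 \<Longrightarrow> ex \<rho> \<psi> \<le> C * defect \<rho> e"
  shows "ex \<rho>0 \<psi> \<le> 0"
proof (rule ccontr)
  assume neg: "\<not> ?thesis"
  define c0 where "c0 = ex \<rho>0 \<psi>"
  have c0: "0 < c0" using neg by (simp add: c0_def)
  define tr where "tr \<rho> = (\<Sum>k<n. var \<rho> (\<lambda>x. x k))" for \<rho>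
  have tr: "0 \<le> tr \<rho>" "tr \<rho> \<le> real n * R\<^sup>2" if \<rho>: "dens \<rho>" for \<rho>
  proof -
    show "0 \<le> tr \<rho>" unfolding tr_def using \<rho> by (intro sum_nonneg var_nonneg) auto
    have "var \<rho> (\<lambda>x. x k) \<le> R\<^sup>2" if k: "k < n" for k
    proof -
      have "var \<rho> (\<lambda>x. x k) \<le> ex \<rho> (\<lambda>x. (x k - 0)\<^sup>2)" using \<rho> by (intro var_le) auto
      also have "\<dots> \<le> ex \<rho> (\<lambda>x. R\<^sup>2)"
      proof (rule ex_mono[OF \<rho>])
        fix x assume "x \<in> cube"
        then have "\<bar>x k\<bar>\<^sup>2 \<le> R\<^sup>2" using k by (intro power_mono) (auto simp: cubeD)
        then show "(x k - 0)\<^sup>2 \<le> R\<^sup>2" by simp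
      qed auto
      finally show ?thesis using \<rho> by (simp add: ex_const)
    qed
    then have "tr \<rho> \<le> (\<Sum>k<n. R\<^sup>2)" unfolding tr_def by (intro sum_mono) auto
    then show "tr \<rho> \<le> real n * R\<^sup>2" by simp
  qed
  \<comment> \<open>So small that the penalty costs \<open>\<rho>0\<close> at most half of
    \<open>c0\<close>.\<close>
  define \<zeta> where "\<zeta> = c0 / (2 * (real n * R\<^sup>2 + 1))"
  have nR: "0 < real n * R\<^sup>2 + 1" by (intro add_nonneg_pos) auto
  then have \<zeta>: "0 < \<zeta>" using c0 by (simp add: \<zeta>_def)
  define \<epsilon> where "\<epsilon> = 1 / (8 * real n * R)"
  have \<epsilon>: "0 < \<epsilon>" using n_pos R_pos by (simp add: \<epsilon>_def)
  define D where "D = max C 1"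
  define \<delta> where "\<delta> = c0 / 4 / D"
  have D: "0 < D" "C \<le> D" and \<delta>: "0 < \<delta>" using c0 by (auto simp: D_def \<delta>_def)
  \<comment> \<open>The average gain of \<open>Y\<close> over a pair of tilts, the same for all
    weights close to the supremum.\<close>
  define \<gamma> where "\<gamma> = \<zeta> * (\<epsilon>\<^sup>2 * (\<delta> / real n)\<^sup>2)"
  have \<gamma>: "0 < \<gamma>" using \<zeta> \<epsilon> \<delta> n_pos by (simp add: \<gamma>_def)
  define Y where "Y \<rho> = ex \<rho> \<psi> - \<zeta> * tr \<rho>" for \<rho>
  define X where "X = Y ` {\<rho>. weight \<kappa> \<rho> \<and> ex \<rho> f = 0}"
  obtain B where B: "\<And>x. x \<in> cube \<Longrightarrow> \<bar>\<psi> x\<bar> \<le> B" using bfun_bound[OF \<psi>] by blast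
  have "y \<le> B" if "y \<in> X" for y
  proof -
    obtain \<rho> where "weight \<kappa> \<rho>" and y: "y = Y \<rho>" using \<open>y \<in> X\<close> by (auto simp: X_def)
    then have \<rho>: "dens \<rho>" by (simp add: weight_dens)
    have "0 \<le> \<zeta> * tr \<rho>" using \<zeta> tr[OF \<rho>] by simp
    then show ?thesis using ex_abs_le[OF \<rho> \<psi> B] by (simp add: y Y_def abs_le_iff)
  qed
  then have bdd: "bdd_above X" by (auto simp: bdd_above_def)
  have Y0X: "Y \<rho>0 \<in> X" using w0 f by (auto simp: X_def)
  have "c0 / 2 \<le> Y \<rho>0"
  proof -
    have "\<zeta> * tr \<rho>0 \<le> \<zeta> * (real n * R\<^sup>2 + 1)"
      using tr[OF weight_dens[OF w0]] \<zeta> by (intro mult_left_mono) auto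
    also have "\<dots> = c0 / 2"
    proof -
      have "c0 / (2 * z) * z = c0 / 2" if "0 < z" for z using that by simp
      from this[OF nR] show ?thesis unfolding \<zeta>_def .
    qed
    finally show ?thesis by (simp add: Y_def c0_def)
  qed
  then have s: "c0 / 2 \<le> Sup X" using cSup_upper[OF Y0X bdd] by linarith
  have "Sup X - min \<gamma> (c0 / 4) < Sup X" using \<gamma> c0 by simp
  then obtain \<rho> where w: "weight \<kappa> \<rho>" and f0: "ex \<rho> f = 0" and Y\<rho>: "Sup X - min \<gamma> (c0 / 4) < Y \<rho>"
    using less_cSup_iff[OF _ bdd, of "Sup X - min \<gamma> (c0 / 4)"] Y0X by (auto simp: X_def)
  have \<rho>: "dens \<rho>" using w by (rule weight_dens)
  have "c0 / 4 < Y \<rho>" using Y\<rho> s by linarith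
  then have \<psi>\<rho>: "c0 / 4 \<le> ex \<rho> \<psi>" using \<zeta> tr(1)[OF \<rho>] unfolding Y_def
    by (smt (verit) mult_nonneg_nonneg)
  \<comment> \<open>The vector of correlations of \<open>f\<close> with the coordinates singles out
    one forbidden direction \<open>e\<close>; tilts with gradient orthogonal to it leave the mean of
    \<open>f\<close> unchanged.\<close>
  define v where "v i = ex \<rho> (\<lambda>x. f x * ce \<rho> i x)" for i
  obtain e where e: "ip e e = 1" and ve: "\<And>j. j < n \<Longrightarrow> v j = e j * ip e v"
  proof (cases "ip v v = 0")
    case True
    have v0: "v j = 0" if "j < n" for j
    proof -
      have "v j * v j \<le> ip v v" unfolding ip_def using that by (intro member_le_sum) auto
      then show ?thesis using True by (metis mult_le_0_iff order_antisym_conv zero_le_square mult_eq_0_iff)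
    qed
    define e where "e j = (of_bool (j = 0) :: real)" for j :: nat
    have "ip e e = 1" unfolding ip_def e_def using sum_of_bool_eq_mult[OF n_pos, of "\<lambda>k. of_bool (k = 0)"] by simp
    moreover have "ip e v = 0" using v0 by (auto simp: ip_def intro!: sum.neutral)
    ultimately show thesis using that[of e] v0 by simp
  next
    case False
    moreover have "0 \<le> ip v v" unfolding ip_def by (intro sum_nonneg) auto
    ultimately have pos: "0 < ip v v" by simp
    define s where "s = sqrt (ip v v)"
    have s: "0 < s" "s * s = ip v v" using pos by (auto simp: s_def)
    have s1: "ip (\<lambda>j. v j / s) v = s"
    proof -
      have "ip (\<lambda>j. v j / s) v = ip v v / s" by (simp add: ip_def sum_divide_distrib)
      then show ?thesis using s(1) unfolding s(2)[symmetric] by simp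
    qed
    have "ip (\<lambda>j. v j / s) (\<lambda>j. v j / s) = ip v v / (s * s)" by (simp add: ip_def sum_divide_distrib)
    then have "ip (\<lambda>j. v j / s) (\<lambda>j. v j / s) = 1" using s pos by simp
    then show thesis using that[of "\<lambda>j. v j / s"] s s1 by simp
  qed
  have "c0 / 4 \<le> C * defect \<rho> e" using leaf[OF w f0 e] \<psi>\<rho> by linarith
  also have "\<dots> \<le> D * defect \<rho> e"
    using D \<rho> unfolding defect_def by (intro mult_right_mono ex_nonneg) (auto intro!: sum_nonneg)
  finally have "\<delta> \<le> defect \<rho> e" using D by (simp add: \<delta>_def field_simps)
  also have "defect \<rho> e = (\<Sum>j<n. ex \<rho> (\<lambda>x. (across \<rho> e j x)\<^sup>2))"
    unfolding defect_def using \<rho> by (simp add: ex_sum)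
  finally have "\<exists>j<n. \<delta> / real n \<le> ex \<rho> (\<lambda>x. (across \<rho> e j x)\<^sup>2)"
  proof -
    assume *: "\<delta> \<le> (\<Sum>j<n. ex \<rho> (\<lambda>x. (across \<rho> e j x)\<^sup>2))"
    show ?thesis
    proof (rule ccontr)
      assume "\<not> ?thesis"
      then have "(\<Sum>j<n. ex \<rho> (\<lambda>x. (across \<rho> e j x)\<^sup>2)) < (\<Sum>j<n. \<delta> / real n)"
        using n_pos by (intro sum_strict_mono) (auto simp: not_le)
      then show False using * n_pos by simp
    qed
  qed
  then obtain j where j: "j < n" "\<delta> / real n \<le> ex \<rho> (\<lambda>x. (across \<rho> e j x)\<^sup>2)" by blast
  define l where "l = (\<lambda>x. \<epsilon> * across \<rho> e j x)"
  have al: "affine l" "affine (\<lambda>x. - l x)" using j by (auto simp: l_def)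
  then have bl: "bfun l" "bfun (\<lambda>x. - l x)" by auto
  have l0: "ex \<rho> l = 0" unfolding l_def using \<rho> by (simp add: across_def ex_linear)
  have fl: "ex \<rho> (\<lambda>x. f x * l x) = 0"
  proof -
    have fa: "ex \<rho> (\<lambda>x. f x * along \<rho> e x) = ip e v"
    proof -
      have "(\<lambda>x. f x * along \<rho> e x) = (\<lambda>x. \<Sum>k<n. e k * (f x * ce \<rho> k x))"
        by (simp add: along_def sum_distrib_left mult_ac)
      then show ?thesis using \<rho> f by (simp add: ex_sum ex_cmult ip_def v_def)
    qed
    have "(\<lambda>x. f x * l x) = (\<lambda>x. \<epsilon> * (f x * ce \<rho> j x - e j * (f x * along \<rho> e x)))"
      by (simp add: l_def across_def algebra_simps)
    then have "ex \<rho> (\<lambda>x. f x * l x) = \<epsilon> * (v j - e j * ip e v)"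
      using \<rho> f by (simp add: ex_cmult ex_diff fa v_def)
    then show ?thesis using ve[OF j(1)] by simp
  qed
  have lb: "\<bar>l x\<bar> \<le> 1/2" if "x \<in> cube" for x
  proof -
    have "\<bar>l x\<bar> \<le> \<epsilon> * (4 * real n * R)"
      unfolding l_def abs_mult using \<epsilon> abs_across_le[OF \<rho> e j(1) that] by (simp add: mult_left_mono)
    also have "\<dots> = 1/2" using n_pos R_pos by (simp add: \<epsilon>_def)
    finally show ?thesis .
  qed
  have child: "Y (tilt \<rho> h) \<le> Sup X" if h: "h = l \<or> h = (\<lambda>x. - l x)" for h
  proof -
    have "weight \<kappa> (tilt \<rho> h)"
      using h al bl l0 lb by (intro weight_tilt[OF w]) (auto simp: affine_def ex_minus)
    moreover have "ex (tilt \<rho> h) f = 0"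
      using h \<rho> bl f f0 fl by (auto simp: ex_tilt ex_minus)
    ultimately show ?thesis using bdd by (intro cSup_upper) (auto simp: X_def)
  qed
  have vt: "var (tilt \<rho> l) g + var (tilt \<rho> (\<lambda>x. - l x)) g = 2 * var \<rho> g - 2 * (ex \<rho> (\<lambda>x. (g x - ex \<rho> g) * l x))\<^sup>2"
    if "bfun g" for g
  proof -
    have lb1: "\<bar>l x\<bar> \<le> 1" "\<bar>- l x\<bar> \<le> 1" if "x \<in> cube" for x using lb[OF that] by auto
    have "ex \<rho> (\<lambda>x. - l x) = 0" using l0 by (simp add: ex_minus)
    from var_tilt[OF \<rho> bl(1) l0 lb1(1) that] var_tilt[OF \<rho> bl(2) this lb1(2) that]
    show ?thesis by (simp add: ex_minus)
  qed
  have "tr (tilt \<rho> l) + tr (tilt \<rho> (\<lambda>x. - l x)) = 2 * tr \<rho> - 2 * (\<Sum>k<n. (ex \<rho> (\<lambda>x. ce \<rho> k x * l x))\<^sup>2)"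
    unfolding tr_def sum.distrib[symmetric] by (simp add: vt sum_subtractf sum_distrib_left ce_def)
  moreover have "\<epsilon>\<^sup>2 * (\<delta> / real n)\<^sup>2 \<le> (\<Sum>k<n. (ex \<rho> (\<lambda>x. ce \<rho> k x * l x))\<^sup>2)"
  proof -
    \<comment> \<open>\<open>across \<rho> e j\<close> is the linear form with coefficients
      \<open>\<theta>\<close>, a projected unit vector and so of norm at most \<open>1\<close>. By
      Cauchy-Schwarz its variance is at most the norm of its correlations \<open>b\<close> with the
      coordinates.\<close>
    define \<theta> where "\<theta> k = of_bool (k = j) - e j * e k" for k
    define b where "b k = ex \<rho> (\<lambda>x. ce \<rho> k x * across \<rho> e j x)" for k
    have \<theta>1: "(\<Sum>k<n. (\<theta> k)\<^sup>2) \<le> 1"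
    proof -
      have "(\<Sum>k<n. (\<theta> k)\<^sup>2) = (\<Sum>k<n. of_bool (k = j) - 2 * (e j * (of_bool (k = j) * e k)) + (e j)\<^sup>2 * (e k * e k))"
        by (intro sum.cong) (auto simp: \<theta>_def power2_eq_square algebra_simps)
      also have "\<dots> = 1 - 2 * (e j * e j) + (e j)\<^sup>2 * ip e e"
        using sum_of_bool_eq_mult[OF j(1), of "\<lambda>k. 1"] sum_of_bool_eq_mult[OF j(1), of e]
        by (simp only: sum.distrib sum_subtractf ip_def flip: sum_distrib_left) simp
      also have "\<dots> \<le> 1" by (simp add: e power2_eq_square)
      finally show ?thesis .
    qed
    have "ex \<rho> (\<lambda>x. (across \<rho> e j x)\<^sup>2) = ex \<rho> (\<lambda>x. \<Sum>k<n. \<theta> k * (ce \<rho> k x * across \<rho> e j x))"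
      by (subst power2_eq_square, subst (1) across_alt[OF j(1)]) (simp add: \<theta>_def sum_distrib_right sum_distrib_left mult_ac)
    also have "\<dots> = (\<Sum>k<n. \<theta> k * b k)" using \<rho> by (simp add: ex_sum ex_cmult b_def)
    finally have eq: "ex \<rho> (\<lambda>x. (across \<rho> e j x)\<^sup>2) = (\<Sum>k<n. \<theta> k * b k)" .
    have "(\<delta> / real n)\<^sup>2 \<le> (\<Sum>k<n. \<theta> k * b k)\<^sup>2" using j \<delta> unfolding eq by (intro power_mono) auto
    also have "\<dots> \<le> (\<Sum>k<n. (\<theta> k)\<^sup>2) * (\<Sum>k<n. (b k)\<^sup>2)" by (rule Cauchy_Schwarz_ineq_sum)
    also have "\<dots> \<le> 1 * (\<Sum>k<n. (b k)\<^sup>2)" using \<theta>1 by (intro mult_right_mono sum_nonneg) auto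
    finally have "\<epsilon>\<^sup>2 * (\<delta> / real n)\<^sup>2 \<le> \<epsilon>\<^sup>2 * (\<Sum>k<n. (b k)\<^sup>2)" by (intro mult_left_mono) auto
    also have "\<dots> = (\<Sum>k<n. (ex \<rho> (\<lambda>x. ce \<rho> k x * l x))\<^sup>2)"
    proof -
      have "(\<lambda>x. ce \<rho> k x * l x) = (\<lambda>x. \<epsilon> * (ce \<rho> k x * across \<rho> e j x))" for k by (simp add: l_def mult_ac)
      then show ?thesis by (simp add: ex_cmult b_def power_mult_distrib sum_distrib_left)
    qed
    finally show ?thesis .
  qed
  ultimately have "tr (tilt \<rho> l) + tr (tilt \<rho> (\<lambda>x. - l x)) \<le> 2 * tr \<rho> - 2 * (\<epsilon>\<^sup>2 * (\<delta> / real n)\<^sup>2)" by linarith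
  then have "\<zeta> * (tr (tilt \<rho> l) + tr (tilt \<rho> (\<lambda>x. - l x))) \<le> \<zeta> * (2 * tr \<rho> - 2 * (\<epsilon>\<^sup>2 * (\<delta> / real n)\<^sup>2))"
    using \<zeta> by (intro mult_left_mono) auto
  then have "\<zeta> * tr (tilt \<rho> l) + \<zeta> * tr (tilt \<rho> (\<lambda>x. - l x)) \<le> 2 * (\<zeta> * tr \<rho>) - 2 * \<gamma>"
    by (simp add: \<gamma>_def algebra_simps)
  moreover have "ex (tilt \<rho> l) \<psi> + ex (tilt \<rho> (\<lambda>x. - l x)) \<psi> = 2 * ex \<rho> \<psi>"
    using \<rho> bl \<psi> by (simp add: ex_tilt ex_minus)
  ultimately have "2 * Y \<rho> + 2 * \<gamma> \<le> Y (tilt \<rho> l) + Y (tilt \<rho> (\<lambda>x. - l x))"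
    unfolding Y_def by (simp add: algebra_simps)
  then show False using child[of l] child[of "\<lambda>x. - l x"] Y\<rho> by auto
qed

section \<open>Inequalities verified on needles\<close>

definition wid :: "((nat \<Rightarrow> real) \<Rightarrow> real) \<Rightarrow> (nat \<Rightarrow> real) \<Rightarrow> (nat \<Rightarrow> real) \<Rightarrow> real" where
  "wid \<rho> e x = (\<Sum>j<n. (across \<rho> e j x)\<^sup>2)"

lemma bfun_wid [simp, intro]: "bfun (\<lambda>x. wid \<rho> e x)"
  by (auto simp: wid_def)

lemma wid_nonneg: "0 \<le> wid \<rho> e x"
  by (auto simp: wid_def intro: sum_nonneg)

lemma defect_wid: "defect \<rho> e = ex \<rho> (\<lambda>x. wid \<rho> e x)"
  by (simp add: defect_def wid_def)

lemma defect_nonneg: "dens \<rho> \<Longrightarrow> 0 \<le> defect \<rho> e"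
  unfolding defect_wid by (intro ex_nonneg) (auto simp: wid_nonneg)

lemma across_orth:
  assumes "ip e e = 1"
  shows "(\<Sum>j<n. e j * across \<rho> e j x) = 0"
proof -
  have "(\<Sum>j<n. e j * across \<rho> e j x) = along \<rho> e x - ip e e * along \<rho> e x"
    by (simp add: across_def ip_def along_def right_diff_distrib sum_subtractf sum_distrib_right mult_ac)
  then show ?thesis using assms by simp
qed

lemma ce_decomp: "ce \<rho> j x = across \<rho> e j x + e j * along \<rho> e x"
  by (simp add: across_def)

lemma centered_nsq:
  assumes "ip e e = 1"
  shows "(\<Sum>j<n. (ce \<rho> j x)\<^sup>2) = (along \<rho> e x)\<^sup>2 + wid \<rho> e x"
proof -
  have "(\<Sum>j<n. (ce \<rho> j x)\<^sup>2) = (\<Sum>j<n. (across \<rho> e j x)\<^sup>2 + 2 * along \<rho> e x * (e j * across \<rho> e j x) + (along \<rho> e x)\<^sup>2 * (e j * e j))"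
    by (intro sum.cong) (auto simp: ce_decomp[of \<rho> _ x e] power2_eq_square algebra_simps)
  also have "\<dots> = wid \<rho> e x + 2 * along \<rho> e x * (\<Sum>j<n. e j * across \<rho> e j x) + (along \<rho> e x)\<^sup>2 * ip e e"
    by (simp add: sum.distrib sum_distrib_left wid_def ip_def)
  finally show ?thesis using assms by (simp add: across_orth)
qed

lemma nsq_expand:
  "nsq x = (\<Sum>j<n. (mn \<rho> j)\<^sup>2) + 2 * (\<Sum>j<n. mn \<rho> j * ce \<rho> j x) + (\<Sum>j<n. (ce \<rho> j x)\<^sup>2)"
proof -
  have "nsq x = (\<Sum>j<n. (mn \<rho> j)\<^sup>2 + 2 * (mn \<rho> j * ce \<rho> j x) + (ce \<rho> j x)\<^sup>2)"
    unfolding nsq_def by (intro sum.cong) (auto simp: ce_def power2_eq_square algebra_simps)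
  then show ?thesis by (simp add: sum.distrib sum_distrib_left)
qed

lemma ex_nsq:
  assumes "dens \<rho>"
  shows "ex \<rho> nsq = (\<Sum>j<n. (mn \<rho> j)\<^sup>2) + (\<Sum>j<n. var \<rho> (\<lambda>x. x j))"
proof -
  have "ex \<rho> nsq = ex \<rho> (\<lambda>x. (\<Sum>j<n. (mn \<rho> j)\<^sup>2) + 2 * (\<Sum>j<n. mn \<rho> j * ce \<rho> j x) + (\<Sum>j<n. (ce \<rho> j x)\<^sup>2))"
    by (intro ex_cong[OF assms] nsq_expand)
  then show ?thesis using assms by (simp add: ex_linear var_coord)
qed

lemma wid_le:
  assumes "dens \<rho>" "ip e e = 1" "x \<in> cube"
  shows "wid \<rho> e x \<le> 4 * real n * R\<^sup>2"
proof -
  have "wid \<rho> e x \<le> (\<Sum>j<n. (ce \<rho> j x)\<^sup>2)" using centered_nsq[OF assms(2)] by simp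
  also have "\<dots> \<le> (\<Sum>j<n. (2 * R)\<^sup>2)"
  proof (rule sum_mono)
    fix j assume "j \<in> {..<n}"
    then have "\<bar>ce \<rho> j x\<bar>\<^sup>2 \<le> (2 * R)\<^sup>2" using abs_ce_le[OF assms(1) _ assms(3)] by (intro power_mono) auto
    then show "(ce \<rho> j x)\<^sup>2 \<le> (2 * R)\<^sup>2" by simp
  qed
  finally show ?thesis by (simp add: power_mult_distrib)
qed

text \<open>\<open>wid\<close> is bounded on the cube, so the defect controls its square too. The
  factor may depend on \<open>n\<close> and \<open>R\<close>, since the needle principle accepts any
  multiple of the defect.\<close>

lemma ex_wid_sq_le:
  assumes "dens \<rho>" "ip e e = 1"
  shows "ex \<rho> (\<lambda>x. (wid \<rho> e x)\<^sup>2) \<le> 4 * real n * R\<^sup>2 * defect \<rho> e"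
proof -
  have "ex \<rho> (\<lambda>x. (wid \<rho> e x)\<^sup>2) \<le> ex \<rho> (\<lambda>x. 4 * real n * R\<^sup>2 * wid \<rho> e x)"
    using wid_le[OF assms] wid_nonneg
    by (intro ex_mono[OF assms(1)]) (auto simp: power2_eq_square intro: mult_right_mono)
  then show ?thesis by (simp add: ex_cmult defect_wid)
qed

lemma along_ip: "along \<rho> e x = ip e x - ip e (mn \<rho>)"
  by (simp add: along_def ip_def ce_def right_diff_distrib sum_subtractf)

lemma var_ip: "dens \<rho> \<Longrightarrow> var \<rho> (ip u) = ex \<rho> (\<lambda>x. (along \<rho> u x)\<^sup>2)"
proof -
  assume \<rho>: "dens \<rho>"
  have "ex \<rho> (ip u) = ip u (mn \<rho>)" unfolding ip_def using \<rho> by (simp add: ex_linear)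
  then show ?thesis by (simp add: var_def along_ip)
qed

lemma strong_variance':
  assumes w: "weight \<kappa> \<rho>" and k: "0 < k" "\<And>i. i < n \<Longrightarrow> k \<le> \<kappa> i"
  shows "ex \<rho> (\<lambda>x. (along \<rho> u x)\<^sup>2) \<le> 2 * ip u u / k"
proof (cases "ip u u = 0")
  case True
  have "u j = 0" if "j < n" for j
  proof -
    have "u j * u j \<le> ip u u" unfolding ip_def using that by (intro member_le_sum) auto
    then show ?thesis using True by (metis mult_le_0_iff order_antisym_conv zero_le_square mult_eq_0_iff)
  qed
  then have "along \<rho> u x = 0" for x by (auto simp: along_def intro!: sum.neutral)
  then show ?thesis using True weight_dens[OF w] by (simp add: ex_const)
next
  case False
  moreover have "0 \<le> ip u u" unfolding ip_def by (intro sum_nonneg) auto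
  ultimately show ?thesis using strong_variance[OF w k order_refl, of u] weight_dens[OF w] by (simp add: var_ip)
qed

lemma along_sq_le:
  assumes \<rho>: "dens \<rho>" and e: "ip e e = 1"
  shows "ex \<rho> (\<lambda>x. (along \<rho> e x)\<^sup>2) \<le> ex \<rho> (\<lambda>x. \<Sum>j<n. (ce \<rho> j x)\<^sup>2)"
  using wid_nonneg centered_nsq[OF e] by (intro ex_mono[OF \<rho>]) auto

text \<open>The estimate that a Poincare inequality with constant of order \<open>1 / k\<close>
  would give. Keeping the mean of \<open>nsq\<close> fixed, it suffices to treat needles. There the
  deviation of \<open>nsq\<close> splits into a linear part, of variance at most
  \<open>8 * A / k\<close> with \<open>A\<close> the squared length of the mean, and the square of
  the needle coordinate, of second moment at most \<open>mom 4 * (2 / k) * T\<close> with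
  \<open>T\<close> the trace; and \<open>A + T\<close> is the mean of \<open>nsq\<close>.\<close>

lemma strong_norm_variance:
  assumes w0: "weight \<kappa> \<rho>0" and k: "0 < k" "\<And>i. i < n \<Longrightarrow> k \<le> \<kappa> i"
  shows "var \<rho>0 nsq \<le> (16 + 8 * mom 4) / k * ex \<rho>0 nsq"
proof -
  have \<rho>0: "dens \<rho>0" using w0 by (rule weight_dens)
  define n0 where "n0 = ex \<rho>0 nsq"
  define K where "K = (16 + 8 * mom 4) / k"
  have "ex \<rho>0 (\<lambda>x. (nsq x - n0)\<^sup>2 - K * nsq x) \<le> 0"
  proof (rule needle_principle[OF w0, where f="\<lambda>x. nsq x - n0" and C="16 * real n * R\<^sup>2"])
    show "ex \<rho>0 (\<lambda>x. nsq x - n0) = 0" using \<rho>0 by (simp add: ex_linear n0_def)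
    fix \<rho> e
    assume w: "weight \<kappa> \<rho>" and f: "ex \<rho> (\<lambda>x. nsq x - n0) = 0" and e: "ip e e = 1"
    have \<rho>: "dens \<rho>" using w by (rule weight_dens)
    have n0: "ex \<rho> nsq = n0" using f \<rho> by (simp add: ex_linear)
    define A where "A = (\<Sum>j<n. (mn \<rho> j)\<^sup>2)"
    define T where "T = ex \<rho> (\<lambda>x. \<Sum>j<n. (ce \<rho> j x)\<^sup>2)"
    have AT: "n0 = A + T" using ex_nsq[OF \<rho>] n0 \<rho> by (simp add: A_def T_def ex_sum var_coord)
    have "ex \<rho> (\<lambda>x. (nsq x - n0)\<^sup>2) = var \<rho> nsq" by (simp add: var_def n0)
    also have "\<dots> \<le> ex \<rho> (\<lambda>x. (nsq x - A)\<^sup>2)" using \<rho> by (intro var_le) auto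
    also have "\<dots> \<le> ex \<rho> (\<lambda>x. 8 * (along \<rho> (mn \<rho>) x)\<^sup>2 + 4 * along \<rho> e x ^ 4 + 4 * (wid \<rho> e x)\<^sup>2)"
    proof (rule ex_mono[OF \<rho>])
      fix x
      have "nsq x - A = 2 * along \<rho> (mn \<rho>) x + ((along \<rho> e x)\<^sup>2 + wid \<rho> e x)"
        unfolding nsq_expand[of x \<rho>] A_def centered_nsq[OF e] along_def by simp
      then have "(nsq x - A)\<^sup>2 \<le> 2 * (2 * along \<rho> (mn \<rho>) x)\<^sup>2 + 2 * ((along \<rho> e x)\<^sup>2 + wid \<rho> e x)\<^sup>2"
        using square_sum_le[of "2 * along \<rho> (mn \<rho>) x" "(along \<rho> e x)\<^sup>2 + wid \<rho> e x"] by simp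
      also have "\<dots> \<le> 2 * (2 * along \<rho> (mn \<rho>) x)\<^sup>2 + 2 * (2 * ((along \<rho> e x)\<^sup>2)\<^sup>2 + 2 * (wid \<rho> e x)\<^sup>2)"
        using square_sum_le[of "(along \<rho> e x)\<^sup>2" "wid \<rho> e x"] by (intro add_left_mono mult_left_mono) auto
      finally show "(nsq x - A)\<^sup>2 \<le> 8 * (along \<rho> (mn \<rho>) x)\<^sup>2 + 4 * along \<rho> e x ^ 4 + 4 * (wid \<rho> e x)\<^sup>2"
        by (simp add: power_mult_distrib)
    qed auto
    also have "\<dots> = 8 * ex \<rho> (\<lambda>x. (along \<rho> (mn \<rho>) x)\<^sup>2) + 4 * ex \<rho> (\<lambda>x. along \<rho> e x ^ 4) + 4 * ex \<rho> (\<lambda>x. (wid \<rho> e x)\<^sup>2)"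
      using \<rho> by (simp add: ex_add ex_cmult)
    finally have 1: "ex \<rho> (\<lambda>x. (nsq x - n0)\<^sup>2) \<le> 8 * ex \<rho> (\<lambda>x. (along \<rho> (mn \<rho>) x)\<^sup>2) + 4 * ex \<rho> (\<lambda>x. along \<rho> e x ^ 4) + 4 * ex \<rho> (\<lambda>x. (wid \<rho> e x)\<^sup>2)" .
    have 2: "ex \<rho> (\<lambda>x. (along \<rho> (mn \<rho>) x)\<^sup>2) \<le> 2 * A / k"
      using strong_variance'[OF w k, of "mn \<rho>"] by (simp add: A_def ip_def power2_eq_square)
    have s: "ex \<rho> (\<lambda>x. (along \<rho> e x)\<^sup>2) \<le> 2 / k" using strong_variance'[OF w k, of e] e by simp
    have s0: "0 \<le> ex \<rho> (\<lambda>x. (along \<rho> e x)\<^sup>2)" using \<rho> by (intro ex_nonneg) auto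
    have "(ex \<rho> (\<lambda>x. (along \<rho> e x)\<^sup>2))\<^sup>2 \<le> 2 / k * T"
      unfolding power2_eq_square[of "ex \<rho> _"] using s s0 k along_sq_le[OF \<rho> e] unfolding T_def by (intro mult_mono) auto
    then have "mom 4 * (ex \<rho> (\<lambda>x. (along \<rho> e x)\<^sup>2))\<^sup>2 \<le> mom 4 * (2 / k * T)"
      using mom_pos[of 4] by (intro mult_left_mono) auto
    then have 3: "ex \<rho> (\<lambda>x. along \<rho> e x ^ 4) \<le> mom 4 * (2 / k * T)"
      using fourth_moment[OF w affine_along[of \<rho> e]] by linarith
    have 4: "ex \<rho> (\<lambda>x. (wid \<rho> e x)\<^sup>2) \<le> 4 * real n * R\<^sup>2 * defect \<rho> e" using \<rho> e by (rule ex_wid_sq_le)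
    have T0: "0 \<le> T" unfolding T_def using \<rho> by (intro ex_nonneg) (auto intro: sum_nonneg)
    have A0: "0 \<le> A" unfolding A_def by (intro sum_nonneg) auto
    have "8 * (2 * A / k) + 4 * (mom 4 * (2 / k * T)) \<le> K * (A + T)"
    proof -
      have "K * (A + T) = 16 * A / k + 8 * mom 4 * T / k + (16 * T / k + 8 * mom 4 * A / k)"
        using k by (simp add: K_def field_simps)
      moreover have "0 \<le> 16 * T / k + 8 * mom 4 * A / k" using T0 A0 k mom_pos[of 4] by simp
      ultimately show ?thesis by (simp add: mult_ac)
    qed
    moreover have "ex \<rho> (\<lambda>x. (nsq x - n0)\<^sup>2 - K * nsq x) = ex \<rho> (\<lambda>x. (nsq x - n0)\<^sup>2) - K * (A + T)"
      using \<rho> by (simp add: ex_diff ex_cmult flip: AT n0)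
    ultimately show "ex \<rho> (\<lambda>x. (nsq x - n0)\<^sup>2 - K * nsq x) \<le> 16 * real n * R\<^sup>2 * defect \<rho> e"
      using 1 2 3 4 by linarith
  qed auto
  then show ?thesis using \<rho>0 by (simp add: ex_linear var_def n0_def K_def)
qed

text \<open>Along a needle \<open>nsq\<close> is a quadratic polynomial, up to an error
  \<open>c\<close> from the transversal directions that is paid by the defect. Completing the square
  leaves the square of an affine function, to which \<open>quadratic_variance\<close>
  applies.\<close>

lemma needle_width:
  assumes w: "weight \<kappa> \<rho>" and e: "ip e e = 1"
  shows "(ex \<rho> (\<lambda>x. (along \<rho> e x)\<^sup>2))\<^sup>2 \<le> 8388608 * (2 * var \<rho> nsq + 32 * real n * R\<^sup>2 * defect \<rho> e)"
proof -
  have \<rho>: "dens \<rho>" using w by (rule weight_dens)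
  define b where "b = ip e (mn \<rho>)"
  define A where "A = (\<Sum>j<n. (mn \<rho> j)\<^sup>2)"
  define c where "c x = 2 * (\<Sum>j<n. mn \<rho> j * across \<rho> e j x) + wid \<rho> e x" for x
  have bc [simp, intro]: "bfun (\<lambda>x. c x)" unfolding c_def by auto
  have eq: "nsq x = (along \<rho> e x + b)\<^sup>2 + (A - b\<^sup>2) + c x" for x
  proof -
    have "(\<Sum>j<n. mn \<rho> j * ce \<rho> j x) = (\<Sum>j<n. mn \<rho> j * across \<rho> e j x) + b * along \<rho> e x"
      by (simp add: ce_decomp[of \<rho> _ x e] b_def ip_def distrib_left sum.distrib sum_distrib_right sum_distrib_left mult_ac)
    then show ?thesis
      unfolding nsq_expand[of x \<rho>] centered_nsq[OF e] by (simp add: A_def c_def power2_eq_square algebra_simps)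
  qed
  have A_le: "A \<le> real n * R\<^sup>2"
  proof -
    have "(mn \<rho> j)\<^sup>2 \<le> R\<^sup>2" if "j < n" for j
      using power_mono[OF abs_mn_le[OF \<rho> that], of 2] by simp
    then have "A \<le> (\<Sum>j<n. R\<^sup>2)" unfolding A_def by (intro sum_mono) auto
    then show ?thesis by simp
  qed
  have "ex \<rho> (\<lambda>x. (c x)\<^sup>2) \<le> ex \<rho> (\<lambda>x. 8 * (A * wid \<rho> e x) + 2 * (wid \<rho> e x)\<^sup>2)"
  proof (rule ex_mono[OF \<rho>])
    fix x
    have "(c x)\<^sup>2 \<le> 2 * (2 * (\<Sum>j<n. mn \<rho> j * across \<rho> e j x))\<^sup>2 + 2 * (wid \<rho> e x)\<^sup>2"
      unfolding c_def by (rule square_sum_le)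
    moreover have "(\<Sum>j<n. mn \<rho> j * across \<rho> e j x)\<^sup>2 \<le> A * wid \<rho> e x"
      unfolding A_def wid_def by (rule Cauchy_Schwarz_ineq_sum)
    ultimately show "(c x)\<^sup>2 \<le> 8 * (A * wid \<rho> e x) + 2 * (wid \<rho> e x)\<^sup>2" by (simp add: power_mult_distrib)
  qed auto
  also have "\<dots> = 8 * (A * defect \<rho> e) + 2 * ex \<rho> (\<lambda>x. (wid \<rho> e x)\<^sup>2)"
    using \<rho> by (simp add: ex_add ex_cmult defect_wid)
  also have "\<dots> \<le> 8 * (real n * R\<^sup>2 * defect \<rho> e) + 2 * (4 * real n * R\<^sup>2 * defect \<rho> e)"
    using ex_wid_sq_le[OF \<rho> e] mult_right_mono[OF A_le defect_nonneg[OF \<rho>, of e]] by linarith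
  finally have c2: "ex \<rho> (\<lambda>x. (c x)\<^sup>2) \<le> 16 * real n * R\<^sup>2 * defect \<rho> e" by (simp add: mult_ac)
  define m where "m = ex \<rho> nsq"
  have "var \<rho> (\<lambda>x. (along \<rho> e x + b)\<^sup>2) \<le> ex \<rho> (\<lambda>x. ((along \<rho> e x + b)\<^sup>2 - (m - (A - b\<^sup>2)))\<^sup>2)"
    using \<rho> by (intro var_le) auto
  also have "\<dots> \<le> ex \<rho> (\<lambda>x. 2 * (nsq x - m)\<^sup>2 + 2 * (c x)\<^sup>2)"
  proof (rule ex_mono[OF \<rho>])
    fix x
    have E: "(along \<rho> e x + b)\<^sup>2 - (m - (A - b\<^sup>2)) = (nsq x - m) + (- c x)" using eq[of x] by simp
    show "((along \<rho> e x + b)\<^sup>2 - (m - (A - b\<^sup>2)))\<^sup>2 \<le> 2 * (nsq x - m)\<^sup>2 + 2 * (c x)\<^sup>2"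
      unfolding E using square_sum_le[of "nsq x - m" "- c x"] by simp
  qed auto
  also have "\<dots> = 2 * var \<rho> nsq + 2 * ex \<rho> (\<lambda>x. (c x)\<^sup>2)"
    using \<rho> by (simp add: ex_add ex_cmult var_def m_def)
  finally have v: "var \<rho> (\<lambda>x. (along \<rho> e x + b)\<^sup>2) \<le> 2 * var \<rho> nsq + 32 * real n * R\<^sup>2 * defect \<rho> e"
    using c2 by simp
  have "(var \<rho> (\<lambda>x. along \<rho> e x + b))\<^sup>2 \<le> 8388608 * var \<rho> (\<lambda>x. (along \<rho> e x + b)\<^sup>2)"
    by (rule quadratic_variance[OF w]) auto
  moreover have "var \<rho> (\<lambda>x. along \<rho> e x + b) = ex \<rho> (\<lambda>x. (along \<rho> e x)\<^sup>2)"
    using \<rho> by (simp add: var_def ex_linear)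
  ultimately show ?thesis using v by simp
qed

text \<open>Points within \<open>r / 4\<close> of the axis and at distance at least \<open>r\<close>
  from each other differ by at least \<open>r / 2\<close> along it, four cells of width
  \<open>r / 8\<close>. Markov's inequality bounds the mass away from the axis by the defect, and
  \<open>a = s + r / 8\<close> is at least the width of a cell.\<close>

lemma needle_isoperimetry:
  assumes w: "weight \<kappa> \<rho>" and e: "ip e e = 1" and r: "0 < r"
    and b: "bfun (\<lambda>x. of_bool (S x))" "bfun (\<lambda>x. of_bool (B x))"
    and sep: "\<And>x y. x \<in> cube \<Longrightarrow> y \<in> cube \<Longrightarrow> S x \<Longrightarrow> B y \<Longrightarrow> r \<le> eucl_dist n x y"
    and s: "0 \<le> s" "ex \<rho> (\<lambda>x. (along \<rho> e x)\<^sup>2) \<le> s\<^sup>2"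
  shows "min (pr \<rho> S) (pr \<rho> B) \<le>
    (20 + 160 * s / r) * ex \<rho> (\<lambda>x. of_bool (\<not> S x) * of_bool (\<not> B x)) + (21 + 160 * s / r) * (16 / r\<^sup>2 * defect \<rho> e)"
proof -
  have \<rho>: "dens \<rho>" using w by (rule weight_dens)
  define Q where "Q x \<longleftrightarrow> wid \<rho> e x < (r / 4)\<^sup>2" for x
  have bQ: "bfun (\<lambda>x. of_bool (Q x))" unfolding Q_def by auto
  let ?g = "ex \<rho> (\<lambda>x. of_bool (\<not> S x) * of_bool (\<not> B x))" and ?q = "pr \<rho> (\<lambda>x. \<not> Q x)"
  define a where "a = s + r / 8"
  have "min (pr \<rho> S) (pr \<rho> B) \<le> 20 * a / (r / 8) * (?g + ?q) + ?q"
  proof (rule line_isoperimetry[OF w affine_along[of \<rho> e]])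
    have "s\<^sup>2 \<le> a\<^sup>2" using s r unfolding a_def by (intro power_mono) auto
    with s show "ex \<rho> (\<lambda>x. (along \<rho> e x)\<^sup>2) \<le> a\<^sup>2" by linarith
    show "0 < r / 8" "r / 8 \<le> a" using r s by (auto simp: a_def)
    fix x y assume xy: "x \<in> cube" "y \<in> cube" "S x" "Q x" "B y" "Q y"
    let ?d = "along \<rho> e x - along \<rho> e y"
    have "r \<le> L2_set (\<lambda>i. x i - y i) {..<n}" using sep[OF xy(1,2,3,5)] by (simp add: eucl_dist_def)
    also have "(\<lambda>i. x i - y i) = (\<lambda>i. e i * ?d + (across \<rho> e i x + - across \<rho> e i y))"
      by (rule ext) (simp add: across_def ce_def algebra_simps)
    also have "L2_set \<dots> {..<n} \<le> L2_set (\<lambda>i. e i * ?d) {..<n} + L2_set (\<lambda>i. across \<rho> e i x + - across \<rho> e i y) {..<n}"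
      by (rule L2_set_triangle_ineq)
    also have "L2_set (\<lambda>i. across \<rho> e i x + - across \<rho> e i y) {..<n} \<le> L2_set (\<lambda>i. across \<rho> e i x) {..<n} + L2_set (\<lambda>i. - across \<rho> e i y) {..<n}"
      by (rule L2_set_triangle_ineq)
    also have "L2_set (\<lambda>i. e i * ?d) {..<n} = \<bar>?d\<bar>"
    proof -
      have "(\<Sum>i<n. (e i * ?d)\<^sup>2) = ip e e * ?d\<^sup>2"
        by (simp add: ip_def power_mult_distrib sum_distrib_right power2_eq_square[of "e _"])
      then show ?thesis using e by (simp add: L2_set_def)
    qed
    also have "L2_set (\<lambda>i. - across \<rho> e i y) {..<n} = L2_set (\<lambda>i. across \<rho> e i y) {..<n}"
      by (simp add: L2_set_def)
    finally have d: "r \<le> \<bar>?d\<bar> + (L2_set (\<lambda>i. across \<rho> e i x) {..<n} + L2_set (\<lambda>i. across \<rho> e i y) {..<n})" by simp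
    have "L2_set (\<lambda>i. across \<rho> e i z) {..<n} \<le> r / 4" if "Q z" for z
      using that r unfolding Q_def wid_def L2_set_def by (intro real_le_lsqrt) (auto intro: sum_nonneg)
    from this[OF xy(4)] this[OF xy(6)] d show "4 * (r / 8) \<le> \<bar>?d\<bar>" by linarith
  qed (use b bQ in auto)
  moreover have "20 * a / (r / 8) = 20 + 160 * s / r" using r by (simp add: a_def field_simps)
  moreover have "(20 + X) * (?g + ?q) + ?q = (20 + X) * ?g + (21 + X) * ?q" for X
    by (simp add: algebra_simps)
  ultimately have 1: "min (pr \<rho> S) (pr \<rho> B) \<le> (20 + 160 * s / r) * ?g + (21 + 160 * s / r) * ?q"
    by (simp only:)
  have "?q \<le> ex \<rho> (\<lambda>x. 16 / r\<^sup>2 * wid \<rho> e x)"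
  proof (rule ex_mono[OF \<rho>])
    fix x
    show "of_bool (\<not> Q x) \<le> 16 / r\<^sup>2 * wid \<rho> e x"
      using r wid_nonneg[of \<rho> e x] by (auto simp: Q_def field_simps power_divide)
  qed (use bQ in \<open>auto simp: of_bool_not_iff\<close>)
  also have "\<dots> = 16 / r\<^sup>2 * defect \<rho> e" by (simp only: ex_cmult defect_wid)
  finally have "(21 + 160 * s / r) * ?q \<le> (21 + 160 * s / r) * (16 / r\<^sup>2 * defect \<rho> e)"
    using s r by (intro mult_left_mono) auto
  with 1 show ?thesis by linarith
qed

text \<open>In a needle either the standard deviation is at most \<open>\<sigma>\<close>, and the one-dimensional inequality
  applies, or \<open>1\<close> is at most a multiple of the needle's share of the variance of \<open>nsq\<close>, divided by \<open>\<sigma> ^ 4\<close>.\<close>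

theorem three_sets:
  assumes w0: "weight \<kappa> \<rho>0" and r: "0 < r"
    and b: "bfun (\<lambda>x. of_bool (S x))" "bfun (\<lambda>x. of_bool (B x))"
    and sep: "\<And>x y. x \<in> cube \<Longrightarrow> y \<in> cube \<Longrightarrow> S x \<Longrightarrow> B y \<Longrightarrow> r \<le> eucl_dist n x y"
    and \<sigma>: "0 < \<sigma>" "33554432 * var \<rho>0 nsq \<le> \<sigma> ^ 4"
  shows "min (pr \<rho>0 S) (pr \<rho>0 B) / 2 \<le> (21 + 160 * \<sigma> / r) * ex \<rho>0 (\<lambda>x. of_bool (\<not> S x) * of_bool (\<not> B x))"
proof -
  have \<rho>0: "dens \<rho>0" using w0 by (rule weight_dens)
  define \<alpha> \<beta> where "\<alpha> = pr \<rho>0 S" and "\<beta> = pr \<rho>0 B"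
  define p where "p = min \<alpha> \<beta>"
  define n0 where "n0 = ex \<rho>0 nsq"
  define K where "K = 21 + 160 * \<sigma> / r"
  \<comment> \<open>On a wide needle \<open>\<sigma> ^ 4\<close> is at most \<open>16777216\<close>
    times the spread of \<open>nsq\<close> about the original mean \<open>n0\<close>, up to the
    defect. Measured about \<open>n0\<close>, these spreads average to the original variance, and
    the bound on that variance keeps their total cost below or at \<open>p / 2\<close>.\<close>
  define c where "c = p * 16777216 / \<sigma> ^ 4"
  have K: "0 \<le> K" using \<sigma> r by (simp add: K_def)
  have nb: "bfun (\<lambda>x. of_bool (\<not> S x))" "bfun (\<lambda>x. of_bool (\<not> B x))"
    using b by (simp_all add: of_bool_not_iff)
  have disj: "\<not> (S x \<and> B x)" if "x \<in> cube" for x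
    using sep[OF that that] r by (auto simp: eucl_dist_def L2_set_def)
  have one: "pr \<rho> S + pr \<rho> B = 1 - ex \<rho> (\<lambda>x. of_bool (\<not> S x) * of_bool (\<not> B x))" if \<rho>: "dens \<rho>" for \<rho>
  proof -
    have "pr \<rho> S + pr \<rho> B + ex \<rho> (\<lambda>x. of_bool (\<not> S x) * of_bool (\<not> B x))
      = ex \<rho> (\<lambda>x. of_bool (S x) + of_bool (B x) + of_bool (\<not> S x) * of_bool (\<not> B x))"
      by (simp only: ex_add[OF \<rho>] bfun_add bfun_mult b nb)
    also have "\<dots> = ex \<rho> (\<lambda>x. 1)"
    proof (rule ex_cong[OF \<rho>])
      fix x assume "x \<in> cube"
      then show "of_bool (S x) + of_bool (B x) + of_bool (\<not> S x) * of_bool (\<not> B x) = (1::real)"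
        using disj[of x] by (cases "S x"; cases "B x") auto
    qed
    finally show ?thesis using \<rho> by (simp add: ex_const)
  qed
  have g01: "0 \<le> ex \<rho> (\<lambda>x. of_bool (\<not> S x) * of_bool (\<not> B x))" if "dens \<rho>" for \<rho>
    using nb that by (intro ex_nonneg) auto
  have \<alpha>\<beta>: "0 \<le> \<alpha>" "0 \<le> \<beta>" "\<alpha> + \<beta> \<le> 1"
    using one[OF \<rho>0] g01[OF \<rho>0] pr_nonneg[OF \<rho>0 b(1)] pr_nonneg[OF \<rho>0 b(2)] by (auto simp: \<alpha>_def \<beta>_def)
  then have p: "0 \<le> p" "p \<le> 1" by (auto simp: p_def)
  define C where "C = K * (16 / r\<^sup>2) + c * (16 * real n * R\<^sup>2)"
  have c0: "0 \<le> c" using p \<sigma> by (simp add: c_def)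
  have "ex \<rho>0 (\<lambda>x. p - K * (of_bool (\<not> S x) * of_bool (\<not> B x)) - c * (nsq x - n0)\<^sup>2) \<le> 0"
  \<comment> \<open>The constraint keeps the masses of \<open>S\<close> and \<open>B\<close> in the
    proportion of \<open>\<alpha>\<close> to \<open>\<beta>\<close>. Hence on each needle both sets
    have at least the share \<open>p\<close> of the mass outside the gap.\<close>
  proof (rule needle_principle[OF w0, where f="\<lambda>x. \<beta> * of_bool (S x) - \<alpha> * of_bool (B x)" and C=C])
    show "bfun (\<lambda>x. \<beta> * of_bool (S x) - \<alpha> * of_bool (B x))" using b by (intro bfun_diff bfun_mult bfun_const)
    show "ex \<rho>0 (\<lambda>x. \<beta> * of_bool (S x) - \<alpha> * of_bool (B x)) = 0"
      using \<rho>0 b by (subst ex_diff) (auto simp: ex_cmult \<alpha>_def \<beta>_def)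
    show "bfun (\<lambda>x. p - K * (of_bool (\<not> S x) * of_bool (\<not> B x)) - c * (nsq x - n0)\<^sup>2)"
      using nb by (intro bfun_diff bfun_mult bfun_const bfun_power bfun_nsq)
    fix \<rho> e
    assume w: "weight \<kappa> \<rho>" and f: "ex \<rho> (\<lambda>x. \<beta> * of_bool (S x) - \<alpha> * of_bool (B x)) = 0" and e: "ip e e = 1"
    have \<rho>: "dens \<rho>" using w by (rule weight_dens)
    let ?g = "ex \<rho> (\<lambda>x. of_bool (\<not> S x) * of_bool (\<not> B x))" and ?d = "defect \<rho> e"
    let ?s = "pr \<rho> S" and ?b = "pr \<rho> B" and ?V = "ex \<rho> (\<lambda>x. (nsq x - n0)\<^sup>2)"
    have d0: "0 \<le> ?d" using \<rho> by (rule defect_nonneg)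
    have V0: "0 \<le> ?V" using \<rho> by (intro ex_nonneg) auto
    have sb: "\<beta> * ?s = \<alpha> * ?b"
    proof -
      have "ex \<rho> (\<lambda>x. \<beta> * of_bool (S x) - \<alpha> * of_bool (B x)) = \<beta> * ?s - \<alpha> * ?b"
        using \<rho> b by (subst ex_diff) (auto simp: ex_cmult)
      then show ?thesis using f by simp
    qed
    have s0: "0 \<le> ?s" "0 \<le> ?b" using pr_nonneg[OF \<rho> b(1)] pr_nonneg[OF \<rho> b(2)] by auto
    have g1: "?s + ?b = 1 - ?g" using one[OF \<rho>] .
    have gle: "0 \<le> 1 - ?g" using g1 s0 by linarith
    have "p * (1 - ?g) \<le> ?s"
    proof -
      have "p * (1 - ?g) \<le> \<alpha> * (1 - ?g)" using gle by (intro mult_right_mono) (auto simp: p_def)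
      also have "\<dots> = ?s * (\<alpha> + \<beta>)" using sb unfolding g1[symmetric] by (simp add: algebra_simps)
      also have "\<dots> \<le> ?s * 1" using s0 \<alpha>\<beta> by (intro mult_left_mono) auto
      finally show ?thesis by simp
    qed
    moreover have "p * (1 - ?g) \<le> ?b"
    proof -
      have "p * (1 - ?g) \<le> \<beta> * (1 - ?g)" using gle by (intro mult_right_mono) (auto simp: p_def)
      also have "\<dots> = ?b * (\<alpha> + \<beta>)" using sb unfolding g1[symmetric] by (simp add: algebra_simps)
      also have "\<dots> \<le> ?b * 1" using s0 \<alpha>\<beta> by (intro mult_left_mono) auto
      finally show ?thesis by simp
    qed
    ultimately have min: "p * (1 - ?g) \<le> min ?s ?b" by simp
    let ?v = "ex \<rho> (\<lambda>x. (along \<rho> e x)\<^sup>2)"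
    have g0: "0 \<le> ?g" using g01[OF \<rho>] .
    have main: "p \<le> K * ?g + K * (16 / r\<^sup>2 * ?d) + c * (?V + 16 * real n * R\<^sup>2 * ?d)"
    proof (cases "?v \<le> \<sigma>\<^sup>2")
      case True
      have "min ?s ?b \<le> (20 + 160 * \<sigma> / r) * ?g + K * (16 / r\<^sup>2 * ?d)"
        unfolding K_def using needle_isoperimetry[OF w e r b sep less_imp_le[OF \<sigma>(1)] True] .
      moreover have "p * ?g \<le> 1 * ?g" using p g0 by (intro mult_right_mono)
      moreover have "0 \<le> c * (?V + 16 * real n * R\<^sup>2 * ?d)" using c0 V0 d0 by simp
      moreover have "(20 + 160 * \<sigma> / r) * ?g + 1 * ?g = K * ?g" by (simp add: K_def algebra_simps)
      moreover have "p * (1 - ?g) = p - p * ?g" by (simp add: right_diff_distrib)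
      ultimately show ?thesis using min by linarith
    next
      case False
      have "\<sigma> ^ 4 = (\<sigma>\<^sup>2)\<^sup>2" by simp
      also have "\<dots> \<le> ?v\<^sup>2" using False by (intro power_mono) auto
      also have "\<dots> \<le> 8388608 * (2 * var \<rho> nsq + 32 * real n * R\<^sup>2 * ?d)" by (rule needle_width[OF w e])
      also have "\<dots> \<le> 8388608 * (2 * ?V + 32 * real n * R\<^sup>2 * ?d)"
        using var_le[OF \<rho>, of nsq n0] by simp
      finally have "\<sigma> ^ 4 \<le> 16777216 * (?V + 16 * real n * R\<^sup>2 * ?d)" by simp
      then have "p / \<sigma> ^ 4 * \<sigma> ^ 4 \<le> p / \<sigma> ^ 4 * (16777216 * (?V + 16 * real n * R\<^sup>2 * ?d))"
        using p \<sigma> by (intro mult_left_mono) auto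
      moreover have "p / \<sigma> ^ 4 * \<sigma> ^ 4 = p" using \<sigma> by simp
      moreover have "p / \<sigma> ^ 4 * (16777216 * W) = c * W" for W by (simp add: c_def)
      ultimately have "p \<le> c * (?V + 16 * real n * R\<^sup>2 * ?d)" by (simp only:)
      moreover have "0 \<le> K * ?g + K * (16 / r\<^sup>2 * ?d)" using K g0 d0 by simp
      ultimately show ?thesis by linarith
    qed
    have "ex \<rho> (\<lambda>x. p - K * (of_bool (\<not> S x) * of_bool (\<not> B x)) - c * (nsq x - n0)\<^sup>2) = p - K * ?g - c * ?V"
      using \<rho> nb by (simp only: ex_diff[OF \<rho>] ex_cmult ex_const[OF \<rho>] bfun_diff bfun_mult bfun_const bfun_power bfun_nsq)
    then show "ex \<rho> (\<lambda>x. p - K * (of_bool (\<not> S x) * of_bool (\<not> B x)) - c * (nsq x - n0)\<^sup>2) \<le> C * ?d"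
      using main by (simp add: C_def algebra_simps)
  qed
  also have "ex \<rho>0 (\<lambda>x. p - K * (of_bool (\<not> S x) * of_bool (\<not> B x)) - c * (nsq x - n0)\<^sup>2)
      = p - K * ex \<rho>0 (\<lambda>x. of_bool (\<not> S x) * of_bool (\<not> B x)) - c * var \<rho>0 nsq"
    using nb by (simp only: ex_diff[OF \<rho>0] ex_cmult ex_const[OF \<rho>0] bfun_diff bfun_mult bfun_const bfun_power bfun_nsq var_def n0_def)
  finally have "p \<le> K * ex \<rho>0 (\<lambda>x. of_bool (\<not> S x) * of_bool (\<not> B x)) + c * var \<rho>0 nsq" by simp
  moreover have "c * var \<rho>0 nsq \<le> p / 2"
  proof -
    have "c * var \<rho>0 nsq = p / 2 * (33554432 * var \<rho>0 nsq / \<sigma> ^ 4)" by (simp add: c_def)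
    also have "\<dots> \<le> p / 2 * 1" using p \<sigma> by (intro mult_left_mono) auto
    finally show ?thesis by simp
  qed
  ultimately have "p / 2 \<le> K * ex \<rho>0 (\<lambda>x. of_bool (\<not> S x) * of_bool (\<not> B x))" by linarith
  then show ?thesis unfolding p_def \<alpha>_def \<beta>_def K_def .
qed

section \<open>Evolution of the covariance under tilts\<close>

abbreviation pairs :: "(nat \<times> nat) set" where
  "pairs \<equiv> {..<n} \<times> {..<n}"

definition ce2 :: "((nat \<Rightarrow> real) \<Rightarrow> real) \<Rightarrow> nat \<times> nat \<Rightarrow> (nat \<Rightarrow> real) \<Rightarrow> real" where
  "ce2 \<rho> p x = ce \<rho> (fst p) x * ce \<rho> (snd p) x"

definition cov :: "((nat \<Rightarrow> real) \<Rightarrow> real) \<Rightarrow> nat \<times> nat \<Rightarrow> real" where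
  "cov \<rho> p = ex \<rho> (\<lambda>x. ce2 \<rho> p x)"

definition third :: "((nat \<Rightarrow> real) \<Rightarrow> real) \<Rightarrow> nat \<Rightarrow> nat \<times> nat \<Rightarrow> real" where
  "third \<rho> i p = ex \<rho> (\<lambda>x. ce \<rho> i x * ce2 \<rho> p x)"

text \<open>The squared Hilbert-Schmidt norm of the covariance; its root also dominates the operator
  norm (\<open>ex_along_sq_le\<close>).\<close>

definition \<Phi> :: "((nat \<Rightarrow> real) \<Rightarrow> real) \<Rightarrow> real" where
  "\<Phi> \<rho> = (\<Sum>p\<in>pairs. (cov \<rho> p)\<^sup>2)"

text \<open>The quadratic form of the covariance at a centred point, or the second moment of the
  inner product with an independent copy. Many sums over \<open>pairs\<close> below are expectations
  over two independent copies, written in coordinates.\<close>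

definition qf :: "((nat \<Rightarrow> real) \<Rightarrow> real) \<Rightarrow> (nat \<Rightarrow> real) \<Rightarrow> real" where
  "qf \<rho> x = (\<Sum>p\<in>pairs. cov \<rho> p * ce2 \<rho> p x)"

lemma bfun_ce2 [simp, intro]: "bfun (\<lambda>x. ce2 \<rho> p x)"
  by (auto simp: ce2_def)

lemma bfun_qf [simp, intro]: "bfun (\<lambda>x. qf \<rho> x)"
  by (auto simp: qf_def)

lemma Phi_nonneg: "0 \<le> \<Phi> \<rho>"
  by (auto simp: \<Phi>_def intro: sum_nonneg)

lemma along_sq: "(along \<rho> u x)\<^sup>2 = (\<Sum>p\<in>pairs. u (fst p) * u (snd p) * ce2 \<rho> p x)"
  by (simp add: along_def power2_eq_square sum_product sum.cartesian_product ce2_def case_prod_unfold mult_ac)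

lemma ex_along_sq: "dens \<rho> \<Longrightarrow> ex \<rho> (\<lambda>x. (along \<rho> u x)\<^sup>2) = (\<Sum>p\<in>pairs. u (fst p) * u (snd p) * cov \<rho> p)"
  by (simp add: along_sq ex_sum ex_cmult cov_def)

lemma qf_alt: "dens \<rho> \<Longrightarrow> qf \<rho> y = ex \<rho> (\<lambda>x. (along \<rho> (\<lambda>j. ce \<rho> j y) x)\<^sup>2)"
  by (simp add: ex_along_sq qf_def ce2_def mult_ac)

lemma qf_nonneg: "dens \<rho> \<Longrightarrow> 0 \<le> qf \<rho> y"
  unfolding qf_alt by (intro ex_nonneg) auto

lemma ex_qf: "dens \<rho> \<Longrightarrow> ex \<rho> (\<lambda>x. qf \<rho> x) = \<Phi> \<rho>"
  by (simp add: qf_def ex_sum ex_cmult \<Phi>_def power2_eq_square flip: cov_def)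

lemma ip_self_nonneg: "0 \<le> ip u u"
  unfolding ip_def by (intro sum_nonneg) auto

lemma ex_along_sq_le:
  assumes "dens \<rho>"
  shows "ex \<rho> (\<lambda>x. (along \<rho> u x)\<^sup>2) \<le> sqrt (\<Phi> \<rho>) * ip u u"
proof (rule power2_le_imp_le)
  have "(ex \<rho> (\<lambda>x. (along \<rho> u x)\<^sup>2))\<^sup>2 \<le> (\<Sum>p\<in>pairs. (u (fst p) * u (snd p))\<^sup>2) * (\<Sum>p\<in>pairs. (cov \<rho> p)\<^sup>2)"
    unfolding ex_along_sq[OF assms] by (rule Cauchy_Schwarz_ineq_sum)
  also have "(\<Sum>p\<in>pairs. (u (fst p) * u (snd p))\<^sup>2) = (ip u u)\<^sup>2"
    by (simp add: ip_def power2_eq_square sum_product sum.cartesian_product case_prod_unfold mult_ac)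
  finally show "(ex \<rho> (\<lambda>x. (along \<rho> u x)\<^sup>2))\<^sup>2 \<le> (sqrt (\<Phi> \<rho>) * ip u u)\<^sup>2"
    using Phi_nonneg by (simp add: power_mult_distrib \<Phi>_def mult.commute)
  show "0 \<le> sqrt (\<Phi> \<rho>) * ip u u" using Phi_nonneg ip_self_nonneg by simp
qed

text \<open>The vector \<open>u\<close> of correlations satisfies
  \<open>ip u u = ex \<rho> (\<lambda>x. g x * along \<rho> u x)\<close>, and Cauchy-Schwarz with
  the operator norm bounds the square of this by a multiple of \<open>ip u u\<close>. For
  \<open>g\<close> the centred \<open>nsq\<close> it limits the rate at which the variance is
  lost.\<close>

lemma correlation_bound:
  assumes \<rho>: "dens \<rho>" and g: "bfun g"
  shows "(\<Sum>i<n. (ex \<rho> (\<lambda>x. g x * ce \<rho> i x))\<^sup>2) \<le> sqrt (\<Phi> \<rho>) * ex \<rho> (\<lambda>x. (g x)\<^sup>2)"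
proof -
  define u where "u i = ex \<rho> (\<lambda>x. g x * ce \<rho> i x)" for i
  have g0: "0 \<le> ex \<rho> (\<lambda>x. (g x)\<^sup>2)" using \<rho> g by (intro ex_nonneg) auto
  have uu: "ip u u = (\<Sum>i<n. (ex \<rho> (\<lambda>x. g x * ce \<rho> i x))\<^sup>2)" by (simp add: ip_def u_def power2_eq_square)
  have u0: "0 \<le> ip u u" unfolding ip_def by (intro sum_nonneg) auto
  have "(\<lambda>x. g x * along \<rho> u x) = (\<lambda>x. \<Sum>i<n. u i * (g x * ce \<rho> i x))"
    by (simp add: along_def sum_distrib_left mult_ac)
  then have "ex \<rho> (\<lambda>x. g x * along \<rho> u x) = ip u u"
    using \<rho> g by (simp add: ex_sum ex_cmult ip_def flip: u_def)
  then have "(ip u u)\<^sup>2 \<le> ex \<rho> (\<lambda>x. (g x)\<^sup>2) * ex \<rho> (\<lambda>x. (along \<rho> u x)\<^sup>2)"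
    using ex_cauchy_schwarz[OF \<rho> g, of "\<lambda>x. along \<rho> u x"] by simp
  also have "\<dots> \<le> ex \<rho> (\<lambda>x. (g x)\<^sup>2) * (sqrt (\<Phi> \<rho>) * ip u u)"
    using g0 ex_along_sq_le[OF \<rho>] by (intro mult_left_mono)
  finally have *: "ip u u * ip u u \<le> (sqrt (\<Phi> \<rho>) * ex \<rho> (\<lambda>x. (g x)\<^sup>2)) * ip u u"
    by (simp add: power2_eq_square mult_ac)
  have "ip u u \<le> sqrt (\<Phi> \<rho>) * ex \<rho> (\<lambda>x. (g x)\<^sup>2)"
  proof (cases "ip u u = 0")
    case True
    then show ?thesis using g0 Phi_nonneg by simp
  next
    case False
    then show ?thesis using * u0 by (simp add: mult_le_cancel_right)
  qed
  then show ?thesis by (simp add: uu)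
qed

text \<open>For independent copies \<open>x\<close> and \<open>y\<close>, \<open>s y\<close> is the
  mean over \<open>x\<close> of their squared inner product times \<open>qf \<rho> x\<close>. By
  Cauchy-Schwarz and the fourth moment of a linear form it is at most
  \<open>sqrt (mom 4 * Q) * qf \<rho> y\<close>. Averaging over \<open>y\<close> gives
  \<open>Q\<close> back, so \<open>Q \<le> sqrt (mom 4 * Q) * \<Phi> \<rho>\<close>, which is solved
  for \<open>Q\<close>.\<close>

lemma ex_qf_sq:
  assumes w: "weight \<kappa> \<rho>"
  shows "ex \<rho> (\<lambda>x. (qf \<rho> x)\<^sup>2) \<le> mom 4 * (\<Phi> \<rho>)\<^sup>2"
proof -
  have \<rho>: "dens \<rho>" using w by (rule weight_dens)
  define Q where "Q = ex \<rho> (\<lambda>x. (qf \<rho> x)\<^sup>2)"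
  have Q0: "0 \<le> Q" unfolding Q_def using \<rho> by (intro ex_nonneg) auto
  define b where "b p = ex \<rho> (\<lambda>x. ce2 \<rho> p x * qf \<rho> x)" for p
  define s where "s y = (\<Sum>p\<in>pairs. b p * ce2 \<rho> p y)" for y
  define c where "c = sqrt (mom 4 * Q)"
  have bs: "bfun (\<lambda>x. s x)" unfolding s_def by auto
  have s_alt: "s y = ex \<rho> (\<lambda>x. (along \<rho> (\<lambda>j. ce \<rho> j y) x)\<^sup>2 * qf \<rho> x)" for y
  proof -
    have "(\<lambda>x. (along \<rho> (\<lambda>j. ce \<rho> j y) x)\<^sup>2 * qf \<rho> x) = (\<lambda>x. \<Sum>p\<in>pairs. ce2 \<rho> p y * (ce2 \<rho> p x * qf \<rho> x))"
      by (simp add: along_sq sum_distrib_right sum_distrib_left mult_ac ce2_def)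
    then show ?thesis using \<rho> by (simp add: ex_sum ex_cmult s_def b_def mult.commute)
  qed
  have "s y \<le> c * qf \<rho> y" for y
  proof (rule power2_le_imp_le)
    let ?a = "\<lambda>x. along \<rho> (\<lambda>j. ce \<rho> j y) x"
    have "(s y)\<^sup>2 \<le> ex \<rho> (\<lambda>x. ((?a x)\<^sup>2)\<^sup>2) * Q"
      unfolding s_alt Q_def using \<rho> by (intro ex_cauchy_schwarz) auto
    also have "\<dots> \<le> (mom 4 * (qf \<rho> y)\<^sup>2) * Q"
      using fourth_moment[OF w affine_along[of \<rho> "\<lambda>j. ce \<rho> j y"]] Q0 by (intro mult_right_mono) (auto simp: qf_alt[OF \<rho>])
    also have "\<dots> = (c * qf \<rho> y)\<^sup>2" using Q0 mom_pos[of 4] by (simp add: c_def power_mult_distrib)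
    finally show "(s y)\<^sup>2 \<le> (c * qf \<rho> y)\<^sup>2" .
    show "0 \<le> c * qf \<rho> y" using Q0 mom_pos[of 4] qf_nonneg[OF \<rho>] by (simp add: c_def)
  qed
  then have "ex \<rho> (\<lambda>x. s x) \<le> ex \<rho> (\<lambda>x. c * qf \<rho> x)" using \<rho> bs by (intro ex_mono) auto
  also have "\<dots> = c * \<Phi> \<rho>" using \<rho> by (simp add: ex_cmult ex_qf)
  also have "ex \<rho> (\<lambda>x. s x) = Q"
  proof -
    have "(\<lambda>x. (qf \<rho> x)\<^sup>2) = (\<lambda>x. \<Sum>p\<in>pairs. cov \<rho> p * (ce2 \<rho> p x * qf \<rho> x))"
      by (simp add: power2_eq_square) (simp add: qf_def[of \<rho>] sum_distrib_right mult_ac)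
    then have "Q = (\<Sum>p\<in>pairs. cov \<rho> p * b p)" using \<rho> by (simp add: Q_def ex_sum ex_cmult b_def)
    then show ?thesis using \<rho> by (simp add: s_def ex_sum ex_cmult mult.commute flip: cov_def)
  qed
  finally have "Q\<^sup>2 \<le> (c * \<Phi> \<rho>)\<^sup>2" using Q0 by (intro power_mono)
  also have "\<dots> = (mom 4 * (\<Phi> \<rho>)\<^sup>2) * Q" using Q0 mom_pos[of 4] by (simp add: c_def power_mult_distrib)
  finally have *: "Q * Q \<le> (mom 4 * (\<Phi> \<rho>)\<^sup>2) * Q" by (simp add: power2_eq_square)
  have "Q \<le> mom 4 * (\<Phi> \<rho>)\<^sup>2"
  proof (cases "Q = 0")
    case True
    then show ?thesis using mom_pos[of 4] by simp
  next
    case False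
    then show ?thesis using * Q0 by (simp add: mult_le_cancel_right)
  qed
  then show ?thesis by (simp add: Q_def)
qed

text \<open>The left-hand side is the mean cubed inner product of two independent centred copies.
  Given one of them, \<open>y\<close>, the mean is at most \<open>sqrt (mom 4)\<close> times the
  power \<open>3/2\<close> of \<open>qf \<rho> y\<close>; the arithmetic-geometric mean inequality
  weighted by \<open>lam\<close> replaces this power by \<open>qf\<close> and its square, whose
  means are under control.\<close>

lemma third_moment_bound:
  assumes w: "weight \<kappa> \<rho>" and lam: "0 < lam" "\<Phi> \<rho> \<le> lam\<^sup>2"
  shows "(\<Sum>i<n. \<Sum>p\<in>pairs. (third \<rho> i p)\<^sup>2) \<le> sqrt (mom 4) * (1 + mom 4) * lam * \<Phi> \<rho>"
proof -
  have \<rho>: "dens \<rho>" using w by (rule weight_dens)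
  define \<tau> where "\<tau> y = (\<Sum>i<n. \<Sum>p\<in>pairs. third \<rho> i p * (ce \<rho> i y * ce2 \<rho> p y))" for y
  have b\<tau>: "bfun (\<lambda>x. \<tau> x)" unfolding \<tau>_def by (intro bfun_sum) auto
  have \<tau>_alt: "\<tau> y = ex \<rho> (\<lambda>x. along \<rho> (\<lambda>j. ce \<rho> j y) x * (along \<rho> (\<lambda>j. ce \<rho> j y) x)\<^sup>2)" for y
  proof -
    have "along \<rho> (\<lambda>j. ce \<rho> j y) x * (along \<rho> (\<lambda>j. ce \<rho> j y) x)\<^sup>2
      = (\<Sum>i<n. \<Sum>p\<in>pairs. (ce \<rho> i y * ce2 \<rho> p y) * (ce \<rho> i x * ce2 \<rho> p x))" for x
      unfolding along_sq unfolding along_def by (simp add: sum_product ce2_def mult_ac)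
    then have "ex \<rho> (\<lambda>x. along \<rho> (\<lambda>j. ce \<rho> j y) x * (along \<rho> (\<lambda>j. ce \<rho> j y) x)\<^sup>2)
      = ex \<rho> (\<lambda>x. \<Sum>i<n. \<Sum>p\<in>pairs. (ce \<rho> i y * ce2 \<rho> p y) * (ce \<rho> i x * ce2 \<rho> p x))" by (simp only:)
    also have "\<dots> = (\<Sum>i<n. \<Sum>p\<in>pairs. (ce \<rho> i y * ce2 \<rho> p y) * third \<rho> i p)"
      using \<rho> by (simp add: ex_sum ex_cmult third_def)
    finally show ?thesis by (simp add: \<tau>_def mult_ac)
  qed
  have le: "\<tau> y \<le> sqrt (mom 4) * (lam * qf \<rho> y + (qf \<rho> y)\<^sup>2 / lam)" for y
  proof (rule power2_le_imp_le)
    let ?a = "\<lambda>x. along \<rho> (\<lambda>j. ce \<rho> j y) x" and ?q = "qf \<rho> y"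
    have q0: "0 \<le> ?q" using \<rho> by (rule qf_nonneg)
    have "(\<tau> y)\<^sup>2 \<le> ex \<rho> (\<lambda>x. (?a x)\<^sup>2) * ex \<rho> (\<lambda>x. ((?a x)\<^sup>2)\<^sup>2)"
      unfolding \<tau>_alt using \<rho> by (intro ex_cauchy_schwarz) auto
    also have "\<dots> \<le> ?q * (mom 4 * ?q\<^sup>2)"
      using fourth_moment[OF w affine_along[of \<rho> "\<lambda>j. ce \<rho> j y"]] q0 by (intro mult_mono) (auto simp: qf_alt[OF \<rho>] intro: ex_nonneg[OF \<rho>])
    also have "\<dots> \<le> mom 4 * (lam * ?q + ?q\<^sup>2 / lam)\<^sup>2"
    proof -
      have "(lam * ?q + ?q\<^sup>2 / lam)\<^sup>2 = (lam * ?q - ?q\<^sup>2 / lam)\<^sup>2 + 4 * (?q * ?q\<^sup>2)"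
        using lam by (simp add: power2_eq_square field_simps)
      then have "?q * ?q\<^sup>2 \<le> (lam * ?q + ?q\<^sup>2 / lam)\<^sup>2" using q0 by (smt (verit) zero_le_power2 mult_nonneg_nonneg)
      then have "mom 4 * (?q * ?q\<^sup>2) \<le> mom 4 * (lam * ?q + ?q\<^sup>2 / lam)\<^sup>2" using mom_pos[of 4] by (intro mult_left_mono) auto
      then show ?thesis by (simp add: mult_ac)
    qed
    also have "\<dots> = (sqrt (mom 4) * (lam * ?q + ?q\<^sup>2 / lam))\<^sup>2" using mom_pos[of 4] by (simp add: power_mult_distrib)
    finally show "(\<tau> y)\<^sup>2 \<le> (sqrt (mom 4) * (lam * ?q + ?q\<^sup>2 / lam))\<^sup>2" .
    show "0 \<le> sqrt (mom 4) * (lam * ?q + ?q\<^sup>2 / lam)" using q0 lam mom_pos[of 4] by simp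
  qed
  have "(\<Sum>i<n. \<Sum>p\<in>pairs. (third \<rho> i p)\<^sup>2) = ex \<rho> (\<lambda>x. \<tau> x)"
    using \<rho> by (simp add: \<tau>_def ex_sum ex_cmult power2_eq_square flip: third_def)
  also have "\<dots> \<le> ex \<rho> (\<lambda>y. sqrt (mom 4) * (lam * qf \<rho> y + (qf \<rho> y)\<^sup>2 / lam))"
    using le b\<tau> \<rho> by (intro ex_mono) auto
  also have "\<dots> = sqrt (mom 4) * (lam * \<Phi> \<rho> + ex \<rho> (\<lambda>y. (qf \<rho> y)\<^sup>2) / lam)"
    using \<rho> by (simp add: ex_cmult ex_add ex_divide ex_qf)
  also have "\<dots> \<le> sqrt (mom 4) * (lam * \<Phi> \<rho> + mom 4 * lam * \<Phi> \<rho>)"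
  proof (intro mult_left_mono add_left_mono)
    have "ex \<rho> (\<lambda>y. (qf \<rho> y)\<^sup>2) \<le> mom 4 * (\<Phi> \<rho> * \<Phi> \<rho>)" using ex_qf_sq[OF w] by (simp add: power2_eq_square)
    also have "\<dots> \<le> mom 4 * (lam\<^sup>2 * \<Phi> \<rho>)" using lam mom_pos[of 4] Phi_nonneg by (intro mult_left_mono mult_right_mono) auto
    finally show "ex \<rho> (\<lambda>y. (qf \<rho> y)\<^sup>2) / lam \<le> mom 4 * lam * \<Phi> \<rho>" using lam by (simp add: field_simps power2_eq_square)
  qed (use mom_pos[of 4] in auto)
  also have "\<dots> = sqrt (mom 4) * (1 + mom 4) * lam * \<Phi> \<rho>" by (simp add: algebra_simps)
  finally show ?thesis .
qed

text \<open>The contraction is the correlation of \<open>qf\<close> with coordinate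
  \<open>i\<close>, so \<open>correlation_bound\<close> applies to \<open>qf\<close>.\<close>

lemma contraction_bound:
  assumes w: "weight \<kappa> \<rho>" and lam: "0 < lam" "\<Phi> \<rho> \<le> lam\<^sup>2"
  shows "(\<Sum>i<n. (\<Sum>p\<in>pairs. cov \<rho> p * third \<rho> i p)\<^sup>2) \<le> mom 4 * lam * (\<Phi> \<rho>)\<^sup>2"
proof -
  have \<rho>: "dens \<rho>" using w by (rule weight_dens)
  have "(\<Sum>p\<in>pairs. cov \<rho> p * third \<rho> i p) = ex \<rho> (\<lambda>x. qf \<rho> x * ce \<rho> i x)" for i
  proof -
    have "(\<lambda>x. qf \<rho> x * ce \<rho> i x) = (\<lambda>x. \<Sum>p\<in>pairs. cov \<rho> p * (ce \<rho> i x * ce2 \<rho> p x))"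
      by (simp add: qf_def sum_distrib_right sum_distrib_left mult_ac)
    then show ?thesis using \<rho> by (simp add: ex_sum ex_cmult third_def)
  qed
  then have "(\<Sum>i<n. (\<Sum>p\<in>pairs. cov \<rho> p * third \<rho> i p)\<^sup>2) \<le> sqrt (\<Phi> \<rho>) * ex \<rho> (\<lambda>x. (qf \<rho> x)\<^sup>2)"
    using correlation_bound[OF \<rho>, of "\<lambda>x. qf \<rho> x"] by simp
  also have "\<dots> \<le> lam * (mom 4 * (\<Phi> \<rho>)\<^sup>2)"
    using lam ex_qf_sq[OF w] real_sqrt_le_mono[OF lam(2)] by (intro mult_mono) (auto intro: ex_nonneg[OF \<rho>])
  finally show ?thesis by (simp add: mult_ac)
qed

section \<open>Expansion of the covariance under a tilt\<close>

lemma cov_tilt: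
  assumes \<rho>: "dens \<rho>" and l: "bfun l" "ex \<rho> l = 0" "\<And>x. x \<in> cube \<Longrightarrow> \<bar>l x\<bar> \<le> 1"
  shows "cov (tilt \<rho> l) p = cov \<rho> p + ex \<rho> (\<lambda>x. ce2 \<rho> p x * l x)
    - ex \<rho> (\<lambda>x. ce \<rho> (fst p) x * l x) * ex \<rho> (\<lambda>x. ce \<rho> (snd p) x * l x)"
proof -
  let ?\<rho>' = "tilt \<rho> l"
  have d: "dens ?\<rho>'" using \<rho> l by (rule dens_tilt)
  define m where "m i = ex \<rho> (\<lambda>x. ce \<rho> i x * l x)" for i
  have m: "ex ?\<rho>' (\<lambda>x. ce \<rho> i x) = m i" for i
    using \<rho> l by (simp add: ex_tilt m_def)
  have "mn ?\<rho>' i - mn \<rho> i = m i" for i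
    using m[of i] d by (simp add: ce_def ex_diff ex_const)
  then have ce': "ce ?\<rho>' i x = ce \<rho> i x - m i" for i x by (simp add: ce_def flip: \<open>\<And>i. mn ?\<rho>' i - mn \<rho> i = m i\<close>)
  have "cov ?\<rho>' p = ex ?\<rho>' (\<lambda>x. ce2 \<rho> p x - m (fst p) * ce \<rho> (snd p) x - m (snd p) * ce \<rho> (fst p) x + m (fst p) * m (snd p))"
    by (simp add: cov_def ce2_def ce' algebra_simps)
  also have "\<dots> = ex ?\<rho>' (\<lambda>x. ce2 \<rho> p x) - m (fst p) * m (snd p)"
    using d by (simp add: ex_add ex_diff ex_cmult ex_const m)
  also have "ex ?\<rho>' (\<lambda>x. ce2 \<rho> p x) = cov \<rho> p + ex \<rho> (\<lambda>x. ce2 \<rho> p x * l x)"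
    using \<rho> l by (simp add: ex_tilt cov_def)
  finally show ?thesis by (simp add: m_def)
qed

text \<open>A crude bound for all coefficients of the expansion in \<open>\<epsilon>\<close>:
  \<open>n ^ 2\<close> products of two entries of size at most \<open>(1 + 2 * R) ^ 4\<close>. It
  only occurs together with \<open>\<epsilon> ^ 4\<close>, so its size is harmless when the steps
  shrink.\<close>

definition Gb :: real where
  "Gb = real n ^ 2 * ((1 + 2 * R) ^ 4)\<^sup>2"

text \<open>With \<open>A' = A \<plusminus> \<epsilon> T - \<epsilon>\<^sup>2 U\<close>, where \<open>A\<close> is the covariance, \<open>T\<close> a slice of the third moment and \<open>U\<close>
  the outer square of a row of \<open>A\<close>, the two values of \<open>\<Phi>\<close> are \<open>P + s\<close> and \<open>P - s\<close> with \<open>P\<close> even and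
  \<open>s\<close> odd in \<open>\<epsilon>\<close>. The second-order term \<open>- 2 * \<langle>A, U\<rangle>\<close> of \<open>P\<close> has the good sign.\<close>

lemma Phi_sq_tilt:
  assumes w: "weight \<kappa> \<rho>" and i: "i < n" and \<epsilon>: "0 < \<epsilon>" "\<epsilon> \<le> 1" "\<epsilon> \<le> 1 / (4 * R)"
  shows "(\<Phi> (tilt \<rho> (\<lambda>x. \<epsilon> * ce \<rho> i x)))\<^sup>2 + (\<Phi> (tilt \<rho> (\<lambda>x. - \<epsilon> * ce \<rho> i x)))\<^sup>2
    \<le> 2 * ((\<Phi> \<rho>)\<^sup>2 + \<epsilon>\<^sup>2 * (2 * \<Phi> \<rho> * (\<Sum>p\<in>pairs. (third \<rho> i p)\<^sup>2) + 4 * (\<Sum>p\<in>pairs. cov \<rho> p * third \<rho> i p)\<^sup>2)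
        + 18 * Gb\<^sup>2 * \<epsilon> ^ 4)"
proof -
  have \<rho>: "dens \<rho>" using w by (rule weight_dens)
  define A where "A = cov \<rho>"
  define T where "T = third \<rho> i"
  define U where "U p = A (i, fst p) * A (i, snd p)" for p
  have covt: "cov (tilt \<rho> (\<lambda>x. c * ce \<rho> i x)) p = A p + c * T p - c\<^sup>2 * U p" if c: "\<bar>c\<bar> \<le> \<epsilon>" for c p
  proof -
    have "cov (tilt \<rho> (\<lambda>x. c * ce \<rho> i x)) p = A p + ex \<rho> (\<lambda>x. ce2 \<rho> p x * (c * ce \<rho> i x))
      - ex \<rho> (\<lambda>x. ce \<rho> (fst p) x * (c * ce \<rho> i x)) * ex \<rho> (\<lambda>x. ce \<rho> (snd p) x * (c * ce \<rho> i x))"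
      unfolding A_def
    proof (rule cov_tilt[OF \<rho>])
      fix x assume "x \<in> cube"
      then have "\<bar>c * ce \<rho> i x\<bar> \<le> 1 / (4 * R) * (2 * R)"
        unfolding abs_mult using c \<epsilon> abs_ce_le[OF \<rho> i] R_pos by (intro mult_mono) auto
      then show "\<bar>c * ce \<rho> i x\<bar> \<le> 1" using R_pos by simp
    qed (use \<rho> in \<open>auto simp: ex_cmult\<close>)
    moreover have "(\<lambda>x. ce2 \<rho> p x * (c * ce \<rho> i x)) = (\<lambda>x. c * (ce \<rho> i x * ce2 \<rho> p x))" by (simp add: mult_ac)
    moreover have "(\<lambda>x. ce \<rho> k x * (c * ce \<rho> i x)) = (\<lambda>x. c * ce2 \<rho> (i, k) x)" for k by (simp add: mult_ac ce2_def)
    ultimately show ?thesis by (simp add: ex_cmult T_def third_def U_def A_def cov_def power2_eq_square)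
  qed
  define t2 u \<alpha> \<omega> \<beta> where "t2 = (\<Sum>p\<in>pairs. (T p)\<^sup>2)" and "u = (\<Sum>p\<in>pairs. (U p)\<^sup>2)"
    and "\<alpha> = (\<Sum>p\<in>pairs. A p * T p)" and "\<omega> = (\<Sum>p\<in>pairs. T p * U p)" and "\<beta> = (\<Sum>p\<in>pairs. A p * U p)"
  define F where "F = \<Phi> \<rho>"
  have Phi_t: "\<Phi> (tilt \<rho> (\<lambda>x. c * ce \<rho> i x)) = F + 2 * c * \<alpha> + c\<^sup>2 * (t2 - 2 * \<beta>) - 2 * c ^ 3 * \<omega> + c ^ 4 * u" if "\<bar>c\<bar> \<le> \<epsilon>" for c
  proof -
    have "\<Phi> (tilt \<rho> (\<lambda>x. c * ce \<rho> i x)) = (\<Sum>p\<in>pairs. (A p)\<^sup>2 + 2 * c * (A p * T p) + c\<^sup>2 * ((T p)\<^sup>2 - 2 * (A p * U p)) - 2 * c ^ 3 * (T p * U p) + c ^ 4 * (U p)\<^sup>2)"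
      unfolding \<Phi>_def covt[OF that] by (intro sum.cong) (auto simp: power2_eq_square power3_eq_cube power4_eq_xxxx algebra_simps)
    also have "\<dots> = F + 2 * c * \<alpha> + c\<^sup>2 * (t2 - 2 * \<beta>) - 2 * c ^ 3 * \<omega> + c ^ 4 * u"
      by (simp only: sum.distrib sum_subtractf flip: sum_distrib_left) (simp add: F_def \<Phi>_def A_def \<alpha>_def t2_def \<beta>_def \<omega>_def u_def)
    finally show ?thesis .
  qed
  \<comment> \<open>\<open>\<beta>\<close> is the second moment along row \<open>i\<close> of the
    covariance, hence its sign.\<close>
  have \<beta>0: "0 \<le> \<beta>"
  proof -
    have "\<beta> = ex \<rho> (\<lambda>x. (along \<rho> (\<lambda>j. A (i, j)) x)\<^sup>2)"
      by (simp add: ex_along_sq[OF \<rho>] \<beta>_def U_def A_def mult_ac)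
    then show ?thesis using \<rho> by (simp add: ex_nonneg)
  qed
  define b0 where "b0 = (1 + 2 * R) ^ 4"
  have b0: "(2 * R) ^ k \<le> b0" if "k \<le> 4" for k
  proof -
    have "(2 * R) ^ k \<le> (1 + 2 * R) ^ k" using R_pos by (intro power_mono) auto
    also have "\<dots> \<le> (1 + 2 * R) ^ 4" using R_pos that by (intro power_increasing) auto
    finally show ?thesis by (simp add: b0_def)
  qed
  have Ab2: "\<bar>A p\<bar> \<le> (2 * R)\<^sup>2" if "p \<in> pairs" for p
    unfolding A_def cov_def
  proof (rule ex_abs_le[OF \<rho>])
    fix x assume "x \<in> cube"
    then show "\<bar>ce2 \<rho> p x\<bar> \<le> (2 * R)\<^sup>2"
      unfolding ce2_def abs_mult power2_eq_square using that abs_ce_le[OF \<rho>] R_pos by (intro mult_mono) auto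
  qed auto
  have Ab: "\<bar>A p\<bar> \<le> b0" if "p \<in> pairs" for p
    using Ab2[OF that] b0[of 2] by simp
  have Tb: "\<bar>T p\<bar> \<le> b0" if "p \<in> pairs" for p
  proof -
    have "\<bar>T p\<bar> \<le> (2 * R) ^ 3"
      unfolding T_def third_def
    proof (rule ex_abs_le[OF \<rho>])
      fix x assume x: "x \<in> cube"
      have "\<bar>ce2 \<rho> p x\<bar> \<le> (2 * R) * (2 * R)"
        unfolding ce2_def abs_mult using x that abs_ce_le[OF \<rho>] R_pos by (intro mult_mono) auto
      then have "\<bar>ce \<rho> i x\<bar> * \<bar>ce2 \<rho> p x\<bar> \<le> (2 * R) * ((2 * R) * (2 * R))"
        using abs_ce_le[OF \<rho> i x] R_pos by (intro mult_mono) auto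
      then show "\<bar>ce \<rho> i x * ce2 \<rho> p x\<bar> \<le> (2 * R) ^ 3"
        by (simp only: abs_mult power3_eq_cube mult.assoc)
    qed auto
    then show ?thesis using b0[of 3] by simp
  qed
  have Ub: "\<bar>U p\<bar> \<le> b0" if "p \<in> pairs" for p
  proof -
    have "\<bar>U p\<bar> \<le> (2 * R)\<^sup>2 * (2 * R)\<^sup>2"
      unfolding U_def abs_mult using that i by (intro mult_mono Ab2) auto
    also have "\<dots> = (2 * R) ^ 4" by (simp flip: power_add)
    finally show ?thesis using b0[of 4] by simp
  qed
  have prodb: "\<bar>\<Sum>p\<in>pairs. f p * g p\<bar> \<le> Gb" if "\<And>p. p \<in> pairs \<Longrightarrow> \<bar>f p\<bar> \<le> b0" "\<And>p. p \<in> pairs \<Longrightarrow> \<bar>g p\<bar> \<le> b0" for f g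
  proof -
    have "0 \<le> b0" by (simp add: b0_def)
    have "\<bar>\<Sum>p\<in>pairs. f p * g p\<bar> \<le> (\<Sum>p\<in>pairs. \<bar>f p * g p\<bar>)" by (rule sum_abs)
    also have "\<dots> \<le> (\<Sum>p\<in>pairs. b0 * b0)"
      unfolding abs_mult using that \<open>0 \<le> b0\<close> by (intro sum_mono mult_mono) auto
    also have "\<dots> = Gb" by (simp add: Gb_def b0_def power2_eq_square)
    finally show ?thesis .
  qed
  have Gs: "\<bar>F\<bar> \<le> Gb" "\<bar>t2\<bar> \<le> Gb" "\<bar>u\<bar> \<le> Gb" "\<bar>\<alpha>\<bar> \<le> Gb" "\<bar>\<omega>\<bar> \<le> Gb"
    unfolding F_def \<Phi>_def t2_def u_def \<alpha>_def \<omega>_def power2_eq_square A_def[symmetric]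
    by (intro prodb Ab Tb Ub; assumption)+
  have nn: "0 \<le> F" "0 \<le> t2" "0 \<le> u" unfolding F_def t2_def u_def by (auto intro: Phi_nonneg sum_nonneg)
  define P s where "P = F + \<epsilon>\<^sup>2 * (t2 - 2 * \<beta>) + \<epsilon> ^ 4 * u" and "s = 2 * \<epsilon> * \<alpha> - 2 * \<epsilon> ^ 3 * \<omega>"
  have plus: "\<Phi> (tilt \<rho> (\<lambda>x. \<epsilon> * ce \<rho> i x)) = P + s" using Phi_t[of \<epsilon>] \<epsilon> by (simp add: P_def s_def)
  have minus: "\<Phi> (tilt \<rho> (\<lambda>x. - \<epsilon> * ce \<rho> i x)) = P - s" using Phi_t[of "- \<epsilon>"] \<epsilon> by (simp add: P_def s_def)
  have "0 \<le> P + s" "0 \<le> P - s" unfolding plus[symmetric] minus[symmetric] by (rule Phi_nonneg)+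
  then have P0: "0 \<le> P" by linarith
  have "P \<le> F + \<epsilon>\<^sup>2 * t2 + \<epsilon> ^ 4 * u" using \<beta>0 by (simp add: P_def algebra_simps)
  then have "P\<^sup>2 \<le> (F + \<epsilon>\<^sup>2 * t2 + \<epsilon> ^ 4 * u)\<^sup>2" using P0 by (intro power_mono)
  also have "\<dots> = F\<^sup>2 + \<epsilon>\<^sup>2 * (2 * F * t2) + \<epsilon> ^ 4 * (2 * (F * u) + t2 * t2 + 2 * (\<epsilon>\<^sup>2 * (t2 * u)) + \<epsilon> ^ 4 * (u * u))"
    by (simp add: power2_eq_square power4_eq_xxxx algebra_simps)
  finally have P2: "P\<^sup>2 \<le> F\<^sup>2 + \<epsilon>\<^sup>2 * (2 * F * t2) + \<epsilon> ^ 4 * (2 * (F * u) + t2 * t2 + 2 * (\<epsilon>\<^sup>2 * (t2 * u)) + \<epsilon> ^ 4 * (u * u))" .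
  have s2: "s\<^sup>2 = \<epsilon>\<^sup>2 * (4 * \<alpha>\<^sup>2) + \<epsilon> ^ 4 * (- 8 * (\<alpha> * \<omega>) + 4 * (\<epsilon>\<^sup>2 * (\<omega> * \<omega>)))"
    by (simp add: s_def power2_eq_square power3_eq_cube power4_eq_xxxx algebra_simps)
  have GG: "\<bar>a * b\<bar> \<le> Gb\<^sup>2" if "\<bar>a\<bar> \<le> Gb" "\<bar>b\<bar> \<le> Gb" for a b
    unfolding abs_mult power2_eq_square using that by (intro mult_mono) auto
  have eps_le: "\<epsilon> ^ k * z \<le> Gb\<^sup>2" if "\<bar>z\<bar> \<le> Gb\<^sup>2" for k z
  proof -
    have "\<epsilon> ^ k * z \<le> \<epsilon> ^ k * \<bar>z\<bar>" using \<epsilon> by (intro mult_left_mono) auto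
    also have "\<dots> \<le> 1 * \<bar>z\<bar>" using \<epsilon> by (intro mult_right_mono power_le_one) auto
    finally show ?thesis using that by simp
  qed
  \<comment> \<open>The absolute values of the coefficients add up to
    \<open>2 + 1 + 2 + 1 + 8 + 4 = 18\<close>.\<close>
  have "2 * (F * u) + t2 * t2 + 2 * (\<epsilon>\<^sup>2 * (t2 * u)) + \<epsilon> ^ 4 * (u * u) + (- 8 * (\<alpha> * \<omega>) + 4 * (\<epsilon>\<^sup>2 * (\<omega> * \<omega>))) \<le> 18 * Gb\<^sup>2"
    using GG[OF Gs(1,3)] GG[OF Gs(2,2)] eps_le[OF GG[OF Gs(2,3)], of 2] eps_le[OF GG[OF Gs(3,3)], of 4]
      GG[OF Gs(4,5)] eps_le[OF GG[OF Gs(5,5)], of 2] by (simp only: abs_le_iff) linarith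
  then have "\<epsilon> ^ 4 * (2 * (F * u) + t2 * t2 + 2 * (\<epsilon>\<^sup>2 * (t2 * u)) + \<epsilon> ^ 4 * (u * u) + (- 8 * (\<alpha> * \<omega>) + 4 * (\<epsilon>\<^sup>2 * (\<omega> * \<omega>)))) \<le> \<epsilon> ^ 4 * (18 * Gb\<^sup>2)"
    using \<epsilon> by (intro mult_left_mono) auto
  then have "P\<^sup>2 + s\<^sup>2 \<le> F\<^sup>2 + \<epsilon>\<^sup>2 * (2 * F * t2 + 4 * \<alpha>\<^sup>2) + 18 * Gb\<^sup>2 * \<epsilon> ^ 4"
    using P2 unfolding s2 by (simp only: distrib_left) (simp add: mult_ac)
  moreover have "(P + s)\<^sup>2 + (P - s)\<^sup>2 = 2 * (P\<^sup>2 + s\<^sup>2)" by (simp add: power2_eq_square algebra_simps)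
  ultimately show ?thesis
    unfolding plus minus by (simp add: F_def t2_def \<alpha>_def A_def T_def)
qed

section \<open>The thin-shell estimate\<close>

text \<open>\<open>N i\<close> counts the tilts along coordinate \<open>i\<close>; each of them adds
  \<open>\<epsilon>\<^sup>2 / 16\<close> to the convexity in this coordinate, by
  \<open>weight_tilt_gain\<close>.\<close>

definition cnt_weight :: "real \<Rightarrow> (nat \<Rightarrow> nat) \<Rightarrow> nat \<Rightarrow> real" where
  "cnt_weight \<epsilon> N i = real (N i) * (\<epsilon>\<^sup>2 / 16)"

text \<open>An exponential moment of the counts: a tilt along a uniformly chosen coordinate
  multiplies it by \<open>1 - 1 / (2 * n)\<close> on average, while a coordinate tilted fewer than
  \<open>M\<close> times keeps it above \<open>(1/2) ^ M\<close>. This stands in for a Chernoff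
  bound.\<close>

definition halves :: "(nat \<Rightarrow> nat) \<Rightarrow> real" where
  "halves N = (\<Sum>i<n. (1/2) ^ N i)"

lemma halves_step:
  assumes "i < n"
  shows "halves (N(i := Suc (N i))) = halves N - (1/2) ^ Suc (N i)"
proof -
  have "halves (N(i := Suc (N i))) = (\<Sum>k<n. (1/2) ^ N k - of_bool (k = i) * (1/2) ^ Suc (N k))"
    unfolding halves_def by (intro sum.cong) auto
  then show ?thesis using sum_of_bool_eq_mult[OF assms, of "\<lambda>k. (1/2) ^ Suc (N k)"]
    by (simp add: sum_subtractf halves_def)
qed

lemma weight_coord_tilt:
  assumes w: "weight (cnt_weight \<epsilon> N) \<rho>" and i: "i < n" and c: "\<bar>c\<bar> = \<epsilon>" "\<epsilon> \<le> 1 / (4 * R)"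
  shows "weight (cnt_weight \<epsilon> (N(i := Suc (N i)))) (tilt \<rho> (\<lambda>x. c * ce \<rho> i x))"
proof (rule weight_tilt_gain[OF w])
  have \<rho>: "dens \<rho>" using w by (rule weight_dens)
  show "ex \<rho> (\<lambda>x. c * ce \<rho> i x) = 0" using \<rho> by (simp add: ex_cmult)
  show "\<bar>c * ce \<rho> i x\<bar> \<le> 1/2" if "x \<in> cube" for x
  proof -
    have "\<bar>c * ce \<rho> i x\<bar> \<le> 1 / (4 * R) * (2 * R)"
      unfolding abs_mult using c abs_ce_le[OF \<rho> i that] R_pos by (intro mult_mono) auto
    then show ?thesis using R_pos by simp
  qed
  fix x y :: "nat \<Rightarrow> real"
  have "(\<Sum>k<n. cnt_weight \<epsilon> (N(i := Suc (N i))) k * (x k - y k)\<^sup>2)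
    = (\<Sum>k<n. cnt_weight \<epsilon> N k * (x k - y k)\<^sup>2 + of_bool (k = i) * (\<epsilon>\<^sup>2 / 16 * (x k - y k)\<^sup>2))"
    by (intro sum.cong) (auto simp: cnt_weight_def algebra_simps)
  also have "\<dots> = (\<Sum>k<n. cnt_weight \<epsilon> N k * (x k - y k)\<^sup>2) + \<epsilon>\<^sup>2 / 16 * (x i - y i)\<^sup>2"
    using sum_of_bool_eq_mult[OF i, of "\<lambda>k. \<epsilon>\<^sup>2 / 16 * (x k - y k)\<^sup>2"] by (simp add: sum.distrib)
  also have "\<epsilon>\<^sup>2 / 16 * (x i - y i)\<^sup>2 = (c * ce \<rho> i x - c * ce \<rho> i y)\<^sup>2 / 16"
  proof -
    have "c * ce \<rho> i x - c * ce \<rho> i y = c * (x i - y i)" by (simp add: ce_def algebra_simps)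
    moreover have "c\<^sup>2 = \<epsilon>\<^sup>2" using c(1) by (metis power2_abs)
    ultimately show ?thesis by (simp add: power_mult_distrib)
  qed
  finally show "(\<Sum>k<n. cnt_weight \<epsilon> (N(i := Suc (N i))) k * (x k - y k)\<^sup>2)
    \<le> (\<Sum>k<n. cnt_weight \<epsilon> N k * (x k - y k)\<^sup>2) + (c * ce \<rho> i x - c * ce \<rho> i y)\<^sup>2 / 16" by (rule eq_refl)
qed (use i affine_ce in \<open>auto simp: cnt_weight_def affine_def ce_def midpt_def field_simps\<close>)

text \<open>The tree of tilts need not be formed: since some child always has at least the average potential,
  following such children leads to a single leaf at which the potential can be evaluated. The path stops early
  if \<open>\<Phi>\<close> becomes large, and the penalty \<open>halves\<close> ensures that every coordinate is tilted often.\<close>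

definition pot :: "real \<Rightarrow> real \<Rightarrow> real \<Rightarrow> real \<Rightarrow> real \<Rightarrow> ((nat \<Rightarrow> real) \<Rightarrow> real) \<Rightarrow> (nat \<Rightarrow> nat) \<Rightarrow> real" where
  "pot g a b c d \<rho> N = g * var \<rho> nsq - (a * ex \<rho> nsq + b * ex \<rho> (\<lambda>x. nsq x ^ 4)) - c * (\<Phi> \<rho>)\<^sup>2 - d * halves N"

text \<open>If all \<open>2 * n\<close> children had smaller potential, so would their average. On
  average the variance of \<open>nsq\<close> keeps at least the factor
  \<open>1 - \<epsilon>\<^sup>2 / n * lam\<close>, the square of \<open>\<Phi>\<close> gains at most
  \<open>1 + \<epsilon>\<^sup>2 / n * (C1 * lam)\<close> up to the error in
  \<open>\<epsilon> ^ 4\<close>, \<open>halves\<close> contracts, and the plain expectations are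
  preserved. The coefficients of the parent are adjusted by precisely these factors.\<close>

lemma good_child:
  assumes w: "weight (cnt_weight \<epsilon> N) \<rho>" and \<epsilon>: "0 < \<epsilon>" "\<epsilon> \<le> 1" "\<epsilon> \<le> 1 / (4 * R)"
    and lam: "0 < lam" "\<Phi> \<rho> \<le> lam\<^sup>2" and nn: "0 \<le> g" "0 \<le> c" "0 \<le> d"
  shows "\<exists>\<rho>' N'. weight (cnt_weight \<epsilon> N') \<rho>' \<and>
    pot (g * (1 - \<epsilon>\<^sup>2 / real n * lam)) a b (c * (1 + \<epsilon>\<^sup>2 / real n * (C1 * lam))) (d * (1 - 1 / (2 * real n))) \<rho> N
      - c * (18 * Gb\<^sup>2 * \<epsilon> ^ 4) \<le> pot g a b c d \<rho>' N'"
proof (rule ccontr)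
  assume neg: "\<not> ?thesis"
  have \<rho>: "dens \<rho>" using w by (rule weight_dens)
  define Z where "Z = pot (g * (1 - \<epsilon>\<^sup>2 / real n * lam)) a b (c * (1 + \<epsilon>\<^sup>2 / real n * (C1 * lam))) (d * (1 - 1 / (2 * real n))) \<rho> N
      - c * (18 * Gb\<^sup>2 * \<epsilon> ^ 4)"
  let ?t = "\<lambda>c i. tilt \<rho> (\<lambda>x. c * ce \<rho> i x)" and ?N = "\<lambda>i. N(i := Suc (N i))"
  have less: "pot g a b c d (?t \<epsilon> i) (?N i) + pot g a b c d (?t (- \<epsilon>) i) (?N i) < 2 * Z" if "i < n" for i
    using neg weight_coord_tilt[OF w that, of \<epsilon>] weight_coord_tilt[OF w that, of "- \<epsilon>"] \<epsilon> unfolding Z_def[symmetric]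
    by (smt (verit))
  define H where "H = var \<rho> nsq"
  define L where "L = a * ex \<rho> nsq + b * ex \<rho> (\<lambda>x. nsq x ^ 4)"
  define F where "F = (\<Phi> \<rho>)\<^sup>2"
  define \<kappa> where "\<kappa> i = (ex \<rho> (\<lambda>x. (nsq x - ex \<rho> nsq) * ce \<rho> i x))\<^sup>2" for i
  define t2 where "t2 i = (\<Sum>p\<in>pairs. (third \<rho> i p)\<^sup>2)" for i
  define \<alpha> where "\<alpha> i = (\<Sum>p\<in>pairs. cov \<rho> p * third \<rho> i p)\<^sup>2" for i
  define E where "E = 18 * Gb\<^sup>2 * \<epsilon> ^ 4"
  have F0: "0 \<le> F" "0 \<le> H" using \<rho> by (auto simp: F_def H_def intro: var_nonneg)
  have sum2: "2 * g * H - 2 * g * \<epsilon>\<^sup>2 * \<kappa> i - 2 * L - c * (2 * (F + \<epsilon>\<^sup>2 * (2 * \<Phi> \<rho> * t2 i + 4 * \<alpha> i) + E)) - d * (2 * halves N - (1/2) ^ N i)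
    \<le> pot g a b c d (?t \<epsilon> i) (?N i) + pot g a b c d (?t (- \<epsilon>) i) (?N i)" if i: "i < n" for i
  proof -
    have lb: "\<bar>s * ce \<rho> i x\<bar> \<le> 1" if "\<bar>s\<bar> = \<epsilon>" "x \<in> cube" for s x
    proof -
      have "\<bar>s * ce \<rho> i x\<bar> \<le> 1 / (4 * R) * (2 * R)"
        unfolding abs_mult using that \<epsilon> abs_ce_le[OF \<rho> i] R_pos by (intro mult_mono) auto
      then show ?thesis using R_pos by simp
    qed
    have lin: "ex (?t \<epsilon> i) u + ex (?t (- \<epsilon>) i) u = 2 * ex \<rho> u" if "bfun u" for u
      using \<rho> that ex_cmult[of \<rho> "\<epsilon>" "\<lambda>x. u x * ce \<rho> i x"] ex_cmult[of \<rho> "- \<epsilon>" "\<lambda>x. u x * ce \<rho> i x"]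
      by (simp add: ex_tilt mult_ac)
    have vt: "var (?t s i) nsq = H + s * ex \<rho> (\<lambda>x. (nsq x - ex \<rho> nsq)\<^sup>2 * ce \<rho> i x) - \<epsilon>\<^sup>2 * \<kappa> i" if "\<bar>s\<bar> = \<epsilon>" for s
    proof -
      have "var (?t s i) nsq = H + ex \<rho> (\<lambda>x. (nsq x - ex \<rho> nsq)\<^sup>2 * (s * ce \<rho> i x)) - (ex \<rho> (\<lambda>x. (nsq x - ex \<rho> nsq) * (s * ce \<rho> i x)))\<^sup>2"
        unfolding H_def using \<rho> lb[OF that] by (intro var_tilt) (auto simp: ex_cmult)
      moreover have "(\<lambda>x. (nsq x - ex \<rho> nsq)\<^sup>2 * (s * ce \<rho> i x)) = (\<lambda>x. s * ((nsq x - ex \<rho> nsq)\<^sup>2 * ce \<rho> i x))"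
        "(\<lambda>x. (nsq x - ex \<rho> nsq) * (s * ce \<rho> i x)) = (\<lambda>x. s * ((nsq x - ex \<rho> nsq) * ce \<rho> i x))"
        by (simp_all add: mult_ac)
      moreover have "s\<^sup>2 = \<epsilon>\<^sup>2" using that by (metis power2_abs)
      ultimately show ?thesis by (simp add: ex_cmult power_mult_distrib \<kappa>_def)
    qed
    have v: "var (?t \<epsilon> i) nsq + var (?t (- \<epsilon>) i) nsq = 2 * H - 2 * \<epsilon>\<^sup>2 * \<kappa> i"
      using vt[of \<epsilon>] vt[of "- \<epsilon>"] \<epsilon> by simp
    have p: "(\<Phi> (?t \<epsilon> i))\<^sup>2 + (\<Phi> (?t (- \<epsilon>) i))\<^sup>2 \<le> 2 * (F + \<epsilon>\<^sup>2 * (2 * \<Phi> \<rho> * t2 i + 4 * \<alpha> i) + E)"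
      using Phi_sq_tilt[OF w i \<epsilon>] by (simp add: F_def t2_def \<alpha>_def E_def)
    have h: "2 * halves (?N i) = 2 * halves N - (1/2) ^ N i" using halves_step[OF i, of N] by simp
    have "pot g a b c d (?t \<epsilon> i) (?N i) + pot g a b c d (?t (- \<epsilon>) i) (?N i)
      = g * (var (?t \<epsilon> i) nsq + var (?t (- \<epsilon>) i) nsq) - (a * (ex (?t \<epsilon> i) nsq + ex (?t (- \<epsilon>) i) nsq)
        + b * (ex (?t \<epsilon> i) (\<lambda>x. nsq x ^ 4) + ex (?t (- \<epsilon>) i) (\<lambda>x. nsq x ^ 4)))
        - c * ((\<Phi> (?t \<epsilon> i))\<^sup>2 + (\<Phi> (?t (- \<epsilon>) i))\<^sup>2) - d * (2 * halves (?N i))"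
      by (simp add: pot_def algebra_simps)
    also have "\<dots> = g * (2 * H - 2 * \<epsilon>\<^sup>2 * \<kappa> i) - 2 * L - c * ((\<Phi> (?t \<epsilon> i))\<^sup>2 + (\<Phi> (?t (- \<epsilon>) i))\<^sup>2) - d * (2 * halves N - (1/2) ^ N i)"
      unfolding v h lin[OF bfun_nsq'] lin[OF bfun_power[OF bfun_nsq]] by (simp add: L_def algebra_simps)
    finally show ?thesis using mult_left_mono[OF p nn(2)] by (simp add: algebra_simps)
  qed
  have "(\<Sum>i<n. 2 * g * H - 2 * g * \<epsilon>\<^sup>2 * \<kappa> i - 2 * L - c * (2 * (F + \<epsilon>\<^sup>2 * (2 * \<Phi> \<rho> * t2 i + 4 * \<alpha> i) + E)) - d * (2 * halves N - (1/2) ^ N i))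
    < (\<Sum>i<n. 2 * Z)"
    using sum2 less n_pos by (intro sum_strict_mono) (auto intro: le_less_trans)
  also have "(\<Sum>i<n. 2 * g * H - 2 * g * \<epsilon>\<^sup>2 * \<kappa> i - 2 * L - c * (2 * (F + \<epsilon>\<^sup>2 * (2 * \<Phi> \<rho> * t2 i + 4 * \<alpha> i) + E)) - d * (2 * halves N - (1/2) ^ N i))
    = (\<Sum>i<n. (2 * g * H - 2 * L - 2 * c * F - 2 * c * E - 2 * d * halves N) - (2 * g * \<epsilon>\<^sup>2) * \<kappa> i
        - (2 * c * \<epsilon>\<^sup>2 * (2 * \<Phi> \<rho>)) * t2 i - (2 * c * \<epsilon>\<^sup>2 * 4) * \<alpha> i + d * (1/2) ^ N i)"
    by (intro sum.cong) (auto simp: algebra_simps)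
  also have "\<dots> = real n * (2 * g * H - 2 * L - 2 * c * F - 2 * c * E - 2 * d * halves N) - (2 * g * \<epsilon>\<^sup>2) * (\<Sum>i<n. \<kappa> i)
        - (2 * c * \<epsilon>\<^sup>2) * (2 * \<Phi> \<rho> * (\<Sum>i<n. t2 i) + 4 * (\<Sum>i<n. \<alpha> i)) + d * halves N"
    by (simp only: sum.distrib sum_subtractf halves_def flip: sum_distrib_left) (simp add: algebra_simps)
  finally have lt: "real n * (2 * g * H - 2 * L - 2 * c * F - 2 * c * E - 2 * d * halves N) - (2 * g * \<epsilon>\<^sup>2) * (\<Sum>i<n. \<kappa> i)
        - (2 * c * \<epsilon>\<^sup>2) * (2 * \<Phi> \<rho> * (\<Sum>i<n. t2 i) + 4 * (\<Sum>i<n. \<alpha> i)) + d * halves N < real n * (2 * Z)"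
    by simp
  have "(\<Sum>i<n. \<kappa> i) \<le> sqrt (\<Phi> \<rho>) * H"
    unfolding \<kappa>_def H_def var_def using \<rho> by (intro correlation_bound) auto
  also have "\<dots> \<le> lam * H" using lam F0 real_sqrt_le_mono[OF lam(2)] by (intro mult_right_mono) auto
  finally have "(2 * g * \<epsilon>\<^sup>2) * (\<Sum>i<n. \<kappa> i) \<le> (2 * g * \<epsilon>\<^sup>2) * (lam * H)"
    using nn by (intro mult_left_mono) auto
  moreover have "(2 * c * \<epsilon>\<^sup>2) * (2 * \<Phi> \<rho> * (\<Sum>i<n. t2 i) + 4 * (\<Sum>i<n. \<alpha> i)) \<le> (2 * c * \<epsilon>\<^sup>2) * (C1 * lam * F)"
  proof (rule mult_left_mono)
    have "2 * \<Phi> \<rho> * (\<Sum>i<n. t2 i) \<le> 2 * \<Phi> \<rho> * (sqrt (mom 4) * (1 + mom 4) * lam * \<Phi> \<rho>)"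
      unfolding t2_def using third_moment_bound[OF w lam] Phi_nonneg by (intro mult_left_mono) auto
    moreover have "4 * (\<Sum>i<n. \<alpha> i) \<le> 4 * (mom 4 * lam * F)"
      unfolding \<alpha>_def F_def using contraction_bound[OF w lam] by simp
    ultimately show "2 * \<Phi> \<rho> * (\<Sum>i<n. t2 i) + 4 * (\<Sum>i<n. \<alpha> i) \<le> C1 * lam * F"
      by (simp add: C1_def F_def power2_eq_square algebra_simps)
  qed (use nn in auto)
  ultimately have "real n * (2 * g * H - 2 * L - 2 * c * F - 2 * c * E - 2 * d * halves N) - (2 * g * \<epsilon>\<^sup>2) * (lam * H)
        - (2 * c * \<epsilon>\<^sup>2) * (C1 * lam * F) + d * halves N < real n * (2 * Z)"
    using lt by linarith
  moreover have "real n * (2 * Z) = real n * (2 * g * H - 2 * L - 2 * c * F - 2 * c * E - 2 * d * halves N) - (2 * g * \<epsilon>\<^sup>2) * (lam * H)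
        - (2 * c * \<epsilon>\<^sup>2) * (C1 * lam * F) + d * halves N"
    unfolding Z_def pot_def H_def[symmetric] L_def[symmetric] F_def[symmetric] E_def[symmetric]
    using n_pos by (simp add: field_simps)
  ultimately show False by simp
qed

text \<open>\<open>G\<close>, \<open>B\<close> and \<open>D\<close> invert the factors of one step,
  so \<open>good_child\<close> with the coefficients of step \<open>Suc k\<close> compares to those
  of step \<open>k\<close>. Once \<open>\<Phi>\<close> exceeds \<open>lam\<^sup>2\<close> the weight
  is frozen, as the one-step estimate holds below that level only.\<close>

lemma good_path:
  assumes w: "weight (\<lambda>_. 0) \<rho>0" and \<epsilon>: "0 < \<epsilon>" "\<epsilon> \<le> 1" "\<epsilon> \<le> 1 / (4 * R)"
    and lam: "0 < lam" "\<epsilon>\<^sup>2 / real n * lam < 1" and nn: "0 \<le> c" "0 \<le> d"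
    and G: "G = 1 / (1 - \<epsilon>\<^sup>2 / real n * lam)" and B: "B = 1 / (1 + \<epsilon>\<^sup>2 / real n * (C1 * lam))"
    and D: "D = 1 / (1 - 1 / (2 * real n))"
  shows "\<exists>j \<rho> N. j \<le> k \<and> weight (cnt_weight \<epsilon> N) \<rho> \<and> (j = k \<or> lam\<^sup>2 < \<Phi> \<rho>) \<and>
    pot 1 a b c d \<rho>0 (\<lambda>_. 0) - real k * (c * (18 * Gb\<^sup>2 * \<epsilon> ^ 4)) \<le> pot (G ^ j) a b (c * B ^ j) (d * D ^ j) \<rho> N"
proof (induction k)
  case 0
  have "cnt_weight \<epsilon> (\<lambda>_. 0) = (\<lambda>_. 0)" by (auto simp: cnt_weight_def)
  then show ?case using w by (intro exI[of _ 0] exI[of _ \<rho>0] exI[of _ "\<lambda>_. 0"]) auto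
next
  case (Suc k)
  define E where "E = c * (18 * Gb\<^sup>2 * \<epsilon> ^ 4)"
  have E0: "0 \<le> E" unfolding E_def using nn \<epsilon> by simp
  have dn: "1 - 1 / (2 * real n) \<noteq> 0" "0 < 1 - 1 / (2 * real n)" using n_pos by (auto simp: field_simps)
  have bn: "0 < 1 + \<epsilon>\<^sup>2 / real n * (C1 * lam)" using C1_pos lam n_pos by (intro add_pos_nonneg) auto
  have G0: "0 \<le> G" "G * (1 - \<epsilon>\<^sup>2 / real n * lam) = 1"
  proof -
    have "0 \<le> 1 / (1 - x) \<and> 1 / (1 - x) * (1 - x) = 1" if "x < 1" for x :: real using that by simp
    from this[OF lam(2)] show "0 \<le> G" "G * (1 - \<epsilon>\<^sup>2 / real n * lam) = 1" unfolding G by auto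
  qed
  have B0: "0 \<le> B" "B * (1 + \<epsilon>\<^sup>2 / real n * (C1 * lam)) = 1" "B \<le> 1"
  proof -
    have "0 \<le> 1 / (1 + x) \<and> 1 / (1 + x) * (1 + x) = 1 \<and> 1 / (1 + x) \<le> 1" if "0 \<le> x" for x :: real using that by simp
    moreover have "0 \<le> \<epsilon>\<^sup>2 / real n * (C1 * lam)" using C1_pos lam n_pos by simp
    ultimately show "0 \<le> B" "B * (1 + \<epsilon>\<^sup>2 / real n * (C1 * lam)) = 1" "B \<le> 1" unfolding B by blast+
  qed
  have D0: "0 \<le> D" "D * (1 - 1 / (2 * real n)) = 1" using dn by (auto simp: D)
  obtain j \<rho> N where IH: "j \<le> k" "weight (cnt_weight \<epsilon> N) \<rho>" "j = k \<or> lam\<^sup>2 < \<Phi> \<rho>"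
    "pot 1 a b c d \<rho>0 (\<lambda>_. 0) - real k * E \<le> pot (G ^ j) a b (c * B ^ j) (d * D ^ j) \<rho> N"
    using Suc unfolding E_def by blast
  show ?case
  proof (cases "lam\<^sup>2 < \<Phi> \<rho>")
    case True
    have "real k * E \<le> real (Suc k) * E" using E0 by (intro mult_right_mono) auto
    then show ?thesis using IH True unfolding E_def[symmetric]
      by (intro exI[of _ j] exI[of _ \<rho>] exI[of _ N]) (auto simp del: of_nat_Suc)
  next
    case False
    then have j: "j = k" and \<Phi>: "\<Phi> \<rho> \<le> lam\<^sup>2" using IH by auto
    obtain \<rho>' N' where c: "weight (cnt_weight \<epsilon> N') \<rho>'"
      "pot (G ^ Suc k * (1 - \<epsilon>\<^sup>2 / real n * lam)) a b (c * B ^ Suc k * (1 + \<epsilon>\<^sup>2 / real n * (C1 * lam))) (d * D ^ Suc k * (1 - 1 / (2 * real n))) \<rho> N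
        - c * B ^ Suc k * (18 * Gb\<^sup>2 * \<epsilon> ^ 4) \<le> pot (G ^ Suc k) a b (c * B ^ Suc k) (d * D ^ Suc k) \<rho>' N'"
      using good_child[OF IH(2) \<epsilon> lam(1) \<Phi>, of "G ^ Suc k" "c * B ^ Suc k" "d * D ^ Suc k" a b] nn G0 B0 D0
      by (auto simp del: power_Suc)
    have "G ^ Suc k * (1 - \<epsilon>\<^sup>2 / real n * lam) = G ^ k * (G * (1 - \<epsilon>\<^sup>2 / real n * lam))" by (simp add: mult_ac)
    also have "\<dots> = G ^ k" unfolding G0 by simp
    finally have 1: "G ^ Suc k * (1 - \<epsilon>\<^sup>2 / real n * lam) = G ^ k" .
    have "c * B ^ Suc k * (1 + \<epsilon>\<^sup>2 / real n * (C1 * lam)) = c * B ^ k * (B * (1 + \<epsilon>\<^sup>2 / real n * (C1 * lam)))" by (simp add: mult_ac)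
    also have "\<dots> = c * B ^ k" unfolding B0 by simp
    finally have 2: "c * B ^ Suc k * (1 + \<epsilon>\<^sup>2 / real n * (C1 * lam)) = c * B ^ k" .
    have "d * D ^ Suc k * (1 - 1 / (2 * real n)) = d * D ^ k * (D * (1 - 1 / (2 * real n)))" by (simp add: mult_ac)
    also have "\<dots> = d * D ^ k" unfolding D0 by simp
    finally have 3: "d * D ^ Suc k * (1 - 1 / (2 * real n)) = d * D ^ k" .
    have "c * B ^ Suc k * (18 * Gb\<^sup>2 * \<epsilon> ^ 4) = B ^ Suc k * E" by (simp add: E_def mult_ac)
    also have "\<dots> \<le> 1 * E" using B0 E0 by (intro mult_right_mono power_le_one) auto
    finally have "c * B ^ Suc k * (18 * Gb\<^sup>2 * \<epsilon> ^ 4) \<le> E" by simp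
    then have "pot 1 a b c d \<rho>0 (\<lambda>_. 0) - real (Suc k) * E \<le> pot (G ^ Suc k) a b (c * B ^ Suc k) (d * D ^ Suc k) \<rho>' N'"
      using c(2) IH(4) unfolding 1 2 3 j by (simp add: algebra_simps)
    then show ?thesis using c(1) unfolding E_def by (intro exI[of _ "Suc k"] exI[of _ \<rho>'] exI[of _ N']) auto
  qed
qed

section \<open>The potential at the root and at the leaf\<close>

lemma var_nsq_sq_le:
  assumes \<rho>: "dens \<rho>"
  shows "(var \<rho> nsq)\<^sup>2 \<le> ex \<rho> (\<lambda>x. nsq x ^ 4)" and "var \<rho> nsq \<le> (real n * R\<^sup>2)\<^sup>2"
proof -
  have v: "var \<rho> nsq \<le> ex \<rho> (\<lambda>x. (nsq x)\<^sup>2)" using var_le[OF \<rho> bfun_nsq', of 0] by simp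
  then have "(var \<rho> nsq)\<^sup>2 \<le> (ex \<rho> (\<lambda>x. (nsq x)\<^sup>2))\<^sup>2" using \<rho> by (intro power_mono var_nonneg) auto
  also have "\<dots> \<le> ex \<rho> (\<lambda>x. ((nsq x)\<^sup>2)\<^sup>2)" using \<rho> by (intro ex_square_le) auto
  finally show "(var \<rho> nsq)\<^sup>2 \<le> ex \<rho> (\<lambda>x. nsq x ^ 4)" by simp
  have "ex \<rho> (\<lambda>x. (nsq x)\<^sup>2) \<le> ex \<rho> (\<lambda>x. (real n * R\<^sup>2)\<^sup>2)"
  proof (rule ex_mono[OF \<rho>])
    fix x assume x: "x \<in> cube"
    have "nsq x \<le> (\<Sum>i<n. R\<^sup>2)" unfolding nsq_def
    proof (rule sum_mono)
      fix i assume "i \<in> {..<n}"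
      then have "\<bar>x i\<bar>\<^sup>2 \<le> R\<^sup>2" using cubeD(2)[OF x] by (intro power_mono) auto
      then show "(x i)\<^sup>2 \<le> R\<^sup>2" by simp
    qed
    moreover have "0 \<le> nsq x" by (auto simp: nsq_def intro: sum_nonneg)
    ultimately show "(nsq x)\<^sup>2 \<le> (real n * R\<^sup>2)\<^sup>2" by (intro power_mono) auto
  qed auto
  then show "var \<rho> nsq \<le> (real n * R\<^sup>2)\<^sup>2" using v \<rho> by (simp add: ex_const)
qed

text \<open>In each case one negative term pays for the variance \<open>v\<close>. If
  \<open>\<Phi>\<close> is large, then
  \<open>2 * v \<le> 2 * \<eta> * v\<^sup>2 + 1 / (2 * \<eta>)\<close> splits the cost between the
  fourth moment and the square of \<open>\<Phi>\<close>. Otherwise either all counts have reached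
  \<open>M\<close>, and the weight is strongly log-concave with
  \<open>k = M * \<epsilon>\<^sup>2 / 16 = t / 64\<close>, or some count has not, and the penalty
  exceeds any variance possible on the cube.\<close>

lemma leaf_pot_nonpos:
  assumes w: "weight (cnt_weight \<epsilon> N) \<rho>" and t: "0 < t" and \<eta>: "0 < \<eta>" and lam: "0 < lam" and M: "0 < M" "\<epsilon>\<^sup>2 = t / (4 * real M)"
    and g: "0 \<le> g" "g \<le> 2" and c: "1 / (2 * \<eta> * lam ^ 4) \<le> c" and d: "0 \<le> d" and fin: "lam\<^sup>2 < \<Phi> \<rho> \<or> 2 * (real n * R\<^sup>2)\<^sup>2 * 2 ^ M \<le> d"
  shows "pot g (128 * (16 + 8 * mom 4) / t) (2 * \<eta>) c d \<rho> N \<le> 0"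
proof -
  have \<rho>: "dens \<rho>" using w by (rule weight_dens)
  have H0: "0 \<le> var \<rho> nsq" using \<rho> by (intro var_nonneg) auto
  have gH: "g * var \<rho> nsq \<le> 2 * var \<rho> nsq" using g H0 by (intro mult_right_mono)
  have m1: "0 \<le> ex \<rho> nsq" using \<rho> by (intro ex_nonneg) (auto simp: nsq_def intro: sum_nonneg)
  have m4: "0 \<le> ex \<rho> (\<lambda>x. nsq x ^ 4)" using \<rho> by (intro ex_nonneg) auto
  have a0: "0 \<le> 128 * (16 + 8 * mom 4) / t * ex \<rho> nsq" using t m1 mom_pos[of 4] by simp
  have b0: "0 \<le> 2 * \<eta> * ex \<rho> (\<lambda>x. nsq x ^ 4)" using \<eta> m4 by simp
  have "0 \<le> 1 / (2 * \<eta> * lam ^ 4)" using \<eta> by simp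
  then have "0 \<le> c" using c by linarith
  then have c0: "0 \<le> c * (\<Phi> \<rho>)\<^sup>2" by simp
  have S: "(1/2) ^ N i \<le> halves N" if "i < n" for i unfolding halves_def using that by (intro member_le_sum) auto
  have d0: "0 \<le> d * halves N" using d by (auto simp: halves_def intro!: mult_nonneg_nonneg sum_nonneg)
  show ?thesis
  proof (cases "lam\<^sup>2 < \<Phi> \<rho>")
    case True
    have "1 \<le> \<Phi> \<rho> / lam\<^sup>2" using True lam by (simp add: field_simps)
    then have "1\<^sup>2 \<le> (\<Phi> \<rho> / lam\<^sup>2)\<^sup>2" by (intro power_mono) auto
    then have one: "1 \<le> (\<Phi> \<rho>)\<^sup>2 / lam ^ 4" by (simp add: power_divide)
    have "0 \<le> (2 * \<eta> * var \<rho> nsq - 1)\<^sup>2 / (2 * \<eta>)" using \<eta> by simp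
    also have "\<dots> = 2 * \<eta> * (var \<rho> nsq)\<^sup>2 + 1 / (2 * \<eta>) - 2 * var \<rho> nsq"
      using \<eta> by (simp add: power2_eq_square field_simps)
    finally have "2 * var \<rho> nsq \<le> 2 * \<eta> * (var \<rho> nsq)\<^sup>2 + 1 / (2 * \<eta>) * 1" by simp
    moreover have "2 * \<eta> * (var \<rho> nsq)\<^sup>2 \<le> 2 * \<eta> * ex \<rho> (\<lambda>x. nsq x ^ 4)"
      using \<eta> var_nsq_sq_le(1)[OF \<rho>] by (intro mult_left_mono) auto
    moreover have "1 / (2 * \<eta>) * 1 \<le> 1 / (2 * \<eta>) * ((\<Phi> \<rho>)\<^sup>2 / lam ^ 4)" using one \<eta> by (intro mult_left_mono) auto
    moreover have "1 / (2 * \<eta>) * ((\<Phi> \<rho>)\<^sup>2 / lam ^ 4) = 1 / (2 * \<eta> * lam ^ 4) * (\<Phi> \<rho>)\<^sup>2" by simp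
    moreover have "1 / (2 * \<eta> * lam ^ 4) * (\<Phi> \<rho>)\<^sup>2 \<le> c * (\<Phi> \<rho>)\<^sup>2" using c by (intro mult_right_mono) auto
    ultimately show ?thesis using gH a0 d0 unfolding pot_def by linarith
  next
    case False
    then have dl: "2 * (real n * R\<^sup>2)\<^sup>2 * 2 ^ M \<le> d" using fin by simp
    show ?thesis
    proof (cases "\<forall>i<n. M \<le> N i")
      case True
      have "var \<rho> nsq \<le> (16 + 8 * mom 4) / (real M * (\<epsilon>\<^sup>2 / 16)) * ex \<rho> nsq"
      proof (rule strong_norm_variance[OF w])
        show "0 < real M * (\<epsilon>\<^sup>2 / 16)" using M t by simp
        show "real M * (\<epsilon>\<^sup>2 / 16) \<le> cnt_weight \<epsilon> N i" if "i < n" for i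
          unfolding cnt_weight_def using True that by (intro mult_right_mono) auto
      qed
      also have "(16 + 8 * mom 4) / (real M * (\<epsilon>\<^sup>2 / 16)) = 64 * (16 + 8 * mom 4) / t"
        unfolding M(2) using M t by (simp add: field_simps)
      finally have v: "var \<rho> nsq \<le> 64 * (16 + 8 * mom 4) / t * ex \<rho> nsq" .
      have "128 * X / t * m = 2 * (64 * X / t * m)" for X m :: real by simp
      from v this[of "16 + 8 * mom 4" "ex \<rho> nsq"]
      have "2 * var \<rho> nsq \<le> 128 * (16 + 8 * mom 4) / t * ex \<rho> nsq" by linarith
      then show ?thesis using gH b0 c0 d0 unfolding pot_def by linarith
    next
      case False
      then obtain i where i: "i < n" "N i < M" by (auto simp: not_le)
      have "(1/2 :: real) ^ M \<le> (1/2) ^ N i" using i by (intro power_decreasing) auto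
      then have "(1/2) ^ M \<le> halves N" using S[OF i(1)] by linarith
      then have "2 * (real n * R\<^sup>2)\<^sup>2 * 2 ^ M * (1/2) ^ M \<le> d * halves N" using dl d by (intro mult_mono) auto
      moreover have "2 * (real n * R\<^sup>2)\<^sup>2 * 2 ^ M * (1/2) ^ M = 2 * (real n * R\<^sup>2)\<^sup>2" by (simp add: power_one_over)
      ultimately have "2 * var \<rho> nsq \<le> d * halves N" using var_nsq_sq_le(2)[OF \<rho>] by linarith
      then show ?thesis using gH a0 b0 c0 unfolding pot_def by linarith
    qed
  qed
qed

text \<open>At the root the potential is the variance minus the right-hand side and the initial
  penalty; at the leaf it is nonpositive. For fixed \<open>t\<close>, refining the steps sends the
  penalty and the discretization error to zero. The condition \<open>t * lam \<le> 1/2\<close> keeps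
  the coefficient of the variance below or at \<open>2\<close>.\<close>

theorem thin_shell:
  assumes w: "weight (\<lambda>_. 0) \<rho>0" and lam: "0 < lam" and t: "0 < t" "t * lam \<le> 1/2" and \<eta>: "0 < \<eta>"
  shows "var \<rho>0 nsq \<le> 128 * (16 + 8 * mom 4) / t * ex \<rho>0 nsq + 2 * \<eta> * ex \<rho>0 (\<lambda>x. nsq x ^ 4)
    + exp (C1 / 2) / (2 * \<eta> * lam ^ 4) * (\<Phi> \<rho>0)\<^sup>2" (is "_ \<le> ?rhs")
proof -
  define a where "a = 128 * (16 + 8 * mom 4) / t"
  define c where "c = exp (C1 / 2) / (2 * \<eta> * lam ^ 4)"
  have c0: "0 \<le> c" using \<eta> by (simp add: c_def)
  define V where "V = (real n * R\<^sup>2)\<^sup>2"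
  define r where "r = 1 - 1 / (2 * real n)"
  have r: "0 < r" "r < 1" using n_pos by (auto simp: r_def field_simps)
  have main: "var \<rho>0 nsq \<le> ?rhs + (2 * V * real n) * (1/2) ^ M + (c * (18 * Gb\<^sup>2) * real n * t\<^sup>2 / 4) * inverse (real M)"
    if M: "0 < M" "t / 4 \<le> real M" "4 * t * R\<^sup>2 \<le> real M" for M :: nat
  proof -
    define \<epsilon> where "\<epsilon> = sqrt (t / (4 * real M))"
    have \<epsilon>2: "\<epsilon>\<^sup>2 = t / (4 * real M)" using t M by (simp add: \<epsilon>_def)
    have \<epsilon>0: "0 < \<epsilon>" using t M by (simp add: \<epsilon>_def)
    have \<epsilon>1: "\<epsilon> \<le> 1" using M by (simp add: \<epsilon>_def field_simps)
    have \<epsilon>R: "\<epsilon> \<le> 1 / (4 * R)"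
    proof (rule power2_le_imp_le)
      show "\<epsilon>\<^sup>2 \<le> (1 / (4 * R))\<^sup>2" unfolding \<epsilon>2 using M R_pos by (simp add: power_divide power_mult_distrib field_simps)
    qed (use R_pos in simp)
    \<comment> \<open>A full path makes \<open>4 * M\<close> tilts per coordinate on average, four
      times what the leaf asks for, and its total time \<open>K * \<epsilon>\<^sup>2 / n\<close> is
      \<open>t\<close>.\<close>
    define K where "K = 4 * n * M"
    define \<delta> where "\<delta> = \<epsilon>\<^sup>2 / real n"
    have K\<delta>: "real K * \<delta> = t" unfolding K_def \<delta>_def \<epsilon>2 using n_pos M by (simp add: field_simps)
    have K0: "0 < K" using n_pos M by (simp add: K_def)
    have \<delta>0: "0 < \<delta>" unfolding \<delta>_def using \<epsilon>0 n_pos by simp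
    have Kdl: "real K * (\<delta> * lam) \<le> 1/2" using t(2) unfolding K\<delta>[symmetric] by (simp add: mult_ac)
    have dl: "0 < \<delta> * lam" "\<delta> * lam \<le> 1/2"
    proof -
      show "0 < \<delta> * lam" using \<delta>0 lam by simp
      then have "1 * (\<delta> * lam) \<le> real K * (\<delta> * lam)" using K0 by (intro mult_right_mono) auto
      then show "\<delta> * lam \<le> 1/2" using Kdl by linarith
    qed
    define G B D where "G = 1 / (1 - \<delta> * lam)" and "B = 1 / (1 + \<delta> * (C1 * lam))" and "D = 1 / (1 - 1 / (2 * real n))"
    have lt: "\<epsilon>\<^sup>2 / real n * lam < 1" using dl(2) unfolding \<delta>_def by linarith
    \<comment> \<open>After \<open>K\<close> steps this coefficient has grown to the
      \<open>2 * V * 2 ^ M\<close> required at a full leaf.\<close>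
    define d where "d = 2 * V * 2 ^ M * r ^ K"
    have V0: "0 \<le> V" by (simp add: V_def)
    have d0: "0 \<le> d" using r V0 by (simp add: d_def)
    obtain j \<rho> N where leaf: "j \<le> K" "weight (cnt_weight \<epsilon> N) \<rho>" "j = K \<or> lam\<^sup>2 < \<Phi> \<rho>"
      "pot 1 a (2 * \<eta>) c d \<rho>0 (\<lambda>_. 0) - real K * (c * (18 * Gb\<^sup>2 * \<epsilon> ^ 4)) \<le> pot (G ^ j) a (2 * \<eta>) (c * B ^ j) (d * D ^ j) \<rho> N"
      using good_path[OF w \<epsilon>0 \<epsilon>1 \<epsilon>R lam lt c0 d0 G_def[unfolded \<delta>_def] B_def[unfolded \<delta>_def] D_def, where a=a and b="2 * \<eta>" and k=K]
      by blast
    have "pot (G ^ j) a (2 * \<eta>) (c * B ^ j) (d * D ^ j) \<rho> N \<le> 0"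
      unfolding a_def
    proof (rule leaf_pot_nonpos[OF leaf(2) t(1) \<eta> lam M(1) \<epsilon>2])
      have G1: "1 \<le> G" using dl by (simp add: G_def)
      then show "0 \<le> G ^ j" by simp
      have "1 + real K * (- (\<delta> * lam)) \<le> (1 + - (\<delta> * lam)) ^ K" using dl by (intro Bernoulli_inequality) auto
      then have half: "1/2 \<le> (1 - \<delta> * lam) ^ K" using Kdl by simp
      have "G ^ j \<le> G ^ K" using G1 leaf(1) by (intro power_increasing)
      also have "\<dots> = 1 / (1 - \<delta> * lam) ^ K" by (simp add: G_def power_one_over)
      also have "\<dots> \<le> 1 / (1/2)" using half by (intro divide_left_mono) auto
      finally show "G ^ j \<le> 2" by simp
      have x0: "0 \<le> \<delta> * (C1 * lam)" using \<delta>0 C1_pos lam by simp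
      have "(1 + \<delta> * (C1 * lam)) ^ j \<le> (1 + \<delta> * (C1 * lam)) ^ K" using leaf(1) x0 by (intro power_increasing) auto
      also have "\<dots> \<le> exp (\<delta> * (C1 * lam)) ^ K" using x0 by (intro power_mono exp_ge_add_one_self) auto
      also have "\<dots> = exp (C1 * (real K * (\<delta> * lam)))" by (simp add: mult_ac flip: exp_of_nat_mult)
      also have "\<dots> \<le> exp (C1 * (1/2))" using Kdl C1_pos by (simp add: mult_left_mono)
      finally have e: "(1 + \<delta> * (C1 * lam)) ^ j \<le> exp (C1 / 2)" by simp
      have p0: "0 < (1 + \<delta> * (C1 * lam)) ^ j" using x0 by (intro zero_less_power) auto
      have "1 \<le> exp (C1 / 2) * B ^ j" using e p0 by (simp add: B_def power_one_over field_simps)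
      then have "1 * (1 / (2 * \<eta> * lam ^ 4)) \<le> (exp (C1 / 2) * B ^ j) * (1 / (2 * \<eta> * lam ^ 4))"
        using \<eta> by (intro mult_right_mono) auto
      then show "1 / (2 * \<eta> * lam ^ 4) \<le> c * B ^ j" by (simp add: c_def)
      have D_r: "D = 1 / r" by (simp add: D_def r_def)
      show "0 \<le> d * D ^ j" using d0 r by (simp add: D_r)
      have "d * D ^ K = 2 * V * 2 ^ M" using r by (simp add: d_def D_r power_one_over)
      then show "lam\<^sup>2 < \<Phi> \<rho> \<or> 2 * (real n * R\<^sup>2)\<^sup>2 * 2 ^ M \<le> d * D ^ j"
        using leaf(3) by (auto simp: V_def)
    qed
    then have "pot 1 a (2 * \<eta>) c d \<rho>0 (\<lambda>_. 0) \<le> real K * (c * (18 * Gb\<^sup>2 * \<epsilon> ^ 4))" using leaf(4) by linarith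
    moreover have "real K * (c * (18 * Gb\<^sup>2 * \<epsilon> ^ 4)) = (c * (18 * Gb\<^sup>2) * real n * t\<^sup>2 / 4) * inverse (real M)"
    proof -
      have "\<epsilon> ^ 4 = (\<epsilon>\<^sup>2)\<^sup>2" by simp
      then have "\<epsilon> ^ 4 = t\<^sup>2 / (16 * (real M)\<^sup>2)" unfolding \<epsilon>2 by (simp add: power_divide power_mult_distrib)
      then show ?thesis using M by (simp add: K_def field_simps power2_eq_square)
    qed
    moreover have "pot 1 a (2 * \<eta>) c d \<rho>0 (\<lambda>_. 0) = var \<rho>0 nsq - ?rhs - d * real n"
      by (simp add: pot_def halves_def a_def c_def)
    moreover have "d * real n \<le> (2 * V * real n) * (1/2) ^ M"
    proof -
      \<comment> \<open>Since \<open>K / (2 * n) = 2 * M\<close>, the bound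
        \<open>r ^ K \<le> exp (- 2) ^ M \<le> (1/4) ^ M\<close> outweighs \<open>2 ^ M\<close>; the
        factor \<open>4\<close> in \<open>K\<close> serves this purpose.\<close>
      have "r \<le> exp (- (1 / (2 * real n)))" using exp_ge_add_one_self[of "- (1 / (2 * real n))"] by (simp add: r_def)
      then have "r ^ K \<le> exp (- (1 / (2 * real n))) ^ K" using r by (intro power_mono) auto
      also have "\<dots> = exp (real K * (- (1 / (2 * real n))))" by (simp flip: exp_of_nat_mult)
      also have "real K * (- (1 / (2 * real n))) = real M * (- 2)" using n_pos by (simp add: K_def field_simps)
      also have "exp (real M * (- 2)) = exp (- 2) ^ M" by (rule exp_of_nat_mult)
      also have "\<dots> \<le> (1/4) ^ M"
      proof (rule power_mono)
        have "2 \<le> exp (1::real)" using exp_ge_add_one_self[of 1] by simp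
        then have "2 * 2 \<le> exp (1::real) * exp 1" by (intro mult_mono) auto
        then have "4 \<le> exp (2::real)" by (simp flip: exp_add)
        then show "exp (- 2) \<le> (1/4 :: real)" by (simp add: exp_minus field_simps)
      qed simp
      finally have "2 ^ M * r ^ K \<le> 2 ^ M * (1/4) ^ M" by (intro mult_left_mono) auto
      also have "\<dots> = (1/2) ^ M" by (simp flip: power_mult_distrib)
      finally have "(2 * V * real n) * (2 ^ M * r ^ K) \<le> (2 * V * real n) * (1/2) ^ M" using V0 by (intro mult_left_mono) auto
      then show ?thesis by (simp add: d_def mult_ac)
    qed
    ultimately show ?thesis by linarith
  qed
  have "(\<lambda>M. ?rhs + (2 * V * real n) * (1/2) ^ M + (c * (18 * Gb\<^sup>2) * real n * t\<^sup>2 / 4) * inverse (real M))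
    \<longlonglongrightarrow> ?rhs + (2 * V * real n) * 0 + (c * (18 * Gb\<^sup>2) * real n * t\<^sup>2 / 4) * 0"
    by (intro tendsto_add tendsto_mult tendsto_const LIMSEQ_power_zero lim_inverse_n) auto
  moreover have "\<exists>M0. \<forall>M\<ge>M0. var \<rho>0 nsq \<le> ?rhs + (2 * V * real n) * (1/2) ^ M + (c * (18 * Gb\<^sup>2) * real n * t\<^sup>2 / 4) * inverse (real M)"
  proof -
    obtain M0 :: nat where M0: "max 1 (max (t / 4) (4 * t * R\<^sup>2)) < real M0" using reals_Archimedean2 by blast
    have "0 < M \<and> t / 4 \<le> real M \<and> 4 * t * R\<^sup>2 \<le> real M" if "M0 \<le> M" for M
    proof -
      have "real M0 \<le> real M" using that by simp
      then have "1 < real M" "t / 4 \<le> real M" "4 * t * R\<^sup>2 \<le> real M" using M0 by linarith+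
      then show ?thesis by simp
    qed
    then show ?thesis using main by blast
  qed
  ultimately have "var \<rho>0 nsq \<le> ?rhs + (2 * V * real n) * 0 + (c * (18 * Gb\<^sup>2) * real n * t\<^sup>2 / 4) * 0"
    by (rule LIMSEQ_le_const)
  then show ?thesis by simp
qed

section \<open>Truncation to a cube and the Cheeger constant\<close>

lemma cube_sets [measurable]: "cube \<in> sets \<Lambda>"
  unfolding cube_def by measurable

definition trunc :: "(nat \<Rightarrow> real) measure \<Rightarrow> ((nat \<Rightarrow> real) \<Rightarrow> real) \<Rightarrow> (nat \<Rightarrow> real) \<Rightarrow> real" where
  "trunc \<mu> g x = indicator cube x * g x / measure \<mu> cube"

context
  fixes \<mu> :: "(nat \<Rightarrow> real) measure" and g :: "(nat \<Rightarrow> real) \<Rightarrow> real"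
  assumes P: "prob_space \<mu>" and D: "has_density n \<mu> g" and L: "log_concave_fun n g" and I: "isotropic n \<mu>"
    and Z: "1/2 \<le> measure \<mu> cube"
begin

lemma g_measurable [measurable]: "g \<in> borel_measurable \<Lambda>"
  using D by (simp add: has_density_def)

lemma mu_density: "\<mu> = density \<Lambda> (\<lambda>x. ennreal (g x))"
  using D by (simp add: has_density_def)

lemma sets_mu [measurable_cong]: "sets \<mu> = sets \<Lambda>"
  by (simp add: mu_density)

lemma g_nonneg: "x \<in> space \<Lambda> \<Longrightarrow> 0 \<le> g x"
  using L by (simp add: log_concave_fun_def)

lemma integral_mu: "f \<in> borel_measurable \<Lambda> \<Longrightarrow> (\<integral>x. f x \<partial>\<mu>) = (\<integral>x. g x * f x \<partial>\<Lambda>)"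
  unfolding mu_density by (subst integral_density) (auto simp: g_nonneg)

lemma ex_trunc:
  assumes "bfun f"
  shows "ex (trunc \<mu> g) f = (\<integral>x. indicator cube x * f x \<partial>\<mu>) / measure \<mu> cube"
proof -
  note [measurable] = bfun_measurable[OF assms]
  have "(\<integral>x. indicator cube x * f x \<partial>\<mu>) = (\<integral>x. g x * (indicator cube x * f x) \<partial>\<Lambda>)"
    by (rule integral_mu) measurable
  moreover have "ex (trunc \<mu> g) f = (\<integral>x. g x * (indicator cube x * f x) / measure \<mu> cube \<partial>\<Lambda>)"
    unfolding ex_def trunc_def by (simp add: mult_ac)
  ultimately show ?thesis by simp
qed

lemma dens_trunc: "dens (trunc \<mu> g)"
  unfolding dens_def
proof (intro conjI ballI impI)
  interpret prob_space \<mu> by (rule P)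
  show "trunc \<mu> g \<in> borel_measurable \<Lambda>" unfolding trunc_def by measurable
  show "0 \<le> trunc \<mu> g x" if "x \<in> space \<Lambda>" for x using g_nonneg[OF that] by (simp add: trunc_def)
  show "x \<in> cube" if "trunc \<mu> g x \<noteq> 0" for x using that by (auto simp: trunc_def indicator_def)
  have "integrable \<mu> (indicator cube :: _ \<Rightarrow> real)" by (intro integrable_real_indicator) (auto simp: emeasure_eq_measure sets_mu)
  then have "integrable \<Lambda> (\<lambda>x. g x * indicator cube x)"
    unfolding mu_density by (subst (asm) integrable_density) (auto simp: g_nonneg)
  then have "integrable \<Lambda> (\<lambda>x. g x * indicator cube x / measure \<mu> cube)" by simp
  then show "integrable \<Lambda> (trunc \<mu> g)" by (simp add: trunc_def[abs_def] mult.commute)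
  have "integral\<^sup>L \<Lambda> (trunc \<mu> g) = ex (trunc \<mu> g) (\<lambda>x. 1)" by (simp add: ex_def)
  also have "\<dots> = (\<integral>x. indicator cube x \<partial>\<mu>) / measure \<mu> cube" by (simp add: ex_trunc)
  also have "(\<integral>x. indicator cube x \<partial>\<mu>) = measure \<mu> cube"
    using sets.sets_into_space[of cube \<mu>] by (simp add: sets_mu Int_absorb2)
  finally show "integral\<^sup>L \<Lambda> (trunc \<mu> g) = 1" using Z by simp
qed

lemma weight_trunc: "weight (\<lambda>_. 0) (trunc \<mu> g)"
proof -
  have "trunc \<mu> g x * trunc \<mu> g y \<le> (trunc \<mu> g (midpt {..<n} x y))\<^sup>2" if "x \<in> space \<Lambda>" "y \<in> space \<Lambda>" for x y
  proof (cases "x \<in> cube \<and> y \<in> cube")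
    case True
    then have "midpt {..<n} x y \<in> cube" by (auto intro: midpt_cube)
    then show ?thesis
      using True log_concave_midpoint[OF L that] by (simp add: trunc_def power_divide power2_eq_square divide_right_mono)
  qed (auto simp: trunc_def)
  then show ?thesis using dens_trunc by (simp add: weight_def)
qed

text \<open>The truncated density need not be isotropic, but dividing by a mass of at least
  \<open>1/2\<close> raises expectations of nonnegative functions at most twofold. Such upper bounds
  are what the estimates below draw from isotropy.\<close>

lemma ex_trunc_le:
  assumes "bfun f" "\<And>x. 0 \<le> f x" "integrable \<mu> f"
  shows "ex (trunc \<mu> g) f \<le> 2 * (\<integral>x. f x \<partial>\<mu>)"
proof -
  note [measurable] = bfun_measurable[OF assms(1)]
  have "(\<integral>x. indicator cube x * f x \<partial>\<mu>) \<le> (\<integral>x. f x \<partial>\<mu>)"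
  proof (rule integral_mono)
    have "integrable \<mu> (\<lambda>x. indicator cube x *\<^sub>R f x)"
      using assms(3) by (intro integrable_mult_indicator) (auto simp: sets_mu)
    then show "integrable \<mu> (\<lambda>x. indicator cube x * f x)" by simp
  qed (use assms in \<open>auto simp: indicator_def\<close>)
  moreover have "0 \<le> (\<integral>x. f x \<partial>\<mu>)" by (intro Bochner_Integration.integral_nonneg assms)
  then have "(\<integral>x. f x \<partial>\<mu>) / measure \<mu> cube \<le> (\<integral>x. f x \<partial>\<mu>) / (1/2)" using Z by (intro divide_left_mono) auto
  ultimately have "(\<integral>x. indicator cube x * f x \<partial>\<mu>) / measure \<mu> cube \<le> (\<integral>x. f x \<partial>\<mu>) / measure \<mu> cube"
    "(\<integral>x. f x \<partial>\<mu>) / measure \<mu> cube \<le> 2 * (\<integral>x. f x \<partial>\<mu>)"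
    by (auto intro: divide_right_mono)
  then show ?thesis unfolding ex_trunc[OF assms(1)] by (rule order_trans)
qed

lemma ex_ip_sq_le: "ex (trunc \<mu> g) (\<lambda>x. (ip u x)\<^sup>2) \<le> 2 * ip u u"
proof -
  have eq: "(ip u x)\<^sup>2 = (\<Sum>i<n. \<Sum>j<n. u i * u j * (x i * x j))" for x
    by (simp add: ip_def power2_eq_square sum_product mult_ac)
  have "has_bochner_integral \<mu> (\<lambda>x. \<Sum>i<n. \<Sum>j<n. u i * u j * (x i * x j)) (\<Sum>i<n. \<Sum>j<n. u i * u j * (if i = j then 1 else 0))"
    using I by (intro has_bochner_integral_sum has_bochner_integral_mult_right) (auto simp: isotropic_def)
  moreover have "(\<Sum>i<n. \<Sum>j<n. u i * u j * (if i = j then 1 else 0)) = ip u u"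
    by (simp add: ip_def if_distrib[of "\<lambda>z. _ * z"] cong: if_cong)
  ultimately have h: "has_bochner_integral \<mu> (\<lambda>x. (ip u x)\<^sup>2) (ip u u)" by (simp add: eq)
  then have "integrable \<mu> (\<lambda>x. (ip u x)\<^sup>2)" "(\<integral>x. (ip u x)\<^sup>2 \<partial>\<mu>) = ip u u"
    by (auto simp: has_bochner_integral_iff)
  then show ?thesis using ex_trunc_le[of "\<lambda>x. (ip u x)\<^sup>2"] by simp
qed

lemma ex_coord_sq_le: "i < n \<Longrightarrow> ex (trunc \<mu> g) (\<lambda>x. (x i)\<^sup>2) \<le> 2"
  using ex_ip_sq_le[of "\<lambda>k. of_bool (k = i)"] sum_of_bool_eq_mult[of i n "\<lambda>k. of_bool (k = i)"]
  by (simp add: ip_def sum_of_bool_eq_mult)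

lemma ex_nsq_le: "ex (trunc \<mu> g) nsq \<le> 2 * real n"
proof -
  have "ex (trunc \<mu> g) nsq = (\<Sum>i<n. ex (trunc \<mu> g) (\<lambda>x. (x i)\<^sup>2))"
    unfolding nsq_def[abs_def] using dens_trunc by (simp add: ex_sum)
  also have "\<dots> \<le> (\<Sum>i<n. 2)" using ex_coord_sq_le by (intro sum_mono) auto
  finally show ?thesis by simp
qed

lemma ex_nsq4_le: "ex (trunc \<mu> g) (\<lambda>x. nsq x ^ 4) \<le> 16 * mom 8 * real n ^ 4"
proof -
  let ?\<rho> = "trunc \<mu> g"
  have m8: "ex ?\<rho> (\<lambda>x. \<bar>x i\<bar> ^ 8) \<le> mom 8 * 16" if "i < n" for i
  proof -
    have "ex ?\<rho> (\<lambda>x. \<bar>x i\<bar> ^ 8) \<le> mom 8 * sqrt 2 ^ 8"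
      using that ex_coord_sq_le[OF that] by (intro moment_bound[OF weight_trunc]) auto
    also have "sqrt 2 ^ 8 = (16 :: real)" using power_mult[of "sqrt 2" 2 4] by simp
    finally show ?thesis .
  qed
  have "ex ?\<rho> (\<lambda>x. nsq x ^ 4) \<le> ex ?\<rho> (\<lambda>x. real n ^ 3 * (\<Sum>i<n. \<bar>x i\<bar> ^ 8))"
  proof (rule ex_mono[OF dens_trunc])
    fix x :: "nat \<Rightarrow> real"
    have "nsq x ^ 4 \<le> real n ^ 3 * (\<Sum>i<n. ((x i)\<^sup>2) ^ 4)" unfolding nsq_def by (rule sum_power4_mean)
    moreover have "((x i)\<^sup>2) ^ 4 = \<bar>x i\<bar> ^ 8" for i using power_mult[of "\<bar>x i\<bar>" 2 4] by simp
    ultimately show "nsq x ^ 4 \<le> real n ^ 3 * (\<Sum>i<n. \<bar>x i\<bar> ^ 8)" by simp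
  qed auto
  also have "\<dots> = real n ^ 3 * (\<Sum>i<n. ex ?\<rho> (\<lambda>x. \<bar>x i\<bar> ^ 8))" using dens_trunc by (simp add: ex_cmult ex_sum)
  also have "\<dots> \<le> real n ^ 3 * (\<Sum>i<n. mom 8 * 16)" using m8 by (intro mult_left_mono sum_mono) auto
  also have "\<dots> = 16 * mom 8 * real n ^ 4" by (simp add: power4_eq_xxxx power3_eq_cube)
  finally show ?thesis .
qed

text \<open>A row \<open>u\<close> of the covariance satisfies \<open>ip u u = ex ?\<rho>
  (\<lambda>x. ce ?\<rho> j x * along ?\<rho> u x)\<close>, and Cauchy-Schwarz with the bounds
  \<open>2\<close> and \<open>2 * ip u u\<close> for the two variances leaves rows of squared length
  at most \<open>4\<close>.\<close>

lemma Phi_trunc_le: "\<Phi> (trunc \<mu> g) \<le> 4 * real n"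
proof -
  let ?\<rho> = "trunc \<mu> g"
  have \<rho>: "dens ?\<rho>" by (rule dens_trunc)
  have v: "ex ?\<rho> (\<lambda>x. (along ?\<rho> u x)\<^sup>2) \<le> 2 * ip u u" for u
    using var_le[OF \<rho>, of "ip u" 0] ex_ip_sq_le[of u] by (simp add: var_ip[OF \<rho>])
  have row: "(\<Sum>k<n. (cov ?\<rho> (j, k))\<^sup>2) \<le> 4" if j: "j < n" for j
  proof -
    define u where "u k = cov ?\<rho> (j, k)" for k
    have uu: "ip u u = (\<Sum>k<n. (cov ?\<rho> (j, k))\<^sup>2)" by (simp add: ip_def u_def power2_eq_square)
    have "(\<lambda>x. ce ?\<rho> j x * along ?\<rho> u x) = (\<lambda>x. \<Sum>k<n. u k * ce2 ?\<rho> (j, k) x)"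
      by (simp add: along_def sum_distrib_left ce2_def mult_ac)
    then have "ex ?\<rho> (\<lambda>x. ce ?\<rho> j x * along ?\<rho> u x) = ip u u"
      using \<rho> by (simp add: ex_sum ex_cmult ip_def u_def flip: cov_def)
    then have "(ip u u)\<^sup>2 \<le> ex ?\<rho> (\<lambda>x. (ce ?\<rho> j x)\<^sup>2) * ex ?\<rho> (\<lambda>x. (along ?\<rho> u x)\<^sup>2)"
      using ex_cauchy_schwarz[OF \<rho>, of "\<lambda>x. ce ?\<rho> j x" "\<lambda>x. along ?\<rho> u x"] by simp
    also have "\<dots> \<le> 2 * (2 * ip u u)"
    proof (rule mult_mono)
      show "ex ?\<rho> (\<lambda>x. (ce ?\<rho> j x)\<^sup>2) \<le> 2"
        using var_le[OF \<rho>, of "\<lambda>x. x j" 0] ex_coord_sq_le[OF j] by (simp add: var_coord)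
    qed (use v \<rho> in \<open>auto intro: ex_nonneg\<close>)
    finally have *: "ip u u * ip u u \<le> 4 * ip u u" by (simp add: power2_eq_square)
    have "ip u u \<le> 4"
    proof (cases "ip u u = 0")
      case False
      then have "0 < ip u u" using ip_self_nonneg[of u] by simp
      then show ?thesis using * by (simp add: mult_le_cancel_right)
    qed simp
    then show ?thesis by (simp add: uu)
  qed
  have "\<Phi> ?\<rho> = (\<Sum>j<n. \<Sum>k<n. (cov ?\<rho> (j, k))\<^sup>2)" by (simp add: \<Phi>_def sum.cartesian_product case_prod_unfold)
  also have "\<dots> \<le> (\<Sum>j<n. 4)" using row by (intro sum_mono) auto
  finally show ?thesis by simp
qed

text \<open>With \<open>lam = A\<close> and \<open>t = 1 / (2 * A)\<close> the first term of
  \<open>thin_shell\<close> has order \<open>n * A\<close>. The choice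
  \<open>\<eta> = E = 1 / (n * A\<^sup>2)\<close> balances the other two, and
  \<open>A = n powr (2/3)\<close> gives all three the order \<open>T\<close>.\<close>

lemma var_nsq_trunc_le: "var (trunc \<mu> g) nsq \<le> CV * real n powr (5/3)"
proof -
  let ?\<rho> = "trunc \<mu> g" and ?n = "real n"
  have n0: "0 < ?n" using n_pos by simp
  define A E T where "A = ?n powr (2/3)" and "E = ?n powr (-7/3)" and "T = ?n powr (5/3)"
  have pos: "0 < A" "0 < E" "0 < T" using n0 by (auto simp: A_def E_def T_def)
  have An: "A * ?n = T"
    using powr_add[of ?n "2/3" 1] n0 by (simp add: A_def T_def)
  have En: "E * ?n ^ 4 = T"
    using powr_add[of ?n "-7/3" 4] n0 by (simp add: E_def T_def powr_numeral)
  have EA: "T * (E * A ^ 4) = ?n\<^sup>2"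
  proof -
    have "A ^ 4 = ?n powr (8/3)" using n0 by (simp add: A_def powr_power)
    then have "T * (E * A ^ 4) = ?n powr (5/3 + (-7/3 + 8/3))"
      unfolding powr_add by (simp add: T_def E_def)
    also have "\<dots> = ?n powr 2" by simp
    finally show ?thesis using n0 by (simp add: powr_numeral)
  qed
  have "var ?\<rho> nsq \<le> 128 * (16 + 8 * mom 4) / (1 / (2 * A)) * ex ?\<rho> nsq
    + 2 * E * ex ?\<rho> (\<lambda>x. nsq x ^ 4) + exp (C1 / 2) / (2 * E * A ^ 4) * (\<Phi> ?\<rho>)\<^sup>2"
    using pos by (intro thin_shell[OF weight_trunc]) auto
  also have "\<dots> \<le> 128 * (16 + 8 * mom 4) / (1 / (2 * A)) * (2 * ?n)
    + 2 * E * (16 * mom 8 * ?n ^ 4) + exp (C1 / 2) / (2 * E * A ^ 4) * (4 * ?n)\<^sup>2"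
  proof (intro add_mono mult_left_mono power_mono)
    show "0 \<le> 128 * (16 + 8 * mom 4) / (1 / (2 * A))" using pos mom_pos[of 4] by simp
    show "0 \<le> exp (C1 / 2) / (2 * E * A ^ 4)" using pos by simp
  qed (use pos ex_nsq_le ex_nsq4_le Phi_trunc_le Phi_nonneg in auto)
  also have "128 * (16 + 8 * mom 4) / (1 / (2 * A)) * (2 * ?n) = 512 * (16 + 8 * mom 4) * (A * ?n)" by simp
  also have "2 * E * (16 * mom 8 * ?n ^ 4) = 32 * mom 8 * (E * ?n ^ 4)" by simp
  also have "exp (C1 / 2) / (2 * E * A ^ 4) * (4 * ?n)\<^sup>2 = 8 * exp (C1 / 2) * (?n\<^sup>2 / (E * A ^ 4))"
    by (simp add: power_mult_distrib)
  also have "?n\<^sup>2 / (E * A ^ 4) = T" using pos unfolding EA[symmetric] by simp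
  also have "512 * (16 + 8 * mom 4) * (A * ?n) + 32 * mom 8 * (E * ?n ^ 4) + 8 * exp (C1 / 2) * T = CV * T"
    unfolding An En CV_def by (simp only: distrib_right)
  finally show ?thesis unfolding T_def .
qed

text \<open>Both sides carry the normalization by the mass of the cube, which cancels; on the
  right-hand side the intersection with the cube is then dropped.\<close>

lemma three_sets_trunc:
  assumes r: "0 < r" and S: "S \<in> sets \<Lambda>" and B: "B \<in> sets \<Lambda>"
    and sep: "\<And>x y. x \<in> S \<Longrightarrow> y \<in> B \<Longrightarrow> r \<le> eucl_dist n x y"
    and \<sigma>: "0 < \<sigma>" "33554432 * CV * real n powr (5/3) \<le> \<sigma> ^ 4"
  shows "min (measure \<mu> (S \<inter> cube)) (measure \<mu> (B \<inter> cube)) / 2 \<le> (21 + 160 * \<sigma> / r) * measure \<mu> (space \<Lambda> - S - B)"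
proof -
  interpret prob_space \<mu> by (rule P)
  let ?\<rho> = "trunc \<mu> g"
  have sp: "space \<mu> = space \<Lambda>" by (simp add: mu_density)
  have Z0: "0 < measure \<mu> cube" using Z by simp
  have bS: "bfun (\<lambda>x. of_bool (x \<in> A))" if "A \<in> sets \<Lambda>" for A using bfun_indicator[OF that] by (simp add: indicator_def of_bool_def)
  have pr: "pr ?\<rho> (\<lambda>x. x \<in> A) = measure \<mu> (A \<inter> cube) / measure \<mu> cube" if A: "A \<in> sets \<Lambda>" for A
  proof -
    have "(\<integral>x. indicator cube x * of_bool (x \<in> A) \<partial>\<mu>) = (\<integral>x. (indicator (A \<inter> cube) x :: real) \<partial>\<mu>)"
      by (intro Bochner_Integration.integral_cong) (auto simp: indicator_def)
    also have "\<dots> = measure \<mu> (A \<inter> cube)" using sets.sets_into_space[OF A] by (simp add: sp Int_absorb2 le_infI1)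
    finally show ?thesis by (simp add: ex_trunc bS[OF A])
  qed
  have nb: "(\<lambda>x. of_bool (x \<notin> S) * of_bool (x \<notin> B)) = (\<lambda>x. of_bool (x \<in> - (S \<union> B)) :: real)" by auto
  have G: "ex ?\<rho> (\<lambda>x. of_bool (x \<notin> S) * of_bool (x \<notin> B)) = pr ?\<rho> (\<lambda>x. x \<in> space \<Lambda> - S - B)"
    by (intro ex_cong[OF dens_trunc]) (auto dest: cubeD(1))
  have "33554432 * var ?\<rho> nsq \<le> \<sigma> ^ 4" using var_nsq_trunc_le \<sigma>(2) by linarith
  then have "min (pr ?\<rho> (\<lambda>x. x \<in> S)) (pr ?\<rho> (\<lambda>x. x \<in> B)) / 2
    \<le> (21 + 160 * \<sigma> / r) * ex ?\<rho> (\<lambda>x. of_bool (x \<notin> S) * of_bool (x \<notin> B))"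
    using sep by (intro three_sets[OF weight_trunc r bS[OF S] bS[OF B] _ \<sigma>(1)]) auto
  also have "\<dots> = (21 + 160 * \<sigma> / r) * (measure \<mu> ((space \<Lambda> - S - B) \<inter> cube) / measure \<mu> cube)"
    unfolding G using S B by (subst pr) auto
  finally have fin: "min (pr ?\<rho> (\<lambda>x. x \<in> S)) (pr ?\<rho> (\<lambda>x. x \<in> B)) / 2
    \<le> (21 + 160 * \<sigma> / r) * (measure \<mu> ((space \<Lambda> - S - B) \<inter> cube) / measure \<mu> cube)" .
  have "min (u / z) (v / z) = min u v / z" if "0 < z" for u v z :: real
    using that by (simp add: min_def divide_le_cancel)
  from fin[unfolded pr[OF S] pr[OF B] this[OF Z0]] have
    "min (measure \<mu> (S \<inter> cube)) (measure \<mu> (B \<inter> cube)) / 2 / measure \<mu> cube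
    \<le> (21 + 160 * \<sigma> / r) * measure \<mu> ((space \<Lambda> - S - B) \<inter> cube) / measure \<mu> cube" by simp
  then have "min (measure \<mu> (S \<inter> cube)) (measure \<mu> (B \<inter> cube)) / 2
    \<le> (21 + 160 * \<sigma> / r) * measure \<mu> ((space \<Lambda> - S - B) \<inter> cube)"
    using Z0 divide_le_cancel by (meson not_less_iff_gr_or_eq)
  also have "\<dots> \<le> (21 + 160 * \<sigma> / r) * measure \<mu> (space \<Lambda> - S - B)"
    using r \<sigma>(1) S B by (intro mult_left_mono finite_measure_mono) (auto simp: sets_mu)
  finally show ?thesis .
qed

end

end

section \<open>Passage to the whole space\<close>

lemma measure_cube_limit:
  assumes P: "prob_space \<mu>" and sets: "sets \<mu> = sets (lborel_pow n)" and n: "0 < n" and A: "A \<in> sets \<mu>"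
  shows "(\<lambda>k. measure \<mu> (A \<inter> box.cube n (real k + 1))) \<longlonglongrightarrow> measure \<mu> A"
proof -
  interpret prob_space \<mu> by (rule P)
  have b: "box n (real k + 1)" for k using n by unfold_locales auto
  note cd = box.cube_def[OF b]
  have m: "A \<inter> box.cube n (real k + 1) \<in> sets \<mu>" for k
    using A box.cube_sets[OF b[of k]] by (simp add: sets)
  have "(\<lambda>k. measure \<mu> (A \<inter> box.cube n (real k + 1))) \<longlonglongrightarrow> measure \<mu> (\<Union>k. A \<inter> box.cube n (real k + 1))"
    using m by (intro finite_Lim_measure_incseq) (force simp: incseq_def cd)+
  moreover have "(\<Union>k. A \<inter> box.cube n (real k + 1)) = A"
  proof
    show "A \<subseteq> (\<Union>k. A \<inter> box.cube n (real k + 1))"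
    proof
      fix x assume x: "x \<in> A"
      then have sp: "x \<in> space (lborel_pow n)" using sets.sets_into_space[OF A] sets_eq_imp_space_eq[OF sets] by auto
      obtain k :: nat where k: "(\<Sum>i<n. \<bar>x i\<bar>) < real k" using reals_Archimedean2 by blast
      have "\<bar>x i\<bar> \<le> real k + 1" if "i < n" for i
      proof -
        have "\<bar>x i\<bar> \<le> (\<Sum>i<n. \<bar>x i\<bar>)" using that by (intro member_le_sum) auto
        then show ?thesis using k by simp
      qed
      then show "x \<in> (\<Union>k. A \<inter> box.cube n (real k + 1))" using x sp by (auto simp: cd)
    qed
  qed auto
  ultimately show ?thesis by simp
qed

text \<open>The constants of the truncated inequality are free of \<open>R\<close>, so the cubes may
  exhaust the space; from some cube on, the mass exceeds \<open>1/2\<close>.\<close>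

lemma three_sets_isotropic:
  assumes P: "prob_space \<mu>" and D: "has_density n \<mu> g" and L: "log_concave_fun n g" and I: "isotropic n \<mu>" and n: "0 < n"
    and r: "0 < r" and S: "S \<in> sets (lborel_pow n)" and B: "B \<in> sets (lborel_pow n)"
    and sep: "\<And>x y. x \<in> S \<Longrightarrow> y \<in> B \<Longrightarrow> r \<le> eucl_dist n x y"
    and \<sigma>: "0 < \<sigma>" "33554432 * CV * real n powr (5/3) \<le> \<sigma> ^ 4"
  shows "min (measure \<mu> S) (measure \<mu> B) / 2 \<le> (21 + 160 * \<sigma> / r) * measure \<mu> (space (lborel_pow n) - S - B)"
proof -
  interpret prob_space \<mu> by (rule P)
  have sets: "sets \<mu> = sets (lborel_pow n)" using D by (simp add: has_density_def)
  have b: "box n (real k + 1)" for k using n by unfold_locales auto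
  let ?c = "\<lambda>k. box.cube n (real k + 1)"
  have lim: "(\<lambda>k. measure \<mu> (A \<inter> ?c k)) \<longlonglongrightarrow> measure \<mu> A" if "A \<in> sets (lborel_pow n)" for A
    using measure_cube_limit[OF P sets n] that sets by simp
  have spm: "space \<mu> \<in> sets (lborel_pow n)" using sets.top[of \<mu>] sets by simp
  have "(\<lambda>k. measure \<mu> (space \<mu> \<inter> ?c k)) \<longlonglongrightarrow> 1"
    using lim[OF spm] unfolding prob_space .
  moreover have "space \<mu> \<inter> ?c k = ?c k" for k
    using sets.sets_into_space[OF box.cube_sets[OF b[of k]]] sets_eq_imp_space_eq[OF sets] by auto
  ultimately have "(\<lambda>k. measure \<mu> (?c k)) \<longlonglongrightarrow> 1" by simp
  then have ev: "\<forall>\<^sub>F k in sequentially. 1/2 < measure \<mu> (?c k)" by (rule order_tendstoD) simp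
  have "(\<lambda>k. min (measure \<mu> (S \<inter> ?c k)) (measure \<mu> (B \<inter> ?c k)) / 2) \<longlonglongrightarrow> min (measure \<mu> S) (measure \<mu> B) / 2"
    using S B by (intro tendsto_divide tendsto_min lim tendsto_const) auto
  moreover have "\<forall>\<^sub>F k in sequentially. min (measure \<mu> (S \<inter> ?c k)) (measure \<mu> (B \<inter> ?c k)) / 2
    \<le> (21 + 160 * \<sigma> / r) * measure \<mu> (space (lborel_pow n) - S - B)"
    using ev
  proof eventually_elim
    case (elim k)
    show ?case using box.three_sets_trunc[OF b P D L I less_imp_le[OF elim] r S B sep \<sigma>] by simp
  qed
  ultimately show ?thesis by (rule tendsto_upperbound) simp
qed

theorem corollary1p4:
  shows "\<exists>c::real. c > 0 \<and>
    (\<forall>n\<ge>1. \<forall>(\<mu> :: (nat \<Rightarrow> real) measure) (g :: (nat \<Rightarrow> real) \<Rightarrow> real).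
      prob_space \<mu> \<longrightarrow> has_density n \<mu> g \<longrightarrow> log_concave_fun n g \<longrightarrow> isotropic n \<mu> \<longrightarrow>
      cheeger_const n \<mu> \<ge> ereal (c * real n powr (- 5 / 12)))"
proof -
  \<comment> \<open>Makes \<open>\<sigma> ^ 4\<close> below equal to
    \<open>33554432 * CV * n powr (5/3)\<close>, so that \<open>\<sigma>\<close> has order
    \<open>n powr (5/12)\<close>, the reciprocal of the claimed rate.\<close>
  define K where "K = root 4 (33554432 * CV)"
  have K: "0 < K" "K ^ 4 = 33554432 * CV" using CV_pos by (auto simp: K_def)
  have "isoperimetric_bound n \<mu> (ereal (1 / (363 * K) * real n powr (- 5 / 12)))"
    if n: "1 \<le> n" and P: "prob_space \<mu>" and D: "has_density n \<mu> g" and L: "log_concave_fun n g" and I: "isotropic n \<mu>"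
    for n and \<mu> :: "(nat \<Rightarrow> real) measure" and g
  proof -
    interpret prob_space \<mu> by (rule P)
    have sets: "sets \<mu> = sets (lborel_pow n)" using D by (simp add: has_density_def)
    have sp: "space \<mu> = space (lborel_pow n)" using sets_eq_imp_space_eq[OF sets] .
    define \<sigma> where "\<sigma> = K * real n powr (5 / 12)"
    have \<sigma>0: "0 < \<sigma>" using K n by (simp add: \<sigma>_def)
    have "(real n powr (5 / 12)) ^ 4 = real n powr (5 / 3)" using n by (simp add: powr_power)
    then have \<sigma>4: "33554432 * CV * real n powr (5 / 3) \<le> \<sigma> ^ 4" by (simp add: \<sigma>_def power_mult_distrib K)
    have c: "1 / (363 * K) * real n powr (- 5 / 12) = 1 / (363 * \<sigma>)"
    proof -
      have "real n powr (- 5 / 12) = 1 / real n powr (5 / 12)" using powr_minus_divide[of "real n" "5 / 12"] by simp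
      then show ?thesis by (simp add: \<sigma>_def)
    qed
    have "ereal (1 / (363 * \<sigma>)) * ereal (min (measure \<mu> S) (1 - measure \<mu> S)) \<le> boundary_measure n \<mu> S"
      if S: "S \<in> sets (lborel_pow n)" for S
    proof -
      define p where "p = min (measure \<mu> S) (1 - measure \<mu> S)"
      have bound: "1 / (363 * \<sigma>) * p \<le> (measure \<mu> (open_nbhd n r S) - measure \<mu> S) / r" if r: "0 < r" "r < \<sigma>" for r
      proof -
        let ?U = "open_nbhd n r S"
        have Ssp: "S \<subseteq> space (lborel_pow n)" using S by (rule sets.sets_into_space)
        have U: "?U \<in> sets (lborel_pow n)" by (rule open_nbhd_measurable[OF Ssp])
        have SU: "S \<subseteq> ?U" using Ssp r by (auto simp: open_nbhd_def eucl_dist_def L2_set_def intro!: bexI)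
        define d where "d = measure \<mu> ?U - measure \<mu> S"
        have d0: "0 \<le> d" using finite_measure_mono[OF SU] U by (simp add: d_def sets)
        let ?B = "space (lborel_pow n) - ?U"
        have mB: "measure \<mu> ?B = 1 - measure \<mu> S - d" using prob_compl[of ?U] U by (simp add: sets sp d_def)
        have "space (lborel_pow n) - S - ?B = ?U - S" using U[THEN sets.sets_into_space] by auto
        moreover have "measure \<mu> (?U - S) = d" using U S SU by (simp add: d_def sets finite_measure_Diff)
        ultimately have mG: "measure \<mu> (space (lborel_pow n) - S - ?B) = d" by simp
        have "min (measure \<mu> S) (measure \<mu> ?B) / 2 \<le> (21 + 160 * \<sigma> / r) * measure \<mu> (space (lborel_pow n) - S - ?B)"
        proof (rule three_sets_isotropic[OF P D L I _ r(1) S _ _ \<sigma>0 \<sigma>4])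
          show "r \<le> eucl_dist n x y" if "x \<in> S" "y \<in> ?B" for x y
            using that unfolding open_nbhd_def by (auto simp: eucl_dist_commute not_less)
        qed (use n U in auto)
        \<comment> \<open>The gap has mass \<open>d\<close>, and the complement of the neighbourhood
          has mass \<open>1 - measure \<mu> S - d\<close>, so the minimum is at least
          \<open>p - d\<close>. For \<open>r < \<sigma>\<close> the constant
          \<open>2 * 21 + 1 = 43\<close> is at most \<open>43 * \<sigma> / r\<close>, and
          \<open>43 + 2 * 160 = 363\<close>.\<close>
        then have "(p - d) / 2 \<le> (21 + 160 * \<sigma> / r) * d" unfolding mB mG using d0 by (auto simp: p_def min_def split: if_splits)
        then have "p \<le> (43 + 320 * \<sigma> / r) * d" by (simp add: algebra_simps)
        also have "\<dots> \<le> (363 * \<sigma> / r) * d"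
        proof (rule mult_right_mono[OF _ d0])
          have "43 \<le> 43 * \<sigma> / r" using r by (simp add: field_simps)
          then show "43 + 320 * \<sigma> / r \<le> 363 * \<sigma> / r" by (simp add: add_divide_distrib[symmetric])
        qed
        finally have "1 / (363 * \<sigma>) * p \<le> 1 / (363 * \<sigma>) * ((363 * \<sigma> / r) * d)" using \<sigma>0 by (intro mult_left_mono) auto
        then show ?thesis using \<sigma>0 r by (simp add: d_def)
      qed
      have "\<forall>\<^sub>F r in at_right 0. 0 < r \<and> r < \<sigma>" using \<sigma>0 by (intro eventually_at_rightI[of 0 \<sigma>]) auto
      then have "\<forall>\<^sub>F r in at_right 0. ereal (1 / (363 * \<sigma>) * p) \<le> ereal ((measure \<mu> (open_nbhd n r S) - measure \<mu> S) / r)"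
        by eventually_elim (use bound in auto)
      then have "ereal (1 / (363 * \<sigma>) * p) \<le> boundary_measure n \<mu> S"
        unfolding boundary_measure_def by (rule Liminf_bounded)
      then show ?thesis by (simp only: times_ereal.simps p_def)
    qed
    then show ?thesis using \<sigma>0 unfolding isoperimetric_bound_def c by auto
  qed
  then have "ereal (1 / (363 * K) * real n powr (- 5 / 12)) \<le> cheeger_const n \<mu>"
    if "1 \<le> n" "prob_space \<mu>" "has_density n \<mu> g" "log_concave_fun n g" "isotropic n \<mu>"
    for n and \<mu> :: "(nat \<Rightarrow> real) measure" and g
    using that unfolding cheeger_const_def by (intro Sup_upper) blast
  moreover have "0 < 1 / (363 * K)" using K by simp
  ultimately show ?thesis by blast
qed

end
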